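(* Assume $\mathrm{OCA}+\mathrm{MA}_{\aleph_1}$. Let $A_n$ and $B_n$, for $n\in\mathbb N$, be separable unital $C^*$-algebras with no nontrivial central projections. Suppose that each $A_n$ has the metric approximation property. Then all isomorphisms $\Lambda\colon\prod A_n/\bigoplus A_n\to\prod B_n/\bigoplus B_n$ are asymptotically algebraic.
   Context: $\prod A_n$ is the $C^*$-algebra of bounded sequences $(a_n)$ with $a_n\in A_n$, and $\bigoplus A_n$ the ideal of sequences with $\|a_n\|\to0$; $\pi_A\colon\prod A_n\to\prod A_n/\bigoplus A_n$ and $\pi_B\colon\prod B_n\to\prod B_n/\bigoplus B_n$ are the quotient maps. A central projection is nontrivial if it is neither $0$ nor $1$. An isomorphism $\Lambda\colon\prod A_n/\bigoplus A_n\to\prod B_n/\bigoplus B_n$ is asymptotically algebraic if there are finite $F_1,F_2\subseteq\mathbb N$, a bijection $g\colon\mathbb N\setminus F_1\to\mathbb N\setminus F_2$ and maps $\varphi_n\colon A_n\to B_{g(n)}$ (arbitrary functions) such that the map $\Phi\colon\prod A_n\to\prod B_n$ given by $\Phi(x)_m=\varphi_n(x_n)$ if $m=g(n)$, and $\Phi(x)_m=0$ if $m\in F_2$, is a lift of $\Lambda$, i.e. $\pi_B(\Phi(x))=\Lambda(\pi_A(x))$ for all $x\in\prod A_n$. Metric approximation property of a unital $C^*$-algebra $A$: for every finite $F\subseteq A$ and $\varepsilon>0$ there are a finite-dimensional operator system $E$ (a unital $^*$-closed linear subspace of some $\mathcal B(H)$) and unital linear contractions $\varphi\colon A\to E$,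 $\psi\colon E\to A$ with $\|\psi(\varphi(a))-a\|<\varepsilon$ for all $a\in F$. $\mathrm{OCA}$: for every separable metric space $X$ and every partition $[X]^2=K_0\cup K_1$ of the set of unordered pairs of $X$ with $K_0$ open, either $X=\bigcup_n X_n$ with $[X_n]^2\subseteq K_1$ for every $n\in\mathbb N$, or there is an uncountable $Y\subseteq X$ with $[Y]^2\subseteq K_0$. $\mathrm{MA}_{\aleph_1}$: for every ccc poset $\mathbb P$ and every family of $\aleph_1$ dense subsets of $\mathbb P$ there is a filter of $\mathbb P$ meeting all of them. *)

theory Defs
  imports
    "HOL-Analysis.Analysis"
    "HOL-Algebra.Module"
    "HOL-Algebra.QuotRing"
    "HOL-Library.Ramsey"
begin

unbundle cardinal_syntax

section \<open>Unital C*-algebras\<close>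

definition complex_ring :: "complex ring"
  where "complex_ring = \<lparr>carrier = UNIV, monoid.mult = (*), one = 1, zero = 0, add = (+)\<rparr>"

text \<open>Algebras are records with an explicit carrier, so that the members of a sequence of
  algebras may have different carriers inside one type.\<close>

record 'a cstar = "(complex, 'a) module" +
  adj :: "'a \<Rightarrow> 'a"
  nrm :: "'a \<Rightarrow> real"

text \<open>The value off the carrier only serves to make this a metric in the sense of
  \<^locale>\<open>Metric_space\<close>, which wants symmetry and nonnegativity on the whole type.\<close>

definition cstar_dist :: "'a cstar \<Rightarrow> 'a \<Rightarrow> 'a \<Rightarrow> real"
  where "cstar_dist A x y =
    (if x \<in> carrier A \<and> y \<in> carrier A then nrm A (x \<ominus>\<^bsub>A\<^esub> y) else 0)"

text \<open>The zero algebra is excluded: it satisfies \<open>0 = 1\<close>.\<close>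

locale unital_cstar_algebra = ring A + scalar: module complex_ring A
  for A :: "'a cstar" (structure) +
  assumes one_not_zero: "\<one> \<noteq> \<zero>"
    and smult_mult_left: "\<lbrakk>x \<in> carrier A; y \<in> carrier A\<rbrakk> \<Longrightarrow> (c \<odot> x) \<otimes> y = c \<odot> (x \<otimes> y)"
    and smult_mult_right: "\<lbrakk>x \<in> carrier A; y \<in> carrier A\<rbrakk> \<Longrightarrow> x \<otimes> (c \<odot> y) = c \<odot> (x \<otimes> y)"
    and adj_closed: "x \<in> carrier A \<Longrightarrow> adj A x \<in> carrier A"
    and adj_adj: "x \<in> carrier A \<Longrightarrow> adj A (adj A x) = x"
    and adj_add: "\<lbrakk>x \<in> carrier A; y \<in> carrier A\<rbrakk> \<Longrightarrow> adj A (x \<oplus> y) = adj A x \<oplus> adj A y"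
    and adj_smult: "x \<in> carrier A \<Longrightarrow> adj A (c \<odot> x) = cnj c \<odot> adj A x"
    and adj_mult: "\<lbrakk>x \<in> carrier A; y \<in> carrier A\<rbrakk> \<Longrightarrow> adj A (x \<otimes> y) = adj A y \<otimes> adj A x"
    and nrm_nonneg: "x \<in> carrier A \<Longrightarrow> 0 \<le> nrm A x"
    and nrm_eq_zero: "x \<in> carrier A \<Longrightarrow> nrm A x = 0 \<longleftrightarrow> x = \<zero>"
    and nrm_triangle: "\<lbrakk>x \<in> carrier A; y \<in> carrier A\<rbrakk> \<Longrightarrow> nrm A (x \<oplus> y) \<le> nrm A x + nrm A y"
    and nrm_smult: "x \<in> carrier A \<Longrightarrow> nrm A (c \<odot> x) = cmod c * nrm A x"
    and nrm_mult: "\<lbrakk>x \<in> carrier A; y \<in> carrier A\<rbrakk> \<Longrightarrow> nrm A (x \<otimes> y) \<le> nrm A x * nrm A y"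
    and cstar_identity: "x \<in> carrier A \<Longrightarrow> nrm A (adj A x \<otimes> x) = (nrm A x)\<^sup>2"
    and complete: "Metric_space.mcomplete (carrier A) (cstar_dist A)"

definition separable_cstar :: "'a cstar \<Rightarrow> bool"
  where "separable_cstar A \<longleftrightarrow>
    separable_space (Metric_space.mtopology (carrier A) (cstar_dist A))"

definition central_projection :: "'a cstar \<Rightarrow> 'a \<Rightarrow> bool"
  where "central_projection A p \<longleftrightarrow>
    p \<in> carrier A \<and> p \<otimes>\<^bsub>A\<^esub> p = p \<and> adj A p = p \<and>
    (\<forall>a\<in>carrier A. p \<otimes>\<^bsub>A\<^esub> a = a \<otimes>\<^bsub>A\<^esub> p)"

definition no_nontrivial_central_projections :: "'a cstar \<Rightarrow> bool"
  where "no_nontrivial_central_projections A \<longleftrightarrow>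
    (\<forall>p. central_projection A p \<longrightarrow> p = \<zero>\<^bsub>A\<^esub> \<or> p = \<one>\<^bsub>A\<^esub>)"

definition cstar_iso :: "'a cstar \<Rightarrow> 'b cstar \<Rightarrow> ('a \<Rightarrow> 'b) set"
  where "cstar_iso A B = {h \<in> ring_iso A B.
    (\<forall>c. \<forall>x\<in>carrier A. h (c \<odot>\<^bsub>A\<^esub> x) = c \<odot>\<^bsub>B\<^esub> h x) \<and>
    (\<forall>x\<in>carrier A. h (adj A x) = adj B (h x))}"


section \<open>Reduced products\<close>

definition cstar_prod :: "(nat \<Rightarrow> 'a cstar) \<Rightarrow> (nat \<Rightarrow> 'a) cstar"
  where "cstar_prod A =
    \<lparr>carrier = {x. (\<forall>n. x n \<in> carrier (A n)) \<and> (\<exists>K. \<forall>n. nrm (A n) (x n) \<le> K)},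
     monoid.mult = (\<lambda>x y n. x n \<otimes>\<^bsub>A n\<^esub> y n),
     one = (\<lambda>n. \<one>\<^bsub>A n\<^esub>),
     zero = (\<lambda>n. \<zero>\<^bsub>A n\<^esub>),
     add = (\<lambda>x y n. x n \<oplus>\<^bsub>A n\<^esub> y n),
     smult = (\<lambda>c x n. c \<odot>\<^bsub>A n\<^esub> x n),
     adj = (\<lambda>x n. adj (A n) (x n)),
     nrm = (\<lambda>x. SUP n. nrm (A n) (x n))\<rparr>"

definition cstar_sum :: "(nat \<Rightarrow> 'a cstar) \<Rightarrow> (nat \<Rightarrow> 'a) set"
  where "cstar_sum A =
    {x \<in> carrier (cstar_prod A). (\<lambda>n. nrm (A n) (x n)) \<longlonglongrightarrow> 0}"

text \<open>The ring structure is that of \<^const>\<open>FactRing\<close>; the remaining operations are defined on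
  cosets in the same style as \<^const>\<open>rcoset_mult\<close>.\<close>

definition cstar_quot :: "'a cstar \<Rightarrow> 'a set \<Rightarrow> 'a set cstar"
  where "cstar_quot A I =
    \<lparr>carrier = carrier (A Quot I),
     monoid.mult = monoid.mult (A Quot I),
     one = one (A Quot I),
     zero = zero (A Quot I),
     add = add (A Quot I),
     smult = (\<lambda>c X. \<Union>x\<in>X. I +>\<^bsub>A\<^esub> (c \<odot>\<^bsub>A\<^esub> x)),
     adj = (\<lambda>X. \<Union>x\<in>X. I +>\<^bsub>A\<^esub> adj A x),
     nrm = (\<lambda>X. INF x\<in>X. nrm A x)\<rparr>"

definition reduced_prod :: "(nat \<Rightarrow> 'a cstar) \<Rightarrow> (nat \<Rightarrow> 'a) set cstar"
  where "reduced_prod A = cstar_quot (cstar_prod A) (cstar_sum A)"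

definition reduced_proj :: "(nat \<Rightarrow> 'a cstar) \<Rightarrow> (nat \<Rightarrow> 'a) \<Rightarrow> (nat \<Rightarrow> 'a) set"
  where "reduced_proj A x = cstar_sum A +>\<^bsub>cstar_prod A\<^esub> x"

text \<open>In the next definition \<open>\<Phi>\<close> is determined by \<open>F\<^sub>2\<close>, \<open>g\<close> and \<open>\<phi>\<close>: the index \<open>n\<close> with
  \<open>m = g n\<close> is \<open>inv_into (- F\<^sub>1) g m\<close>.  The values \<open>g n\<close> and \<open>\<phi> n\<close> for \<open>n \<in> F\<^sub>1\<close> play no role.
  That \<open>\<Phi>\<close> takes bounded sequences to bounded sequences is part of the requirement.\<close>

definition coordinate_map ::
    "(nat \<Rightarrow> 'b cstar) \<Rightarrow> nat set \<Rightarrow> nat set \<Rightarrow> (nat \<Rightarrow> nat) \<Rightarrow> (nat \<Rightarrow> 'a \<Rightarrow> 'b)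
      \<Rightarrow> (nat \<Rightarrow> 'a) \<Rightarrow> nat \<Rightarrow> 'b"
  where "coordinate_map B F\<^sub>1 F\<^sub>2 g \<phi> x m =
    (if m \<in> F\<^sub>2 then \<zero>\<^bsub>B m\<^esub>
     else let n = inv_into (- F\<^sub>1) g m in \<phi> n (x n))"

definition asymptotically_algebraic ::
    "(nat \<Rightarrow> 'a cstar) \<Rightarrow> (nat \<Rightarrow> 'b cstar) \<Rightarrow> ((nat \<Rightarrow> 'a) set \<Rightarrow> (nat \<Rightarrow> 'b) set) \<Rightarrow> bool"
  where "asymptotically_algebraic A B \<Lambda> \<longleftrightarrow>
    (\<exists>F\<^sub>1 F\<^sub>2 g \<phi>. finite F\<^sub>1 \<and> finite F\<^sub>2 \<and> bij_betw g (- F\<^sub>1) (- F\<^sub>2) \<and>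
      (\<forall>n\<in>- F\<^sub>1. \<phi> n \<in> carrier (A n) \<rightarrow> carrier (B (g n))) \<and>
      (\<forall>x\<in>carrier (cstar_prod A).
        coordinate_map B F\<^sub>1 F\<^sub>2 g \<phi> x \<in> carrier (cstar_prod B) \<and>
        reduced_proj B (coordinate_map B F\<^sub>1 F\<^sub>2 g \<phi> x) = \<Lambda> (reduced_proj A x)))"


section \<open>Bounded operators on a Hilbert space\<close>

record 'h hilbert = "(complex, 'h) module" +
  ip :: "'h \<Rightarrow> 'h \<Rightarrow> complex"

definition hnorm :: "'h hilbert \<Rightarrow> 'h \<Rightarrow> real"
  where "hnorm H x = sqrt (Re (ip H x x))"

definition hilbert_dist :: "'h hilbert \<Rightarrow> 'h \<Rightarrow> 'h \<Rightarrow> real"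
  where "hilbert_dist H x y =
    (if x \<in> carrier H \<and> y \<in> carrier H then hnorm H (x \<ominus>\<^bsub>H\<^esub> y) else 0)"

locale hilbert_space = module complex_ring H for H :: "'h hilbert" (structure) +
  assumes ip_add_left: "\<lbrakk>x \<in> carrier H; y \<in> carrier H; z \<in> carrier H\<rbrakk> \<Longrightarrow>
      ip H (x \<oplus>\<^bsub>H\<^esub> y) z = ip H x z + ip H y z"
    and ip_smult_left: "\<lbrakk>x \<in> carrier H; y \<in> carrier H\<rbrakk> \<Longrightarrow> ip H (c \<odot>\<^bsub>H\<^esub> x) y = c * ip H x y"
    and ip_cnj: "\<lbrakk>x \<in> carrier H; y \<in> carrier H\<rbrakk> \<Longrightarrow> ip H y x = cnj (ip H x y)"
    and ip_nonneg: "x \<in> carrier H \<Longrightarrow> 0 \<le> Re (ip H x x)"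
    and ip_eq_zero: "x \<in> carrier H \<Longrightarrow> ip H x x = 0 \<longleftrightarrow> x = \<zero>\<^bsub>H\<^esub>"
    and complete: "Metric_space.mcomplete (carrier H) (hilbert_dist H)"

definition bounded_operators :: "'h hilbert \<Rightarrow> ('h \<Rightarrow> 'h) set"
  where "bounded_operators H = {T \<in> carrier H \<rightarrow>\<^sub>E carrier H.
    (\<forall>x\<in>carrier H. \<forall>y\<in>carrier H. T (x \<oplus>\<^bsub>H\<^esub> y) = T x \<oplus>\<^bsub>H\<^esub> T y) \<and>
    (\<forall>c. \<forall>x\<in>carrier H. T (c \<odot>\<^bsub>H\<^esub> x) = c \<odot>\<^bsub>H\<^esub> T x) \<and>
    (\<exists>K. \<forall>x\<in>carrier H. hnorm H (T x) \<le> K * hnorm H x)}"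

definition operator_algebra :: "'h hilbert \<Rightarrow> ('h \<Rightarrow> 'h) cstar"
  where "operator_algebra H =
    \<lparr>carrier = bounded_operators H,
     monoid.mult = (\<lambda>S T. compose (carrier H) S T),
     one = (\<lambda>x\<in>carrier H. x),
     zero = (\<lambda>x\<in>carrier H. \<zero>\<^bsub>H\<^esub>),
     add = (\<lambda>S T. \<lambda>x\<in>carrier H. S x \<oplus>\<^bsub>H\<^esub> T x),
     smult = (\<lambda>c T. \<lambda>x\<in>carrier H. c \<odot>\<^bsub>H\<^esub> T x),
     adj = (\<lambda>T. THE S. S \<in> bounded_operators H \<and>
              (\<forall>x\<in>carrier H. \<forall>y\<in>carrier H. ip H (T x) y = ip H x (S y))),
     nrm = (\<lambda>T. SUP x\<in>{x \<in> carrier H. hnorm H x \<le> 1}. hnorm H (T x))\<rparr>"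


section \<open>The metric approximation property\<close>

definition operator_system :: "'h hilbert \<Rightarrow> ('h \<Rightarrow> 'h) set \<Rightarrow> bool"
  where "operator_system H E \<longleftrightarrow>
    submodule E complex_ring (operator_algebra H) \<and>
    \<one>\<^bsub>operator_algebra H\<^esub> \<in> E \<and>
    (\<forall>T\<in>E. adj (operator_algebra H) T \<in> E)"

definition finite_dim_subspace :: "'a cstar \<Rightarrow> 'a set \<Rightarrow> bool"
  where "finite_dim_subspace A V \<longleftrightarrow>
    (\<exists>S. finite S \<and> S \<subseteq> V \<and>
      (\<forall>x\<in>V. \<exists>c :: 'a \<Rightarrow> complex. x = (\<Oplus>\<^bsub>A\<^esub>s\<in>S. c s \<odot>\<^bsub>A\<^esub> s)))"

text \<open>Here \<open>V\<close> and \<open>W\<close> are unital subspaces of the algebras \<open>A\<close> and \<open>B\<close>, with the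
  inherited norms.\<close>

definition unital_linear_contraction ::
    "'a cstar \<Rightarrow> 'a set \<Rightarrow> 'b cstar \<Rightarrow> 'b set \<Rightarrow> ('a \<Rightarrow> 'b) \<Rightarrow> bool"
  where "unital_linear_contraction A V B W f \<longleftrightarrow>
    f \<in> V \<rightarrow> W \<and>
    (\<forall>x\<in>V. \<forall>y\<in>V. f (x \<oplus>\<^bsub>A\<^esub> y) = f x \<oplus>\<^bsub>B\<^esub> f y) \<and>
    (\<forall>c. \<forall>x\<in>V. f (c \<odot>\<^bsub>A\<^esub> x) = c \<odot>\<^bsub>B\<^esub> f x) \<and>
    f \<one>\<^bsub>A\<^esub> = \<one>\<^bsub>B\<^esub> \<and>
    (\<forall>x\<in>V. nrm B (f x) \<le> nrm A x)"

text \<open>The type argument bounds the Hilbert spaces: they have carriers inside \<open>'h\<close>.  HOL cannot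
  quantify over \<open>'h\<close> inside a formula, but this existential only occurs in hypotheses, where
  a free type variable \<open>'h\<close> gives the unrestricted notion.\<close>

definition metric_approximation_property :: "'h itself \<Rightarrow> 'a cstar \<Rightarrow> bool"
  where "metric_approximation_property _ A \<longleftrightarrow>
    (\<forall>F \<epsilon>. finite F \<longrightarrow> F \<subseteq> carrier A \<longrightarrow> 0 < \<epsilon> \<longrightarrow>
      (\<exists>(H :: 'h hilbert) E \<phi> \<psi>.
        hilbert_space H \<and> operator_system H E \<and> finite_dim_subspace (operator_algebra H) E \<and>
        unital_linear_contraction A (carrier A) (operator_algebra H) E \<phi> \<and>
        unital_linear_contraction (operator_algebra H) E A (carrier A) \<psi> \<and>
        (\<forall>a\<in>F. nrm A (\<psi> (\<phi> a) \<ominus>\<^bsub>A\<^esub> a) < \<epsilon>)))"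


section \<open>Set-theoretic axioms\<close>

text \<open>Openness of a set of unordered pairs is openness of the corresponding symmetric set of
  ordered pairs.\<close>

definition open_colouring_dichotomy :: "'x set \<Rightarrow> ('x \<Rightarrow> 'x \<Rightarrow> real) \<Rightarrow> bool"
  where "open_colouring_dichotomy X d \<longleftrightarrow>
    (\<forall>K\<^sub>0 K\<^sub>1. nsets X 2 = K\<^sub>0 \<union> K\<^sub>1 \<and> K\<^sub>0 \<inter> K\<^sub>1 = {} \<and>
      openin (prod_topology (Metric_space.mtopology X d) (Metric_space.mtopology X d))
        {(x, y). x \<in> X \<and> y \<in> X \<and> {x, y} \<in> K\<^sub>0} \<longrightarrow>
      (\<exists>Z :: nat \<Rightarrow> 'x set. X = (\<Union>n. Z n) \<and> (\<forall>n. nsets (Z n) 2 \<subseteq> K\<^sub>1)) \<or>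
      (\<exists>Y. Y \<subseteq> X \<and> uncountable Y \<and> nsets Y 2 \<subseteq> K\<^sub>0))"

text \<open>A separable metric space has at most continuum many points, so it suffices to consider
  (arbitrary) metrics on sets of reals; see \<open>OCA_any_type\<close> below.\<close>

definition OCA :: bool
  where "OCA \<longleftrightarrow>
    (\<forall>(X :: real set) d. Metric_space X d \<longrightarrow> separable_space (Metric_space.mtopology X d) \<longrightarrow>
      open_colouring_dichotomy X d)"

text \<open>A pair \<open>(p, q) \<in> r\<close> means that \<open>p \<le> q\<close>, i.e. \<open>p\<close> is the stronger condition.\<close>

definition forcing_compatible :: "'p set \<Rightarrow> 'p rel \<Rightarrow> 'p \<Rightarrow> 'p \<Rightarrow> bool"
  where "forcing_compatible P r p q \<longleftrightarrow> (\<exists>s\<in>P. (s, p) \<in> r \<and> (s, q) \<in> r)"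

definition forcing_ccc :: "'p set \<Rightarrow> 'p rel \<Rightarrow> bool"
  where "forcing_ccc P r \<longleftrightarrow>
    (\<forall>C\<subseteq>P. (\<forall>p\<in>C. \<forall>q\<in>C. p \<noteq> q \<longrightarrow> \<not> forcing_compatible P r p q) \<longrightarrow> countable C)"

definition forcing_dense :: "'p set \<Rightarrow> 'p rel \<Rightarrow> 'p set \<Rightarrow> bool"
  where "forcing_dense P r D \<longleftrightarrow> D \<subseteq> P \<and> (\<forall>p\<in>P. \<exists>q\<in>D. (q, p) \<in> r)"

definition forcing_filter :: "'p set \<Rightarrow> 'p rel \<Rightarrow> 'p set \<Rightarrow> bool"
  where "forcing_filter P r G \<longleftrightarrow>
    G \<subseteq> P \<and> G \<noteq> {} \<and>
    (\<forall>p\<in>G. \<forall>q\<in>P. (p, q) \<in> r \<longrightarrow> q \<in> G) \<and>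
    (\<forall>p\<in>G. \<forall>q\<in>G. \<exists>s\<in>G. (s, p) \<in> r \<and> (s, q) \<in> r)"

definition MA_aleph1_at :: "'p set \<Rightarrow> 'p rel \<Rightarrow> bool"
  where "MA_aleph1_at P r \<longleftrightarrow>
    (\<forall>\<D>. |\<D>| \<le>o cardSuc natLeq \<longrightarrow> (\<forall>D\<in>\<D>. forcing_dense P r D) \<longrightarrow>
      (\<exists>G. forcing_filter P r G \<and> (\<forall>D\<in>\<D>. G \<inter> D \<noteq> {})))"

text \<open>Given \<open>\<aleph>\<^sub>1\<close> dense sets one can pass to a suitable subposet of size at most \<open>\<aleph>\<^sub>1\<close>, so it
  suffices to consider (arbitrary) partial orders on sets of reals; see \<open>MA_aleph1_any_type\<close>
  below.\<close>

definition MA_aleph1 :: bool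
  where "MA_aleph1 \<longleftrightarrow>
    (\<forall>(P :: real set) r. P \<noteq> {} \<longrightarrow> partial_order_on P r \<longrightarrow> forcing_ccc P r \<longrightarrow>
      MA_aleph1_at P r)"


section \<open>Adequacy of the set-theoretic axioms for arbitrary types\<close>

lemma separable_metric_card:
  fixes X :: "'x set"
  assumes M: "Metric_space X d" and sep: "separable_space (Metric_space.mtopology X d)"
  obtains h :: "'x \<Rightarrow> real" where "inj_on h X"
proof -
  interpret Metric_space X d by (rule M)
  obtain S where S: "countable S" "S \<subseteq> X" "mtopology closure_of S = X"
    using sep unfolding separable_space_def by auto
  define k where "k x = {(s, n :: nat). s \<in> S \<and> d x s < inverse (real (Suc n))}" for x
  have "inj_on k X"
  proof (rule inj_onI)
    fix x y assume xy: "x \<in> X" "y \<in> X" "k x = k y"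
    show "x = y"
    proof (rule ccontr)
      assume "x \<noteq> y"
      then have "d x y > 0" using xy nonneg[of x y] zero[of x y] by linarith
      then obtain n where n: "inverse (real (Suc n)) < d x y / 2"
        using reals_Archimedean[of "d x y / 2"] by auto
      have "x \<in> mtopology closure_of S" using S(3) xy by simp
      then obtain s where "s \<in> S" "d x s < inverse (real (Suc n))"
        unfolding metric_closure_of by (auto dest!: spec[of _ "inverse (real (Suc n))"])
      moreover from this have "d y s < inverse (real (Suc n))"
        using xy(3) unfolding k_def by blast
      ultimately show False
        using triangle[of x s y] commute[of s y] xy S(2) n by auto
    qed
  qed
  moreover have "countable (S \<times> (UNIV :: nat set))" using S(1) by blast
  then have "inj_on ((`) (to_nat_on (S \<times> (UNIV :: nat set)))) (Pow (S \<times> UNIV))"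
    by (intro inj_on_image_Pow inj_on_to_nat_on)
  moreover have "k ` X \<subseteq> Pow (S \<times> UNIV)" unfolding k_def by auto
  ultimately have "inj_on ((`) (to_nat_on (S \<times> (UNIV :: nat set))) \<circ> k) X"
    by (meson comp_inj_on inj_on_subset)
  moreover obtain e :: "nat set \<Rightarrow> real" where "inj e"
    using eqpoll_imp_lepoll[OF nat_sets_eqpoll_reals] unfolding lepoll_def by blast
  ultimately have "inj_on (e \<circ> ((`) (to_nat_on (S \<times> (UNIV :: nat set))) \<circ> k)) X"
    by (meson comp_inj_on inj_on_subset subset_UNIV)
  then show ?thesis by (rule that)
qed


lemma openin_prod_metric:
  assumes "Metric_space X d"
  shows "openin (prod_topology (Metric_space.mtopology X d) (Metric_space.mtopology X d)) W \<longleftrightarrow>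
    (\<forall>x y. (x, y) \<in> W \<longrightarrow> x \<in> X \<and> y \<in> X \<and>
      (\<exists>e>0. \<forall>u\<in>X. \<forall>v\<in>X. d x u < e \<longrightarrow> d y v < e \<longrightarrow> (u, v) \<in> W))" (is "?L \<longleftrightarrow> ?R")
proof -
  interpret Metric_space X d by fact
  show ?thesis
  proof
    assume L: ?L
    show ?R
    proof (intro allI impI)
      fix x y assume "(x, y) \<in> W"
      then obtain U V where UV: "openin mtopology U" "openin mtopology V" "x \<in> U" "y \<in> V" "U \<times> V \<subseteq> W"
        using L unfolding openin_prod_topology_alt by meson
      obtain e1 where e1: "e1 > 0" "mball x e1 \<subseteq> U" using UV unfolding openin_mtopology by meson
      obtain e2 where e2: "e2 > 0" "mball y e2 \<subseteq> V" using UV unfolding openin_mtopology by meson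
      have xy: "x \<in> X" "y \<in> X" using UV unfolding openin_mtopology by auto
      moreover have "\<forall>u\<in>X. \<forall>v\<in>X. d x u < min e1 e2 \<longrightarrow> d y v < min e1 e2 \<longrightarrow> (u, v) \<in> W"
        using e1(2) e2(2) UV(5) xy by (auto simp: mball_def)
      ultimately show "x \<in> X \<and> y \<in> X \<and>
        (\<exists>e>0. \<forall>u\<in>X. \<forall>v\<in>X. d x u < e \<longrightarrow> d y v < e \<longrightarrow> (u, v) \<in> W)"
        using e1(1) e2(1) by (metis min_less_iff_conj)
    qed
  next
    assume R: ?R
    show ?L
      unfolding openin_prod_topology_alt
    proof (intro allI impI)
      fix x y assume "(x, y) \<in> W"
      then obtain e where e: "e > 0" "x \<in> X" "y \<in> X"
        "\<forall>u\<in>X. \<forall>v\<in>X. d x u < e \<longrightarrow> d y v < e \<longrightarrow> (u, v) \<in> W" using R by meson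
      have "mball x e \<times> mball y e \<subseteq> W" using e(4) by (auto simp: mball_def)
      then show "\<exists>U V. openin mtopology U \<and> openin mtopology V \<and> x \<in> U \<and> y \<in> V \<and> U \<times> V \<subseteq> W"
        using e by (meson centre_in_mball_iff openin_mball)
    qed
  qed
qed

lemma nsets2_iff: "e \<in> nsets Z 2 \<longleftrightarrow> (\<exists>x y. x \<in> Z \<and> y \<in> Z \<and> x \<noteq> y \<and> e = {x, y})"
  by (auto simp: nsets_def card_2_iff)

lemma OCA_any_type:
  fixes X :: "'x set"
  assumes OCA and M: "Metric_space X d" and sep: "separable_space (Metric_space.mtopology X d)"
  shows "open_colouring_dichotomy X d"
  unfolding open_colouring_dichotomy_def
proof (intro allI impI, elim conjE)
  fix K0 K1
  assume K: "nsets X 2 = K0 \<union> K1" "K0 \<inter> K1 = {}"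
    and op: "openin (prod_topology (Metric_space.mtopology X d) (Metric_space.mtopology X d))
        {(x, y). x \<in> X \<and> y \<in> X \<and> {x, y} \<in> K0}"
  obtain h :: "'x \<Rightarrow> real" where h: "inj_on h X" using separable_metric_card[OF M sep] by blast
  define k where "k = inv_into X h"
  have kh: "k (h x) = x" if "x \<in> X" for x using that h by (simp add: k_def)
  define Y where "Y = h ` X"
  have hk: "h (k y) = y" "k y \<in> X" if "y \<in> Y" for y
    using that kh unfolding Y_def by auto
  define d' where "d' a b = d (k a) (k b)" for a b
  interpret M: Metric_space X d by (rule M)
  interpret M': Metric_space Y d'
  proof
    show "0 \<le> d' x y" "d' x y = d' y x" for x y by (simp_all add: d'_def M.commute)
    show "(d' x y = 0) = (x = y)" if "x \<in> Y" "y \<in> Y" for x y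
      using hk that M.zero unfolding d'_def by metis
    show "d' x z \<le> d' x y + d' y z" if "x \<in> Y" "y \<in> Y" "z \<in> Y" for x y z
      using hk that M.triangle unfolding d'_def by blast
  qed
  have "separable_space M'.mtopology"
  proof -
    obtain S where S: "countable S" "S \<subseteq> X" "M.mtopology closure_of S = X"
      using sep unfolding separable_space_def by auto
    have "Y \<subseteq> M'.mtopology closure_of (h ` S)"
    proof
      fix y assume y: "y \<in> Y"
      then have "k y \<in> M.mtopology closure_of S" using S(3) hk by simp
      then have *: "\<exists>s\<in>S. d (k y) s < e" if "e > 0" for e
        using that unfolding M.metric_closure_of by auto
      have "\<exists>t\<in>h ` S. t \<in> Y \<and> d' y t < e" if "e > 0" for e
        using *[OF that] kh S(2) unfolding d'_def Y_def by (metis image_eqI subsetD)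
      then show "y \<in> M'.mtopology closure_of (h ` S)"
        using y unfolding M'.metric_closure_of by auto
    qed
    then have "M'.mtopology closure_of (h ` S) = Y"
      using closure_of_subset_topspace[of M'.mtopology] by auto
    moreover have "countable (h ` S)" "h ` S \<subseteq> Y" using S unfolding Y_def by auto
    ultimately show ?thesis unfolding separable_space_def by auto
  qed
  then have dich: "open_colouring_dichotomy Y d'"
    using \<open>OCA\<close> M'.Metric_space_axioms unfolding OCA_def by blast
  define L where "L i = {e \<in> nsets Y 2. k ` e \<in> i}" for i
  have kY: "k ` e \<in> nsets X 2" if e: "e \<in> nsets Y 2" for e
  proof -
    obtain x y where xy: "x \<in> Y" "y \<in> Y" "x \<noteq> y" "e = {x, y}"
      using e unfolding nsets2_iff by blast
    then have "k x \<noteq> k y" using hk(1) by metis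
    then show ?thesis using xy hk(2) unfolding nsets2_iff by auto
  qed
  have L: "nsets Y 2 = L K0 \<union> L K1" "L K0 \<inter> L K1 = {}"
    using K kY unfolding L_def by blast+
  have pair: "{x, y} \<in> L K0 \<longleftrightarrow> {k x, k y} \<in> K0" if "x \<in> Y" "y \<in> Y" for x y
  proof
    assume "{k x, k y} \<in> K0"
    moreover from this have "k x \<noteq> k y" 
      using K(1) by (metis UnI1 card_2_iff doubleton_eq_iff nsets2_iff)
    ultimately show "{x, y} \<in> L K0" using that unfolding L_def nsets2_iff by auto
  qed (auto simp: L_def)
  have "openin (prod_topology M'.mtopology M'.mtopology) {(x, y). x \<in> Y \<and> y \<in> Y \<and> {x, y} \<in> L K0}"
    unfolding openin_prod_metric[OF M'.Metric_space_axioms]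
  proof (intro allI impI)
    fix x y assume "(x, y) \<in> {(x, y). x \<in> Y \<and> y \<in> Y \<and> {x, y} \<in> L K0}"
    then have xy: "x \<in> Y" "y \<in> Y" "{x, y} \<in> L K0" by auto
    then have "(k x, k y) \<in> {(x, y). x \<in> X \<and> y \<in> X \<and> {x, y} \<in> K0}" using pair hk by auto
    then obtain e where e: "e > 0"
      "\<forall>u\<in>X. \<forall>v\<in>X. d (k x) u < e \<longrightarrow> d (k y) v < e \<longrightarrow> (u, v) \<in> {(x, y). x \<in> X \<and> y \<in> X \<and> {x, y} \<in> K0}"
      using op unfolding openin_prod_metric[OF M] by meson
    then have "\<exists>e>0. \<forall>u\<in>Y. \<forall>v\<in>Y. d' x u < e \<longrightarrow> d' y v < e \<longrightarrow>
        (u, v) \<in> {(x, y). x \<in> Y \<and> y \<in> Y \<and> {x, y} \<in> L K0}"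
      using hk pair unfolding d'_def by (intro exI[of _ e]) auto
    with xy show "x \<in> Y \<and> y \<in> Y \<and> (\<exists>e>0. \<forall>u\<in>Y. \<forall>v\<in>Y. d' x u < e \<longrightarrow> d' y v < e \<longrightarrow>
        (u, v) \<in> {(x, y). x \<in> Y \<and> y \<in> Y \<and> {x, y} \<in> L K0})" by blast
  qed
  with dich L consider
      (Z) Z :: "nat \<Rightarrow> real set" where "Y = (\<Union>n. Z n)" "\<forall>n. nsets (Z n) 2 \<subseteq> L K1"
    | (U) U where "U \<subseteq> Y" "uncountable U" "nsets U 2 \<subseteq> L K0"
    unfolding open_colouring_dichotomy_def by meson
  then show "(\<exists>Z :: nat \<Rightarrow> 'x set. X = (\<Union>n. Z n) \<and> (\<forall>n. nsets (Z n) 2 \<subseteq> K1)) \<or>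
      (\<exists>Y. Y \<subseteq> X \<and> uncountable Y \<and> nsets Y 2 \<subseteq> K0)"
  proof cases
    case Z
    have "X = k ` Y" using kh unfolding Y_def by force
    then have "X = (\<Union>n. k ` Z n)" using Z(1) by blast
    moreover have "nsets (k ` Z n) 2 \<subseteq> K1" for n
    proof
      fix e assume "e \<in> nsets (k ` Z n) 2"
      then obtain a b where "a \<in> Z n" "b \<in> Z n" "k a \<noteq> k b" "e = {k a, k b}"
        unfolding nsets2_iff by blast
      moreover from this have "{a, b} \<in> L K1" using Z(2) nsets2_iff by blast
      ultimately show "e \<in> K1" unfolding L_def by simp
    qed
    ultimately show ?thesis by blast
  next
    case U
    have "inj_on k U" by (rule inj_on_inverseI[of _ h]) (use U(1) hk(1) in blast)
    then have "uncountable (k ` U)" using U(2) countable_image_inj_on by blast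
    moreover have "k ` U \<subseteq> X" using U(1) hk by blast
    moreover have "nsets (k ` U) 2 \<subseteq> K0"
    proof
      fix e assume "e \<in> nsets (k ` U) 2"
      then obtain a b where "a \<in> U" "b \<in> U" "k a \<noteq> k b" "e = {k a, k b}"
        unfolding nsets2_iff by blast
      moreover from this have "{a, b} \<in> L K0" using U(3) nsets2_iff by blast
      ultimately show "e \<in> K0" unfolding L_def by simp
    qed
    ultimately show ?thesis by blast
  qed
qed

lemma card_of_le_real_times: 
  assumes "|A| \<le>o |UNIV::real set|" "|B| \<le>o |UNIV::real set|"
  shows "|A \<times> B| \<le>o |UNIV::real set|"
  using assms by (intro card_of_Times_ordLeq_infinite_Field)
    (auto simp: infinite_UNIV_char_0 Field_card_of card_of_card_order_on)

lemma aleph1_le_real: "cardSuc natLeq \<le>o |UNIV :: real set|"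
proof -
  have "\<not> |UNIV :: real set| \<le>o natLeq"
  proof
    assume "|UNIV :: real set| \<le>o natLeq"
    then have "|UNIV :: real set| \<le>o |UNIV :: nat set|"
      using card_of_nat ordIso_symmetric ordLeq_ordIso_trans by blast
    then have "countable (UNIV :: real set)"
      by (auto simp flip: card_of_ordLeq intro: countableI)
    then show False using uncountable_UNIV_real by blast
  qed
  then have "natLeq <o |UNIV :: real set|"
    by (simp add: natLeq_Well_order card_of_Well_order not_ordLeq_iff_ordLess)
  then show ?thesis
    using cardSuc_ordLess_ordLeq[OF natLeq_Card_order card_of_Card_order] by blast
qed

lemma small_subposet:
  fixes P :: "'p set" and r :: "'p rel"
  assumes "p0 \<in> P" and D: "\<forall>D\<in>\<D>. forcing_dense P r D" and card: "|\<D>| \<le>o |UNIV::real set|"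
  obtains Q where "p0 \<in> Q" "Q \<subseteq> P" "|Q| \<le>o |UNIV::real set|"
    "\<And>D p. D \<in> \<D> \<Longrightarrow> p \<in> Q \<Longrightarrow> \<exists>q\<in>D \<inter> Q. (q, p) \<in> r"
    "\<And>p q. p \<in> Q \<Longrightarrow> q \<in> Q \<Longrightarrow> forcing_compatible P r p q \<Longrightarrow> \<exists>s\<in>Q. (s, p) \<in> r \<and> (s, q) \<in> r"
proof -
  define f where "f = (\<lambda>(D, p). SOME q. q \<in> D \<and> (q, p) \<in> r)"
  define g where "g = (\<lambda>(p, q). SOME s. s \<in> P \<and> (forcing_compatible P r p q \<longrightarrow> (s, p) \<in> r \<and> (s, q) \<in> r))"
  have f: "f (D, p) \<in> D \<and> (f (D, p), p) \<in> r" if "D \<in> \<D>" "p \<in> P" for D p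
    using D that unfolding f_def forcing_dense_def by simp (rule someI_ex, blast)
  have fP: "f (D, p) \<in> P" if "D \<in> \<D>" "p \<in> P" for D p
    using f[OF that] D that unfolding forcing_dense_def by blast
  have g: "g (p, q) \<in> P \<and> (forcing_compatible P r p q \<longrightarrow> (g (p, q), p) \<in> r \<and> (g (p, q), q) \<in> r)" for p q
  proof -
    have "\<exists>s. s \<in> P \<and> (forcing_compatible P r p q \<longrightarrow> (s, p) \<in> r \<and> (s, q) \<in> r)"
      unfolding forcing_compatible_def using assms(1) by blast
    from someI_ex[OF this] show ?thesis unfolding g_def by simp
  qed
  define S where "S = rec_nat {p0} (\<lambda>_ T. T \<union> f ` (\<D> \<times> T) \<union> g ` (T \<times> T))"
  have S0: "S 0 = {p0}" and SS: "\<And>n. S (Suc n) = S n \<union> f ` (\<D> \<times> S n) \<union> g ` (S n \<times> S n)"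
    by (simp_all add: S_def)
  have mono: "S m \<subseteq> S n" if "m \<le> n" for m n
    using that by (rule lift_Suc_mono_le[rotated]) (auto simp: SS)
  have sub: "S n \<subseteq> P" for n
    by (induction n) (use assms(1) fP g in \<open>auto simp: S0 SS\<close>)
  have cS: "|S n| \<le>o |UNIV::real set|" for n
  proof (induction n)
    case 0
    then show ?case by (simp add: S0 card_of_singl_ordLeq)
  next
    case (Suc n)
    have "|f ` (\<D> \<times> S n)| \<le>o |UNIV::real set|" "|g ` (S n \<times> S n)| \<le>o |UNIV::real set|"
      using card_of_le_real_times[OF card Suc] card_of_le_real_times[OF Suc Suc]
        card_of_image ordLeq_transitive by blast+
    then show ?case unfolding SS using Suc
      by (intro card_of_Un_ordLeq_infinite_Field) (auto simp: infinite_UNIV_char_0 Field_card_of card_of_card_order_on)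
  qed
  let ?Q = "\<Union>n. S n"
  show ?thesis
  proof
    show "p0 \<in> ?Q" using S0 by blast
    show "?Q \<subseteq> P" using sub by blast
    show "|?Q| \<le>o |UNIV::real set|"
      using cS by (intro card_of_UNION_ordLeq_infinite)
        (auto simp: infinite_UNIV_char_0 infinite_iff_card_of_nat[symmetric])
  next
    fix D p assume "D \<in> \<D>" "p \<in> ?Q"
    then obtain n where "p \<in> S n" by blast
    then have "f (D, p) \<in> S (Suc n)" using \<open>D \<in> \<D>\<close> SS by blast
    then show "\<exists>q\<in>D \<inter> ?Q. (q, p) \<in> r" using f[OF \<open>D \<in> \<D>\<close>] sub \<open>p \<in> S n\<close> by blast
  next
    fix p q assume "p \<in> ?Q" "q \<in> ?Q" and c: "forcing_compatible P r p q"
    then obtain m n where "p \<in> S m" "q \<in> S n" by blast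
    then have "p \<in> S (max m n)" "q \<in> S (max m n)" using mono by (meson max.cobounded1 max.cobounded2 subsetD)+
    then have "g (p, q) \<in> S (Suc (max m n))" using SS by blast
    then show "\<exists>s\<in>?Q. (s, p) \<in> r \<and> (s, q) \<in> r" using g c by blast
  qed
qed

lemma MA_aleph1_any_type:
  fixes P :: "'p set"
  assumes MA: "MA_aleph1" and P: "P \<noteq> {}" and r: "partial_order_on P r" and ccc: "forcing_ccc P r"
  shows "MA_aleph1_at P r"
  unfolding MA_aleph1_at_def
proof (intro allI impI)
  fix \<D> :: "'p set set"
  assume card: "|\<D>| \<le>o cardSuc natLeq" and D: "\<forall>D\<in>\<D>. forcing_dense P r D"
  have rr: "r \<subseteq> P \<times> P" "refl_on P r" "trans r" "antisym r"
    using partial_order_onD[OF r] by auto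
  obtain p0 where "p0 \<in> P" using P by blast
  then obtain Q where Q: "p0 \<in> Q" "Q \<subseteq> P" "|Q| \<le>o |UNIV::real set|"
    and QD: "\<And>D p. D \<in> \<D> \<Longrightarrow> p \<in> Q \<Longrightarrow> \<exists>q\<in>D \<inter> Q. (q, p) \<in> r"
    and Qc: "\<And>p q. p \<in> Q \<Longrightarrow> q \<in> Q \<Longrightarrow> forcing_compatible P r p q \<Longrightarrow> \<exists>s\<in>Q. (s, p) \<in> r \<and> (s, q) \<in> r"
    using small_subposet[OF _ D ordLeq_transitive[OF card aleph1_le_real]] by blast
  from Q(3) obtain h :: "'p \<Rightarrow> real" where h: "inj_on h Q"
    by (meson card_of_ordLeq)
  define r' where "r' = {(h p, h q) | p q. p \<in> Q \<and> q \<in> Q \<and> (p, q) \<in> r}"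
  have r'_iff: "(h p, h q) \<in> r' \<longleftrightarrow> (p, q) \<in> r" if "p \<in> Q" "q \<in> Q" for p q
    using that h unfolding r'_def inj_on_def by blast
  have r'_dom: "r' \<subseteq> h ` Q \<times> h ` Q"
    unfolding r'_def by blast
  have po: "partial_order_on (h ` Q) r'"
    unfolding partial_order_on_def preorder_on_def
  proof (intro conjI)
    show "r' \<subseteq> h ` Q \<times> h ` Q" by (rule r'_dom)
    show "refl_on (h ` Q) r'"
      using rr(2) Q(2) r'_iff by (auto simp: refl_on_def)
    show "trans r'"
    proof (rule transI)
      fix x y z assume xy: "(x, y) \<in> r'" and yz: "(y, z) \<in> r'"
      then obtain p q s where "x = h p" "y = h q" "z = h s" "p \<in> Q" "q \<in> Q" "s \<in> Q"
        using r'_dom by blast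
      then show "(x, z) \<in> r'" using xy yz r'_iff rr(3) by (metis transD)
    qed
    show "antisym r'"
    proof (rule antisymI)
      fix x y assume xy: "(x, y) \<in> r'" and yx: "(y, x) \<in> r'"
      then obtain p q where "x = h p" "y = h q" "p \<in> Q" "q \<in> Q"
        using r'_dom by blast
      then show "x = y" using xy yx r'_iff rr(4) by (metis antisymD)
    qed
  qed
  have compat: "forcing_compatible (h ` Q) r' (h p) (h q)"
    if "p \<in> Q" "q \<in> Q" "forcing_compatible P r p q" for p q
    using Qc[OF that] that r'_iff unfolding forcing_compatible_def by blast
  have ccc': "forcing_ccc (h ` Q) r'"
    unfolding forcing_ccc_def
  proof (intro allI impI)
    fix C assume "C \<subseteq> h ` Q" and anti: "\<forall>p\<in>C. \<forall>q\<in>C. p \<noteq> q \<longrightarrow> \<not> forcing_compatible (h ` Q) r' p q"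
    then obtain B where B: "B \<subseteq> Q" "C = h ` B" by (meson subset_imageE)
    have "\<forall>p\<in>B. \<forall>q\<in>B. p \<noteq> q \<longrightarrow> \<not> forcing_compatible P r p q"
      using anti compat B h by (metis (no_types, lifting) image_eqI inj_on_eq_iff subsetD)
    then have "countable B" using ccc B(1) Q(2) unfolding forcing_ccc_def by (meson subset_trans)
    then show "countable C" using B by simp
  qed
  define \<D>' where "\<D>' = (\<lambda>D. h ` (D \<inter> Q)) ` \<D>"
  have "|\<D>'| \<le>o cardSuc natLeq"
    unfolding \<D>'_def using card card_of_image ordLeq_transitive by blast
  moreover have "\<forall>D\<in>\<D>'. forcing_dense (h ` Q) r' D"
  proof
    fix D' assume "D' \<in> \<D>'"
    then obtain D where D': "D \<in> \<D>" "D' = h ` (D \<inter> Q)" unfolding \<D>'_def by blast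
    have "\<exists>q\<in>D'. (q, h p) \<in> r'" if "p \<in> Q" for p
      using QD[OF D'(1) that] D'(2) that r'_iff by auto
    then show "forcing_dense (h ` Q) r' D'" unfolding forcing_dense_def D'(2) by auto
  qed
  moreover have "MA_aleph1_at (h ` Q) r'"
    using MA[unfolded MA_aleph1_def, rule_format, of "h ` Q" r'] po ccc' Q(1) by blast
  ultimately obtain G' where G': "forcing_filter (h ` Q) r' G'" "\<forall>D\<in>\<D>'. G' \<inter> D \<noteq> {}"
    unfolding MA_aleph1_at_def by (elim allE[of _ \<D>']) blast
  define G where "G = {p \<in> P. \<exists>q\<in>Q. h q \<in> G' \<and> (q, p) \<in> r}"
  have "G' \<subseteq> h ` Q" "G' \<noteq> {}" using G'(1) unfolding forcing_filter_def by auto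
  have inG: "q \<in> G" if "q \<in> Q" "h q \<in> G'" for q
    using that Q(2) rr(2) unfolding G_def refl_on_def by blast
  have "forcing_filter P r G"
    unfolding forcing_filter_def
  proof (intro conjI ballI impI)
    show "G \<subseteq> P" unfolding G_def by blast
    show "G \<noteq> {}" using \<open>G' \<subseteq> h ` Q\<close> \<open>G' \<noteq> {}\<close> inG by blast
  next
    fix p q assume "p \<in> G" "q \<in> P" "(p, q) \<in> r"
    then show "q \<in> G" unfolding G_def using rr(3) by (auto dest: transD)
  next
    fix p q assume "p \<in> G" "q \<in> G"
    then obtain p' q' where p': "p' \<in> Q" "h p' \<in> G'" "(p', p) \<in> r" and q': "q' \<in> Q" "h q' \<in> G'" "(q', q) \<in> r"
      unfolding G_def by blast
    then obtain t where t: "t \<in> G'" "(t, h p') \<in> r'" "(t, h q') \<in> r'"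
      using G'(1) unfolding forcing_filter_def by blast
    then obtain s where s: "s \<in> Q" "t = h s" using \<open>G' \<subseteq> h ` Q\<close> by blast
    then have "(s, p') \<in> r" "(s, q') \<in> r" using t p' q' r'_iff by auto
    then show "\<exists>s\<in>G. (s, p) \<in> r \<and> (s, q) \<in> r"
      using transD[OF rr(3) _ p'(3), of s] transD[OF rr(3) _ q'(3), of s] inG[of s] s t(1) by blast
  qed
  moreover have "G \<inter> D \<noteq> {}" if "D \<in> \<D>" for D
  proof -
    have "G' \<inter> h ` (D \<inter> Q) \<noteq> {}" using G'(2) that unfolding \<D>'_def by blast
    then show ?thesis using inG by blast
  qed
  ultimately show "\<exists>G. forcing_filter P r G \<and> (\<forall>D\<in>\<D>. G \<inter> D \<noteq> {})" by blast
qed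

end

theory Submission
  imports Defs "HOL-Library.Countable_Set_Type"
begin

text \<open>
  Since Newton's method turns an almost central, almost idempotent element of a coordinate algebra
  into a central projection, the central idempotents of a reduced product are the classes of the
  characteristic sequences.  An isomorphism therefore induces an automorphism of the power set of
  \<open>\<nat>\<close> modulo finite sets, and under OCA and MA this is given by a bijection \<open>g\<close> of cofinite sets.
  Hence two bounded sequences that agree on a set \<open>S\<close> have lifted images whose distance tends to \<open>0\<close>
  on \<open>g ` S\<close>.  Restricted to sequences from countable dense sets of the coordinates, this says that a
  family of functions is coherent; OCA and MA uniformize it by one map per coordinate, up to any
  given error.  Diagonalizing over errors \<open>1 / j\<close> and norm bounds \<open>j\<close> gives the \<open>\<phi> n\<close>.

  The automorphism itself is treated similarly.  OCA shows that it is trivial on almost every branch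
  of any tree of subsets of \<open>\<nat>\<close>, and the representations on these sets form a coherent
  family, whose uniformization represents the automorphism everywhere.
\<close>

subsection \<open>Open colourings of coded sets\<close>

text \<open>Call a point a conflict of two members of a coherent family if they agree there while
  their values lie far apart. Each pair has finitely many conflicts, but no common bound is given.
  If some nonmeagre part of the family has a bound, Baire category isolates the finitely many points
  responsible and yields the uniformization. Otherwise OCA returns uncountably many members, with
  reals attached, whose pairs have the more conflicts the later their reals split. This growth makes
  a poset ccc, and MA yields a partial function that meets a conflict of every pair from an
  uncountable subset. Coherence with each of these members then forces two of them to be close at
  one of their own conflicts. The obstacle is that the generic function must itself belong to the
  family. For sequences every partial function does; for the automorphism only those do on whose
  domain it is trivial, and OCA grants this just for all but countably many branches of a tree.
  Hence the generic object is a labelled tree, and one of the uncountably many attached reals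
  selects a branch lying in the family.\<close>

definition seq_dist :: "('x \<Rightarrow> nat \<Rightarrow> 'c) \<Rightarrow> 'x \<Rightarrow> 'x \<Rightarrow> real"
  where "seq_dist \<kappa> x y =
    (if \<kappa> x = \<kappa> y then 0 else inverse (real (Suc (LEAST i. \<kappa> x i \<noteq> \<kappa> y i))))"

text \<open>\<open>seq_dist\<close> is the Baire metric pulled back along \<open>\<kappa>\<close>. A
  first difference at \<open>L\<close> gives distance 1/(L+1), so staying strictly below 1/(N+1)
  means that \<open>L\<close> exceeds \<open>N\<close>.\<close>

lemma seq_dist_less_iff:
  "seq_dist \<kappa> x y < inverse (real (Suc N)) \<longleftrightarrow> (\<forall>i\<le>N. \<kappa> x i = \<kappa> y i)"
proof (cases "\<kappa> x = \<kappa> y")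
  case False
  then obtain j where j: "\<kappa> x j \<noteq> \<kappa> y j" by (auto simp: fun_eq_iff)
  define L where "L = (LEAST i. \<kappa> x i \<noteq> \<kappa> y i)"
  have L: "\<kappa> x L \<noteq> \<kappa> y L" unfolding L_def using j by (rule LeastI[of "\<lambda>i. \<kappa> x i \<noteq> \<kappa> y i"])
  have L': "\<kappa> x i = \<kappa> y i" if "i < L" for i using not_less_Least that unfolding L_def by blast
  have "(\<forall>i\<le>N. \<kappa> x i = \<kappa> y i) \<longleftrightarrow> N < L" using L L' by (meson leD leI le_less_trans)
  moreover have "inverse (real (Suc L)) < inverse (real (Suc N)) \<longleftrightarrow> N < L"
    by (subst inverse_less_iff_less) auto
  ultimately show ?thesis using False unfolding seq_dist_def L_def by simp
qed (simp add: seq_dist_def)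

lemma Metric_space_seq_dist:
  assumes "inj_on \<kappa> X"
  shows "Metric_space X (seq_dist \<kappa>)"
proof
  show "0 \<le> seq_dist \<kappa> x y" for x y by (simp add: seq_dist_def)
  show "seq_dist \<kappa> x y = seq_dist \<kappa> y x" for x y
    unfolding seq_dist_def by (simp add: eq_commute)
  show "seq_dist \<kappa> x y = 0 \<longleftrightarrow> x = y" if "x \<in> X" "y \<in> X" for x y
    using that assms by (auto simp: seq_dist_def inj_on_def)
  show "seq_dist \<kappa> x z \<le> seq_dist \<kappa> x y + seq_dist \<kappa> y z" for x y z
  proof (cases "\<kappa> x = \<kappa> z")
    case False
    define L where "L = (LEAST i. \<kappa> x i \<noteq> \<kappa> z i)"
    have L: "\<kappa> x L \<noteq> \<kappa> z L" unfolding L_def using False by (intro LeastI_ex[of "\<lambda>i. \<kappa> x i \<noteq> \<kappa> z i"]) (auto simp: fun_eq_iff)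
    have nn: "0 \<le> seq_dist \<kappa> u v" for u v by (simp add: seq_dist_def)
    have "seq_dist \<kappa> x z = inverse (real (Suc L))" using False by (simp add: seq_dist_def L_def)
    \<comment> \<open>Ultrametric inequality: \<open>x\<close> and \<open>z\<close> differ at
      \<open>L\<close>, so \<open>y\<close> cannot agree with both of them up to
      \<open>L\<close>.\<close>
    moreover have "\<not> (seq_dist \<kappa> x y < inverse (real (Suc L)) \<and> seq_dist \<kappa> y z < inverse (real (Suc L)))"
      unfolding seq_dist_less_iff using L by auto
    ultimately show ?thesis using nn[of x y] nn[of y z] by linarith
  qed (simp add: seq_dist_def)
qed

text \<open>One witness for every finite list realized as an initial segment of a code suffices, and
  a countable alphabet has only countably many finite lists.\<close>

lemma countable_seq_dense:
  fixes \<kappa> :: "'x \<Rightarrow> nat \<Rightarrow> 'c::countable"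
  obtains S where "countable S" "S \<subseteq> X" "\<And>x N. x \<in> X \<Longrightarrow> \<exists>s\<in>S. \<forall>i<N. \<kappa> s i = \<kappa> x i"
proof
  define f where "f l = (SOME x. x \<in> X \<and> map (\<kappa> x) [0..<length l] = l)" for l
  \<comment> \<open>Lists that no point of \<open>X\<close> realizes get an arbitrary value,
    possibly outside \<open>X\<close>.\<close>
  let ?S = "f ` UNIV \<inter> X"
  show "countable ?S" by simp
  show "?S \<subseteq> X" by blast
  fix x N assume "x \<in> X"
  define l where "l = map (\<kappa> x) [0..<N]"
  have "f l \<in> X \<and> map (\<kappa> (f l)) [0..<length l] = l"
    unfolding f_def by (rule someI[of _ x]) (simp add: \<open>x \<in> X\<close> l_def)
  then have "f l \<in> ?S" "\<forall>i<N. \<kappa> (f l) i = \<kappa> x i" by (auto simp: l_def)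
  then show "\<exists>s\<in>?S. \<forall>i<N. \<kappa> s i = \<kappa> x i" by blast
qed

text \<open>Codes over a countable alphabet make \<open>X\<close> a separable metric space, and a
  colouring decided by finite parts of the two codes is open. Unordered pairs are replaced by a
  symmetric relation.\<close>

lemma OCA_seq:
  fixes X :: "'x set" and \<kappa> :: "'x \<Rightarrow> nat \<Rightarrow> 'c::countable" and K :: "'x \<Rightarrow> 'x \<Rightarrow> bool"
  assumes OCA and inj: "inj_on \<kappa> X" and sym: "\<And>x y. K x y \<Longrightarrow> K y x"
    and op: "\<And>x y. \<lbrakk>x \<in> X; y \<in> X; x \<noteq> y; K x y\<rbrakk> \<Longrightarrow>
      \<exists>N. \<forall>x'\<in>X. \<forall>y'\<in>X. (\<forall>i<N. \<kappa> x i = \<kappa> x' i) \<longrightarrow> (\<forall>i<N. \<kappa> y i = \<kappa> y' i) \<longrightarrow> K x' y'"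
  obtains (K1) Z :: "nat \<Rightarrow> 'x set" where "X = (\<Union>n. Z n)"
      "\<And>n x y. \<lbrakk>x \<in> Z n; y \<in> Z n; x \<noteq> y\<rbrakk> \<Longrightarrow> \<not> K x y"
    | (K0) Y where "Y \<subseteq> X" "uncountable Y" "\<And>x y. \<lbrakk>x \<in> Y; y \<in> Y; x \<noteq> y\<rbrakk> \<Longrightarrow> K x y"
proof -
  interpret Metric_space X "seq_dist \<kappa>" by (rule Metric_space_seq_dist[OF inj])
  obtain S where S: "countable S" "S \<subseteq> X" "\<And>x N. x \<in> X \<Longrightarrow> \<exists>s\<in>S. \<forall>i<N. \<kappa> s i = \<kappa> x i"
    using countable_seq_dense[of X \<kappa>] by metis
  have "X \<subseteq> Abstract_Topology.closure_of mtopology S"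
  proof
    fix x assume x: "x \<in> X"
    have "\<exists>s\<in>S. s \<in> X \<and> seq_dist \<kappa> x s < e" if e: "e > 0" for e
    proof -
      obtain N where N: "inverse (real (Suc N)) < e" using reals_Archimedean[OF e] by blast
      obtain s where s: "s \<in> S" "\<forall>i<Suc N. \<kappa> s i = \<kappa> x i" using S(3)[OF x, of "Suc N"] by blast
      then have "seq_dist \<kappa> x s < inverse (real (Suc N))" unfolding seq_dist_less_iff by auto
      then show ?thesis using s S(2) N by force
    qed
    then show "x \<in> Abstract_Topology.closure_of mtopology S" unfolding metric_closure_of using x by auto
  qed
  then have "Abstract_Topology.closure_of mtopology S = X" using closure_of_subset_topspace[of mtopology] by auto
  then have sep: "separable_space mtopology"
    unfolding separable_space_def using S by auto
  define K0 where "K0 = {{x, y} | x y. x \<in> X \<and> y \<in> X \<and> x \<noteq> y \<and> K x y}"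
  define K1 where "K1 = nsets X 2 - K0"
  have K0: "{x, y} \<in> K0 \<longleftrightarrow> x \<noteq> y \<and> K x y" if "x \<in> X" "y \<in> X" for x y
    using that sym unfolding K0_def by (auto simp: doubleton_eq_iff)
  have "nsets X 2 = K0 \<union> K1" "K0 \<inter> K1 = {}"
    unfolding K1_def K0_def using nsets2_iff by blast+
  moreover have "openin (prod_topology mtopology mtopology) {(x, y). x \<in> X \<and> y \<in> X \<and> {x, y} \<in> K0}"
    unfolding openin_prod_metric[OF Metric_space_axioms]
  proof (intro allI impI)
    fix x y assume "(x, y) \<in> {(x, y). x \<in> X \<and> y \<in> X \<and> {x, y} \<in> K0}"
    then have xy: "x \<in> X" "y \<in> X" "x \<noteq> y" "K x y" using K0 by auto
    obtain N where N: "\<forall>x'\<in>X. \<forall>y'\<in>X. (\<forall>i<N. \<kappa> x i = \<kappa> x' i) \<longrightarrow> (\<forall>i<N. \<kappa> y i = \<kappa> y' i) \<longrightarrow> K x' y'"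
      using op[OF xy] by blast
    have "\<kappa> x \<noteq> \<kappa> y" using xy inj by (auto dest: inj_onD)
    then obtain j where j: "\<kappa> x j \<noteq> \<kappa> y j" by (auto simp: fun_eq_iff)
    \<comment> \<open>Including the index \<open>j\<close>, where the codes of \<open>x\<close> and
      \<open>y\<close> differ, keeps nearby points distinct; only distinct points form a
      pair.\<close>
    define M where "M = max N j"
    have "(u, v) \<in> {(x, y). x \<in> X \<and> y \<in> X \<and> {x, y} \<in> K0}"
      if uv: "u \<in> X" "v \<in> X" "seq_dist \<kappa> x u < inverse (real (Suc M))" "seq_dist \<kappa> y v < inverse (real (Suc M))" for u v
    proof -
      have *: "\<forall>i\<le>M. \<kappa> x i = \<kappa> u i" "\<forall>i\<le>M. \<kappa> y i = \<kappa> v i" using uv unfolding seq_dist_less_iff by auto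
      then have "K u v" using N uv by (simp add: M_def)
      moreover have "u \<noteq> v" using * j by (auto simp: M_def)
      ultimately show ?thesis using K0 uv by auto
    qed
    then show "x \<in> X \<and> y \<in> X \<and> (\<exists>e>0. \<forall>u\<in>X. \<forall>v\<in>X. seq_dist \<kappa> x u < e \<longrightarrow> seq_dist \<kappa> y v < e \<longrightarrow>
        (u, v) \<in> {(x, y). x \<in> X \<and> y \<in> X \<and> {x, y} \<in> K0})"
      using xy by (intro conjI exI[of _ "inverse (real (Suc M))"]) auto
  qed
  ultimately consider (a) Z :: "nat \<Rightarrow> 'x set" where "X = (\<Union>n. Z n)" "\<forall>n. nsets (Z n) 2 \<subseteq> K1"
    | (b) Y where "Y \<subseteq> X" "uncountable Y" "nsets Y 2 \<subseteq> K0"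
    using OCA_any_type[OF \<open>OCA\<close> Metric_space_axioms sep] unfolding open_colouring_dichotomy_def by meson
  then show thesis
  proof cases
    case a
    show thesis
    proof (rule that(1)[OF a(1)])
      fix n x y assume xy: "x \<in> Z n" "y \<in> Z n" "x \<noteq> y"
      then have "{x, y} \<in> K1" using a(2) nsets2_iff by blast
      then show "\<not> K x y" using xy a(1) K0 unfolding K1_def by blast
    qed
  next
    case b
    show thesis
    proof (rule that(2)[OF b(1,2)])
      fix x y assume xy: "x \<in> Y" "y \<in> Y" "x \<noteq> y"
      then have "{x, y} \<in> K0" using b(3) nsets2_iff by blast
      then show "K x y" using xy b(1) K0 by blast
    qed
  qed
qed

subsection \<open>Generic filters containing uncountably many given conditions\<close>

text \<open>Transports the cardinal order \<open>cardSuc natLeq\<close> into \<open>\<Xi>\<close>,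
  with \<open>U b\<close> the set of predecessors of \<open>b\<close>. Proper initial segments of a
  cardinal are smaller than it, hence countable here.\<close>

lemma omega1_enumeration:
  fixes \<Xi> :: "'i set"
  assumes "uncountable \<Xi>"
  obtains \<Omega> and U :: "'i \<Rightarrow> 'i set" where "\<Omega> \<subseteq> \<Xi>" "uncountable \<Omega>" "|\<Omega>| \<le>o cardSuc natLeq"
    "\<And>b. countable (U b)" "\<And>b c. \<lbrakk>b \<in> \<Omega>; c \<in> \<Omega>\<rbrakk> \<Longrightarrow> b \<in> U c \<or> c \<in> U b \<or> b = c"
    "\<And>b c. b \<in> U c \<Longrightarrow> c \<notin> U b"
proof -
  define r where "r = cardSuc natLeq"
  have co: "Card_order r" unfolding r_def by (simp add: cardSuc_Card_order natLeq_Card_order)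
  have wo: "Well_order r" using co by (simp add: card_order_on_well_order_on)
  have lt: "natLeq <o r" unfolding r_def by (simp add: cardSuc_greater natLeq_Card_order)
  note count = countable_card_le_natLeq
  have "\<not> |\<Xi>| \<le>o natLeq" using assms count by blast
  then have "natLeq <o |\<Xi>|"
    by (simp add: natLeq_Well_order card_of_Well_order not_ordLeq_iff_ordLess)
  then have "r \<le>o |\<Xi>|" unfolding r_def
    using cardSuc_ordLess_ordLeq[OF natLeq_Card_order card_of_Card_order] by blast
  moreover have fr: "|Field r| =o r" using co card_of_Field_ordIso by blast
  ultimately have "|Field r| \<le>o |\<Xi>|" using ordIso_ordLeq_trans by blast
  then obtain e where e: "inj_on e (Field r)" "e ` Field r \<subseteq> \<Xi>" using card_of_ordLeq[of "Field r" \<Xi>] by blast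
  define d where "d = inv_into (Field r) e"
  have d: "d (e a) = a" if "a \<in> Field r" for a using that e(1) by (simp add: d_def)
  have unc: "uncountable (Field r)"
  proof
    assume "countable (Field r)"
    then have "|Field r| \<le>o natLeq" using count by blast
    then have "r \<le>o natLeq" using fr ordIso_ordLeq_trans ordIso_symmetric by blast
    then show False using lt not_ordLess_ordLeq by blast
  qed
  have und: "countable (underS r a)" for a
  proof (cases "a \<in> Field r")
    case True
    then have "|underS r a| <o r" using card_of_underS[OF co] by blast
    then have "|underS r a| \<le>o natLeq" unfolding r_def
      using cardSuc_ordLeq_ordLess[OF natLeq_Card_order card_of_Card_order] by blast
    then show ?thesis by (simp add: count)
  next
    case False
    then have "underS r a = {}" by (auto simp: underS_def Field_def)
    then show ?thesis by simp
  qed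
  show thesis
  proof (rule that[of "e ` Field r" "\<lambda>b. if b \<in> e ` Field r then e ` underS r (d b) else {}"])
    show "e ` Field r \<subseteq> \<Xi>" by (rule e(2))
    show "uncountable (e ` Field r)" using unc e(1) countable_image_inj_on by blast
    show "|e ` Field r| \<le>o cardSuc natLeq"
      using card_of_image[of e "Field r"] fr ordLeq_ordIso_trans unfolding r_def by blast
    show "countable (if b \<in> e ` Field r then e ` underS r (d b) else {})" for b using und by simp
  next
    fix b c assume "b \<in> e ` Field r" "c \<in> e ` Field r"
    then obtain a a' where a: "b = e a" "c = e a'" "a \<in> Field r" "a' \<in> Field r" by blast
    have "a \<in> underS r a' \<or> a' \<in> underS r a \<or> a = a'"
      using wo a(3,4) unfolding well_order_on_def linear_order_on_def total_on_def underS_def by auto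
    then show "b \<in> (if c \<in> e ` Field r then e ` underS r (d c) else {}) \<or>
       c \<in> (if b \<in> e ` Field r then e ` underS r (d b) else {}) \<or> b = c"
      using a d by auto
  next
    fix b c assume b: "b \<in> (if c \<in> e ` Field r then e ` underS r (d c) else {})"
    then obtain a a' where a: "c = e a'" "a' \<in> Field r" "b = e a" "a \<in> underS r a'"
      using d by (auto split: if_splits)
    then have "a \<in> Field r" by (auto simp: underS_def Field_def)
    have "a' \<notin> underS r a" using a(4) wo
      unfolding well_order_on_def linear_order_on_def partial_order_on_def antisym_def underS_def by auto
    moreover have "underS r a \<subseteq> Field r" by (auto simp: underS_def Field_def)
    ultimately show "c \<notin> (if b \<in> e ` Field r then e ` underS r (d b) else {})"
      using a d[OF \<open>a \<in> Field r\<close>] e(1) by (auto simp: inj_on_def)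
  qed
qed

text \<open>Otherwise every \<open>p \<xi>\<close> has an extension \<open>q \<xi>\<close> and a
  bound \<open>\<eta> \<xi>\<close> beyond which all \<open>p \<zeta>\<close> are incompatible with
  \<open>q \<xi>\<close>. A maximal antichain among the \<open>q \<xi>\<close> is countable, so some
  \<open>\<beta>\<close> lies beyond all its bounds, and \<open>q \<beta>\<close> is incompatible
  with all of it. In forcing terms, \<open>p \<xi>\<^sub>0\<close> forces uncountably many
  \<open>p \<xi>\<close> into the generic filter.\<close>

lemma ccc_recurrent_condition:
  assumes po: "partial_order_on P r" and ccc: "forcing_ccc P r" and unc: "uncountable \<Omega>"
    and U: "\<And>b. countable (U b)" "\<And>b c. \<lbrakk>b \<in> \<Omega>; c \<in> \<Omega>\<rbrakk> \<Longrightarrow> b \<in> U c \<or> c \<in> U b \<or> b = c"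
    and p: "\<And>\<xi>. \<xi> \<in> \<Omega> \<Longrightarrow> p \<xi> \<in> P"
  obtains \<xi>\<^sub>0 where "\<xi>\<^sub>0 \<in> \<Omega>"
    "\<And>q \<eta>. \<lbrakk>q \<in> P; (q, p \<xi>\<^sub>0) \<in> r; \<eta> \<in> \<Omega>\<rbrakk> \<Longrightarrow> \<exists>\<xi>\<in>\<Omega>. \<eta> \<in> U \<xi> \<and> forcing_compatible P r q (p \<xi>)"
proof (rule ccontr)
  note thesisI = that
  assume "\<not> thesis"
  have "\<exists>z. fst z \<in> P \<and> (fst z, p \<xi>) \<in> r \<and> snd z \<in> \<Omega> \<and>
      (\<forall>\<zeta>\<in>\<Omega>. snd z \<in> U \<zeta> \<longrightarrow> \<not> forcing_compatible P r (fst z) (p \<zeta>))" if "\<xi> \<in> \<Omega>" for \<xi>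
  proof (rule ccontr)
    assume n: "\<not> ?thesis"
    have "\<exists>\<zeta>\<in>\<Omega>. \<eta> \<in> U \<zeta> \<and> forcing_compatible P r q (p \<zeta>)"
      if "q \<in> P" "(q, p \<xi>) \<in> r" "\<eta> \<in> \<Omega>" for q \<eta>
      using n that by (auto dest: spec[of _ "(q, \<eta>)"])
    then show False using thesisI[OF \<open>\<xi> \<in> \<Omega>\<close>] \<open>\<not> thesis\<close> by blast
  qed
  then have "\<forall>\<xi>\<in>\<Omega>. \<exists>z. fst z \<in> P \<and> (fst z, p \<xi>) \<in> r \<and> snd z \<in> \<Omega> \<and>
      (\<forall>\<zeta>\<in>\<Omega>. snd z \<in> U \<zeta> \<longrightarrow> \<not> forcing_compatible P r (fst z) (p \<zeta>))" by blast
  from bchoice[OF this] obtain z where z: "\<And>\<xi>. \<xi> \<in> \<Omega> \<Longrightarrow> fst (z \<xi>) \<in> P \<and> (fst (z \<xi>), p \<xi>) \<in> r \<and> snd (z \<xi>) \<in> \<Omega> \<and>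
      (\<forall>\<zeta>\<in>\<Omega>. snd (z \<xi>) \<in> U \<zeta> \<longrightarrow> \<not> forcing_compatible P r (fst (z \<xi>)) (p \<zeta>))" by blast
  define q where "q \<xi> = fst (z \<xi>)" for \<xi>
  define \<eta> where "\<eta> \<xi> = snd (z \<xi>)" for \<xi>
  have q: "\<And>\<xi>. \<xi> \<in> \<Omega> \<Longrightarrow> q \<xi> \<in> P" "\<And>\<xi>. \<xi> \<in> \<Omega> \<Longrightarrow> (q \<xi>, p \<xi>) \<in> r"
      "\<And>\<xi>. \<xi> \<in> \<Omega> \<Longrightarrow> \<eta> \<xi> \<in> \<Omega>"
      "\<And>\<xi> \<zeta>. \<lbrakk>\<xi> \<in> \<Omega>; \<zeta> \<in> \<Omega>; \<eta> \<xi> \<in> U \<zeta>\<rbrakk> \<Longrightarrow> \<not> forcing_compatible P r (q \<xi>) (p \<zeta>)"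
    using z unfolding q_def \<eta>_def by blast+
  define anti where "anti A \<longleftrightarrow> A \<subseteq> q ` \<Omega> \<and> (\<forall>a\<in>A. \<forall>b\<in>A. a \<noteq> b \<longrightarrow> \<not> forcing_compatible P r a b)" for A
  have "\<exists>M\<in>Collect anti. \<forall>A\<in>Collect anti. M \<subseteq> A \<longrightarrow> A = M"
  proof (rule subset_Zorn_nonempty)
    have "anti {}" by (simp add: anti_def)
    then show "Collect anti \<noteq> {}" by blast
    fix \<C> assume ch: "\<C> \<noteq> {}" "subset.chain (Collect anti) \<C>"
    have "\<not> forcing_compatible P r a b" if ab: "a \<in> \<Union>\<C>" "b \<in> \<Union>\<C>" "a \<noteq> b" for a b
    proof -
      obtain A B where "A \<in> \<C>" "B \<in> \<C>" "a \<in> A" "b \<in> B" using ab by blast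
      moreover from this have "A \<subseteq> B \<or> B \<subseteq> A" "anti A" "anti B" using ch(2) by (auto simp: subset.chain_def)
      ultimately show ?thesis using ab(3) unfolding anti_def by blast
    qed
    moreover have "\<Union>\<C> \<subseteq> q ` \<Omega>" using ch(2) unfolding subset.chain_def anti_def by blast
    ultimately show "\<Union>\<C> \<in> Collect anti" by (simp add: anti_def)
  qed
  then obtain A where A: "anti A" "\<And>B. anti B \<Longrightarrow> A \<subseteq> B \<Longrightarrow> B = A" by blast
  have "A \<subseteq> P" using A(1) q(1) unfolding anti_def by blast
  then have "countable A"
    using A(1) ccc[unfolded forcing_ccc_def, rule_format, of A] unfolding anti_def by blast
  then obtain S where S: "countable S" "S \<subseteq> \<Omega>" "A = q ` S"
    using A(1) unfolding anti_def by (metis countable_subset_image)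
  have "countable (\<Union>\<xi>\<in>S. insert (\<eta> \<xi>) (U (\<eta> \<xi>)))" using S(1) U(1) by simp
  then obtain \<beta> where \<beta>: "\<beta> \<in> \<Omega>" "\<beta> \<notin> (\<Union>\<xi>\<in>S. insert (\<eta> \<xi>) (U (\<eta> \<xi>)))"
    using unc by (meson countable_subset subsetI)
  have inc: "\<not> forcing_compatible P r (q \<xi>) (p \<beta>)" if "\<xi> \<in> S" for \<xi>
    using q(4)[of \<xi> \<beta>] U(2)[of "\<eta> \<xi>" \<beta>] q(3)[of \<xi>] \<beta> that S(2) by blast
  have tr: "trans r" and rf: "refl_on P r" using partial_order_onD[OF po] by auto
  have inc': "\<not> forcing_compatible P r (q \<xi>) (q \<beta>)" if "\<xi> \<in> S" for \<xi>
    using inc[OF that] q(2)[OF \<beta>(1)] tr unfolding forcing_compatible_def by (meson transD)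
  then have "\<not> forcing_compatible P r (q \<beta>) (q \<xi>)" if "\<xi> \<in> S" for \<xi>
    using that unfolding forcing_compatible_def by blast
  then have "anti (insert (q \<beta>) A)" using A(1) inc' S(3) \<beta>(1) unfolding anti_def by auto
  then have "q \<beta> \<in> A" using A(2) by blast
  then obtain \<xi> where "\<xi> \<in> S" "q \<xi> = q \<beta>" using S(3) by auto
  \<comment> \<open>By maximality \<open>q \<beta>\<close> lies in the antichain, so it would be
    incompatible with itself.\<close>
  then show False using inc' q(1)[OF \<beta>(1)] rf unfolding forcing_compatible_def refl_on_def by metis
qed

text \<open>Below a recurrent condition the sets \<open>E \<eta>\<close> of conditions under some
  \<open>p \<xi>\<close> with \<open>\<xi>\<close> beyond \<open>\<eta>\<close> are dense, and there
  are at most aleph-1 of them. A filter meeting them all captures cofinally many of the given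
  conditions, hence uncountably many.\<close>

lemma MA_filter:
  fixes P :: "'p set"
  assumes MA: MA_aleph1 and po: "partial_order_on P r" and ccc: "forcing_ccc P r" and unc: "uncountable \<Xi>"
    and p: "\<And>\<xi>. \<xi> \<in> \<Xi> \<Longrightarrow> p \<xi> \<in> P" and D: "\<And>i :: nat. forcing_dense P r (D i)"
  obtains G where "G \<subseteq> P" "\<And>a b. \<lbrakk>a \<in> G; b \<in> G\<rbrakk> \<Longrightarrow> \<exists>s\<in>G. (s, a) \<in> r \<and> (s, b) \<in> r"
    "\<And>i. G \<inter> D i \<noteq> {}" "uncountable {\<xi> \<in> \<Xi>. p \<xi> \<in> G}"
proof -
  obtain \<Omega> U where \<Omega>: "\<Omega> \<subseteq> \<Xi>" "uncountable \<Omega>" "|\<Omega>| \<le>o cardSuc natLeq"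
    and U: "\<And>b. countable (U b)" "\<And>b c. \<lbrakk>b \<in> \<Omega>; c \<in> \<Omega>\<rbrakk> \<Longrightarrow> b \<in> U c \<or> c \<in> U b \<or> b = c"
      "\<And>b c. b \<in> U c \<Longrightarrow> c \<notin> U b"
    using omega1_enumeration[OF unc] by metis
  have p': "p \<xi> \<in> P" if "\<xi> \<in> \<Omega>" for \<xi> using p that \<Omega>(1) by blast
  obtain \<xi>\<^sub>0 where \<xi>\<^sub>0: "\<xi>\<^sub>0 \<in> \<Omega>" "\<And>q \<eta>. \<lbrakk>q \<in> P; (q, p \<xi>\<^sub>0) \<in> r; \<eta> \<in> \<Omega>\<rbrakk> \<Longrightarrow>
      \<exists>\<xi>\<in>\<Omega>. \<eta> \<in> U \<xi> \<and> forcing_compatible P r q (p \<xi>)"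
    using ccc_recurrent_condition[OF po ccc \<Omega>(2), of U p] U(1,2) p' by blast
  have rr: "r \<subseteq> P \<times> P" "refl_on P r" "trans r" "antisym r"
    using partial_order_onD[OF po] by auto
  define Q where "Q = {q \<in> P. (q, p \<xi>\<^sub>0) \<in> r}"
  define r' where "r' = r \<inter> Q \<times> Q"
  have Qdown: "s \<in> Q" if "q \<in> Q" "(s, q) \<in> r" for s q
    using that rr unfolding Q_def by (auto dest: transD)
  have po': "partial_order_on Q r'"
    unfolding partial_order_on_def preorder_on_def
  proof (intro conjI)
    show "refl_on Q r'" "r' \<subseteq> Q \<times> Q" using rr(2) unfolding r'_def refl_on_def Q_def by auto
    show "trans r'" using rr(3) unfolding r'_def trans_def by blast
    show "antisym r'" using rr(4) unfolding r'_def antisym_def by blast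
  qed
  have compat: "forcing_compatible Q r' a b \<longleftrightarrow> forcing_compatible P r a b" if "a \<in> Q" "b \<in> Q" for a b
    using that Qdown rr(1) unfolding forcing_compatible_def r'_def Q_def by blast
  have ccc': "forcing_ccc Q r'"
    unfolding forcing_ccc_def
  proof (intro allI impI)
    fix C assume C: "C \<subseteq> Q" "\<forall>a\<in>C. \<forall>b\<in>C. a \<noteq> b \<longrightarrow> \<not> forcing_compatible Q r' a b"
    then have "\<forall>a\<in>C. \<forall>b\<in>C. a \<noteq> b \<longrightarrow> \<not> forcing_compatible P r a b" using compat by blast
    moreover have "C \<subseteq> P" using C(1) unfolding Q_def by blast
    ultimately show "countable C" using ccc[unfolded forcing_ccc_def, rule_format, of C] by blast
  qed
  have "p \<xi>\<^sub>0 \<in> Q" using p'[OF \<xi>\<^sub>0(1)] rr(2) unfolding Q_def refl_on_def by blast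
  define E where "E \<eta> = {q \<in> Q. \<exists>\<xi>\<in>\<Omega>. \<eta> \<in> U \<xi> \<and> (q, p \<xi>) \<in> r}" for \<eta>
  define \<D> where "\<D> = E ` \<Omega> \<union> range (\<lambda>i. D i \<inter> Q)"
  have "|E ` \<Omega>| \<le>o cardSuc natLeq" using \<Omega>(3) card_of_image ordLeq_transitive by blast
  moreover have "natLeq \<le>o cardSuc natLeq" using cardSuc_ordLeq natLeq_Card_order by blast
  then have "|range (\<lambda>i. D i \<inter> Q)| \<le>o cardSuc natLeq"
    using countable_card_le_natLeq[of "range (\<lambda>i. D i \<inter> Q)"] ordLeq_transitive by blast
  moreover have "\<not> finite (Field (cardSuc natLeq))"
    by (subst cardSuc_finite[OF natLeq_Card_order]) (simp add: Field_natLeq)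
  ultimately have card: "|\<D>| \<le>o cardSuc natLeq"
    unfolding \<D>_def by (intro card_of_Un_ordLeq_infinite_Field) (auto simp: cardSuc_Card_order natLeq_Card_order)
  have dens: "forcing_dense Q r' X" if "X \<in> \<D>" for X
    using that unfolding \<D>_def
  proof
    assume "X \<in> E ` \<Omega>"
    then obtain \<eta> where \<eta>: "\<eta> \<in> \<Omega>" "X = E \<eta>" by blast
    have "\<exists>s\<in>E \<eta>. (s, q) \<in> r'" if q: "q \<in> Q" for q
    proof -
      obtain \<xi> s where "\<xi> \<in> \<Omega>" "\<eta> \<in> U \<xi>" "s \<in> P" "(s, q) \<in> r" "(s, p \<xi>) \<in> r"
        using \<xi>\<^sub>0(2)[of q \<eta>] q \<eta>(1) unfolding Q_def forcing_compatible_def by blast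
      then show ?thesis using q Qdown unfolding E_def r'_def by blast
    qed
    then show ?thesis using \<eta>(2) unfolding forcing_dense_def E_def by blast
  next
    assume "X \<in> range (\<lambda>i. D i \<inter> Q)"
    then obtain i where X: "X = D i \<inter> Q" by blast
    have "\<exists>s\<in>D i \<inter> Q. (s, q) \<in> r'" if q: "q \<in> Q" for q
    proof -
      have "q \<in> P" using q Q_def by blast
      then obtain s where "s \<in> D i" "(s, q) \<in> r" using D[of i] unfolding forcing_dense_def by blast
      then show ?thesis using q Qdown unfolding r'_def by blast
    qed
    then show ?thesis using X unfolding forcing_dense_def by blast
  qed
  have "MA_aleph1_at Q r'"
    using MA_aleph1_any_type[OF MA _ po' ccc'] \<open>p \<xi>\<^sub>0 \<in> Q\<close> by blast
  then obtain G where G: "forcing_filter Q r' G" "\<forall>X\<in>\<D>. G \<inter> X \<noteq> {}"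
    using card dens unfolding MA_aleph1_at_def by meson
  \<comment> \<open>The filter from MA lives below \<open>p \<xi>\<^sub>0\<close>; its upward
    closure in \<open>P\<close> is what contains the conditions \<open>p \<xi>\<close>
    themselves.\<close>
  define H where "H = {q \<in> P. \<exists>g\<in>G. (g, q) \<in> r}"
  have GQ: "G \<subseteq> Q" using G(1) unfolding forcing_filter_def by blast
  have GH: "G \<subseteq> H" using GQ rr(2) unfolding H_def Q_def refl_on_def by blast
  show thesis
  proof (rule that[of H])
    show "H \<subseteq> P" unfolding H_def by blast
    fix a b assume "a \<in> H" "b \<in> H"
    then obtain g h where gh: "g \<in> G" "h \<in> G" "(g, a) \<in> r" "(h, b) \<in> r" unfolding H_def by blast
    obtain s where "s \<in> G" "(s, g) \<in> r'" "(s, h) \<in> r'"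
      using G(1) gh unfolding forcing_filter_def by meson
    then show "\<exists>s\<in>H. (s, a) \<in> r \<and> (s, b) \<in> r"
      using gh GH rr(3) unfolding r'_def by (meson IntD1 subsetD transD)
  next
    show "H \<inter> D i \<noteq> {}" for i
    proof -
      have "D i \<inter> Q \<in> \<D>" unfolding \<D>_def by blast
      then have "G \<inter> (D i \<inter> Q) \<noteq> {}" using G(2) by (rule bspec[rotated])
      then show ?thesis using GH by blast
    qed
    show "uncountable {\<xi> \<in> \<Xi>. p \<xi> \<in> H}"
    proof
      assume "countable {\<xi> \<in> \<Xi>. p \<xi> \<in> H}"
      then have "countable (\<Union>\<xi>\<in>{\<xi> \<in> \<Xi>. p \<xi> \<in> H}. insert \<xi> (U \<xi>))" using U(1) by simp
      then obtain \<beta> where \<beta>: "\<beta> \<in> \<Omega>" "\<beta> \<notin> (\<Union>\<xi>\<in>{\<xi> \<in> \<Xi>. p \<xi> \<in> H}. insert \<xi> (U \<xi>))"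
        using \<Omega>(2) by (meson countable_subset subsetI)
      have "E \<beta> \<in> \<D>" using \<beta>(1) unfolding \<D>_def by blast
      then have "G \<inter> E \<beta> \<noteq> {}" using G(2) by (rule bspec[rotated])
      then obtain q \<xi> where q: "q \<in> G" "\<xi> \<in> \<Omega>" "\<beta> \<in> U \<xi>" "(q, p \<xi>) \<in> r" unfolding E_def by blast
      then have "p \<xi> \<in> H" using p' unfolding H_def by blast
      then show False using q \<beta> \<Omega>(1) by blast
    qed
  qed
qed

subsection \<open>Meagre sets of sequences\<close>

definition agree :: "nat \<Rightarrow> (nat \<Rightarrow> 'a) \<Rightarrow> (nat \<Rightarrow> 'a) \<Rightarrow> bool"
  where "agree n x y \<longleftrightarrow> (\<forall>i<n. x i = y i)"

text \<open>Nowhere density in the product of discrete spaces; a pair \<open>y\<close>,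
  \<open>n\<close> stands for the basic open set of sequences that agree with \<open>y\<close> below
  \<open>n\<close>.\<close>

definition seq_nowhere_dense :: "(nat \<Rightarrow> 'a) set \<Rightarrow> bool"
  where "seq_nowhere_dense Z \<longleftrightarrow>
    (\<forall>y n. \<exists>z m. n \<le> m \<and> agree n z y \<and> (\<forall>x. agree m x z \<longrightarrow> x \<notin> Z))"

definition seq_meagre :: "(nat \<Rightarrow> 'a) set \<Rightarrow> bool"
  where "seq_meagre Z \<longleftrightarrow> (\<exists>C :: nat \<Rightarrow> (nat \<Rightarrow> 'a) set. (\<forall>i. seq_nowhere_dense (C i)) \<and> Z \<subseteq> (\<Union>i. C i))"

lemma agree_refl [simp]: "agree n x x"
  by (simp add: agree_def)

lemma agree_sym: "agree n x y \<Longrightarrow> agree n y x"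
  by (simp add: agree_def)

lemma agree_trans: "agree n x y \<Longrightarrow> agree n y z \<Longrightarrow> agree n x z"
  by (simp add: agree_def)

lemma agree_mono: "agree n x y \<Longrightarrow> m \<le> n \<Longrightarrow> agree m x y"
  by (simp add: agree_def)

lemma agree_iff_map: "agree n x y \<longleftrightarrow> map x [0..<n] = map y [0..<n]"
  by (simp add: agree_def list_eq_iff_nth_eq)

lemma seq_meagre_subset: "seq_meagre Z \<Longrightarrow> W \<subseteq> Z \<Longrightarrow> seq_meagre W"
  unfolding seq_meagre_def by (meson subset_trans)

lemma seq_nowhere_dense_imp_meagre: "seq_nowhere_dense Z \<Longrightarrow> seq_meagre Z"
  unfolding seq_meagre_def by (intro exI[of _ "\<lambda>_. Z"]) auto

lemma seq_meagre_UN_nat: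
  fixes Z :: "nat \<Rightarrow> (nat \<Rightarrow> 'a) set"
  assumes "\<And>i. seq_meagre (Z i)"
  shows "seq_meagre (\<Union>i. Z i)"
proof -
  have "\<forall>i. \<exists>C :: nat \<Rightarrow> (nat \<Rightarrow> 'a) set. (\<forall>j. seq_nowhere_dense (C j)) \<and> Z i \<subseteq> (\<Union>j. C j)"
    using assms unfolding seq_meagre_def by blast
  from choice[OF this] obtain C :: "nat \<Rightarrow> nat \<Rightarrow> (nat \<Rightarrow> 'a) set" where
    C: "\<And>i j. seq_nowhere_dense (C i j)" "\<And>i. Z i \<subseteq> (\<Union>j. C i j)" by blast
  define D where "D k = C (fst (prod_decode k)) (snd (prod_decode k))" for k
  have "(\<Union>i. Z i) \<subseteq> (\<Union>k. D k)"
  proof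
    fix x assume "x \<in> (\<Union>i. Z i)"
    then obtain i j where "x \<in> C i j" using C(2) by blast
    then have "x \<in> D (prod_encode (i, j))" by (simp add: D_def)
    then show "x \<in> (\<Union>k. D k)" by blast
  qed
  moreover have "\<forall>k. seq_nowhere_dense (D k)" by (simp add: D_def C(1))
  ultimately show ?thesis unfolding seq_meagre_def by blast
qed

lemma seq_nowhere_dense_empty: "seq_nowhere_dense {}"
  unfolding seq_nowhere_dense_def by (auto intro: agree_refl)

lemma seq_meagre_UN:
  assumes "countable I" "\<And>i. i \<in> I \<Longrightarrow> seq_meagre (Z i)"
  shows "seq_meagre (\<Union>i\<in>I. Z i)"
proof (cases "I = {}")
  case True
  then show ?thesis using seq_nowhere_dense_imp_meagre[OF seq_nowhere_dense_empty] by simp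
next
  case False
  have "seq_meagre (\<Union>n. Z (from_nat_into I n))"
    by (intro seq_meagre_UN_nat assms(2) from_nat_into[OF False])
  moreover have "(\<Union>i\<in>I. Z i) \<subseteq> (\<Union>n. Z (from_nat_into I n))"
  proof
    fix x assume "x \<in> (\<Union>i\<in>I. Z i)"
    then obtain i where "i \<in> I" "x \<in> Z i" by blast
    moreover from this obtain n where "from_nat_into I n = i" using from_nat_into_surj[OF assms(1)] by blast
    ultimately show "x \<in> (\<Union>n. Z (from_nat_into I n))" by blast
  qed
  ultimately show ?thesis by (rule seq_meagre_subset)
qed

lemma nonmeagre_Diff:
  assumes "\<not> seq_meagre Z" "seq_meagre W"
  shows "\<not> seq_meagre (Z - W)"
proof
  assume "seq_meagre (Z - W)"
  then have "seq_meagre (\<Union>b\<in>UNIV. if b then W else Z - W)"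
    using assms(2) by (intro seq_meagre_UN) auto
  then have "seq_meagre Z" by (rule seq_meagre_subset) auto
  then show False using assms(1) by simp
qed

lemma nonmeagre_UN:
  assumes "\<not> seq_meagre Z" "Z \<subseteq> (\<Union>i\<in>I. C i)" "countable I"
  obtains i where "i \<in> I" "\<not> seq_meagre (C i)"
  using assms seq_meagre_UN[OF assms(3), of C] seq_meagre_subset by blast

lemma nonmeagre_UN_type:
  fixes C :: "'i::countable \<Rightarrow> (nat \<Rightarrow> 'a) set"
  assumes "\<not> seq_meagre Z" "\<And>x. x \<in> Z \<Longrightarrow> \<exists>i. x \<in> C i"
  obtains i where "\<not> seq_meagre (C i)"
proof -
  have "Z \<subseteq> (\<Union>i\<in>UNIV. C i)" using assms(2) by blast
  then show thesis by (rule nonmeagre_UN[OF assms(1)]) (auto intro: that)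
qed

text \<open>The Baire category theorem: nested basic open sets that miss the \<open>C k\<close> in
  turn have a common point. Their lengths are forced up to \<open>k\<close> at stage
  \<open>k\<close>, so that the limit is determined at every index.\<close>

lemma not_seq_meagre_UNIV: "\<not> seq_meagre (UNIV :: (nat \<Rightarrow> 'a) set)"
proof
  assume "seq_meagre (UNIV :: (nat \<Rightarrow> 'a) set)"
  then obtain C :: "nat \<Rightarrow> (nat \<Rightarrow> 'a) set" where
    C: "\<And>i. seq_nowhere_dense (C i)" "UNIV \<subseteq> (\<Union>i. C i)" unfolding seq_meagre_def by blast
  have "\<exists>f :: nat \<Rightarrow> (nat \<Rightarrow> 'a) \<times> nat. \<forall>k. k \<le> snd (f k) \<and>
     (snd (f k) \<le> snd (f (Suc k)) \<and> agree (snd (f k)) (fst (f (Suc k))) (fst (f k)) \<and>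
      (\<forall>x. agree (snd (f (Suc k))) x (fst (f (Suc k))) \<longrightarrow> x \<notin> C k))"
  proof (rule dependent_nat_choice)
    show "\<exists>q :: (nat \<Rightarrow> 'a) \<times> nat. 0 \<le> snd q" by simp
    fix q :: "(nat \<Rightarrow> 'a) \<times> nat" and k
    obtain z m where "snd q \<le> m" "agree (snd q) z (fst q)" "\<And>x. agree m x z \<Longrightarrow> x \<notin> C k"
      using C(1)[of k] unfolding seq_nowhere_dense_def by meson
    moreover have "agree m x z" if "agree (m + Suc k) x z" for x using that by (rule agree_mono) simp
    ultimately show "\<exists>q'. Suc k \<le> snd q' \<and> snd q \<le> snd q' \<and> agree (snd q) (fst q') (fst q) \<and>
        (\<forall>x. agree (snd q') x (fst q') \<longrightarrow> x \<notin> C k)"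
      by (intro exI[of _ "(z, m + Suc k)"]) auto
  qed
  then obtain f :: "nat \<Rightarrow> (nat \<Rightarrow> 'a) \<times> nat" where f: "\<And>k. k \<le> snd (f k)" "\<And>k. snd (f k) \<le> snd (f (Suc k))"
    "\<And>k. agree (snd (f k)) (fst (f (Suc k))) (fst (f k))"
    "\<And>k x. agree (snd (f (Suc k))) x (fst (f (Suc k))) \<Longrightarrow> x \<notin> C k" by blast
  have mono: "snd (f k) \<le> snd (f l)" if "k \<le> l" for k l using that by (rule lift_Suc_mono_le[of "\<lambda>k. snd (f k)", rotated]) (rule f(2))
  have ag: "agree (snd (f k)) (fst (f l)) (fst (f k))" if "k \<le> l" for k l
    using that
  proof (induction l rule: dec_induct)
    case (step l)
    then show ?case using f(3)[of l] mono[of k l] by (meson agree_mono agree_trans)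
  qed simp
  define x where "x i = fst (f (Suc i)) i" for i
  have "agree (snd (f k)) x (fst (f k))" for k
    unfolding agree_def
  proof (intro allI impI)
    fix i assume i: "i < snd (f k)"
    have "i < snd (f (Suc i))" using f(1)[of "Suc i"] by simp
    then show "x i = fst (f k) i"
      using ag[of k "Suc i"] ag[of "Suc i" k] i unfolding x_def agree_def by (cases "k \<le> Suc i") auto
  qed
  then have "x \<notin> C k" for k using f(4) by blast
  then show False using C(2) by blast
qed

lemma nonmeagre_dense:
  assumes "\<not> seq_meagre Z"
  shows "\<exists>y n. \<forall>z m. n \<le> m \<longrightarrow> agree n z y \<longrightarrow> (\<exists>x\<in>Z. agree m x z)"
proof -
  have "\<not> seq_nowhere_dense Z" using assms seq_nowhere_dense_imp_meagre by blast
  then show ?thesis unfolding seq_nowhere_dense_def by blast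
qed

text \<open>A countable alphabet has countably many boxes, so all those in which \<open>Z\<close> is
  meagre can be discarded at once. The remainder is nonmeagre, hence dense in some box, and no box
  inside that one was discarded.\<close>

lemma nonmeagre_box:
  fixes Z :: "(nat \<Rightarrow> 'a::countable) set"
  assumes "\<not> seq_meagre Z"
  shows "\<exists>y n. \<forall>z m. n \<le> m \<longrightarrow> agree n z y \<longrightarrow> \<not> seq_meagre {x \<in> Z. agree m x z}"
proof -
  define box where "box s = {x \<in> Z. map x [0..<length s] = s}" for s :: "'a list"
  define B where "B = {s. seq_meagre (box s)}"
  have "seq_meagre (\<Union>s\<in>B. box s)" by (rule seq_meagre_UN) (auto simp: B_def)
  then have "\<not> seq_meagre (Z - (\<Union>s\<in>B. box s))" by (rule nonmeagre_Diff[OF assms])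
  then obtain y n where yn: "\<And>z m. n \<le> m \<Longrightarrow> agree n z y \<Longrightarrow> \<exists>x\<in>Z - (\<Union>s\<in>B. box s). agree m x z"
    using nonmeagre_dense by metis
  have "\<not> seq_meagre {x \<in> Z. agree m x z}" if "n \<le> m" "agree n z y" for z m
  proof -
    from that obtain x where x: "x \<in> Z" "x \<notin> (\<Union>s\<in>B. box s)" "agree m x z" using yn by blast
    have eq: "box (map z [0..<m]) = {x \<in> Z. agree m x z}" by (simp add: box_def agree_iff_map)
    then have "x \<in> box (map z [0..<m])" using x by simp
    then have "map z [0..<m] \<notin> B" using x(2) by blast
    then have "\<not> seq_meagre (box (map z [0..<m]))" by (simp add: B_def)
    then show ?thesis by (simp only: eq not_False_eq_True)
  qed
  then show ?thesis by blast
qed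

text \<open>Any finite sequence can be prolonged to hit \<open>g\<close> at a later point of
  \<open>Q\<close>, so missing \<open>g\<close> on \<open>Q\<close> from \<open>N\<close> on is
  nowhere dense. Consequently a nonmeagre set has a member that imitates a prescribed sequence
  infinitely often.\<close>

lemma seq_meagre_finitely_often:
  assumes "infinite Q"
  shows "seq_meagre {x. finite {n \<in> Q. x n = g n}}"
proof -
  have "seq_nowhere_dense {x. \<forall>n\<in>Q. N \<le> n \<longrightarrow> x n \<noteq> g n}" for N
    unfolding seq_nowhere_dense_def
  proof (intro allI)
    fix y :: "nat \<Rightarrow> 'a" and n
    obtain q where q: "q \<in> Q" "q \<ge> max N n" using assms infinite_nat_iff_unbounded_le by blast
    show "\<exists>z m. n \<le> m \<and> agree n z y \<and> (\<forall>x. agree m x z \<longrightarrow> x \<notin> {x. \<forall>n\<in>Q. N \<le> n \<longrightarrow> x n \<noteq> g n})"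
      by (intro exI[of _ "y(q := g q)"] exI[of _ "Suc q"]) (use q in \<open>auto simp: agree_def\<close>)
  qed
  then have "seq_meagre (\<Union>N. {x. \<forall>n\<in>Q. N \<le> n \<longrightarrow> x n \<noteq> g n})"
    by (intro seq_meagre_UN_nat seq_nowhere_dense_imp_meagre)
  moreover have "{x. finite {n \<in> Q. x n = g n}} \<subseteq> (\<Union>N. {x. \<forall>n\<in>Q. N \<le> n \<longrightarrow> x n \<noteq> g n})"
  proof
    fix x assume "x \<in> {x. finite {n \<in> Q. x n = g n}}"
    then obtain N where "\<forall>n\<in>{n \<in> Q. x n = g n}. n < N" using finite_nat_set_iff_bounded by auto
    then have "x \<in> {x. \<forall>n\<in>Q. N \<le> n \<longrightarrow> x n \<noteq> g n}" using leD by blast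
    then show "x \<in> (\<Union>N. {x. \<forall>n\<in>Q. N \<le> n \<longrightarrow> x n \<noteq> g n})" by blast
  qed
  ultimately show ?thesis by (rule seq_meagre_subset)
qed

lemma nonmeagre_infinitely_often:
  assumes "\<not> seq_meagre Z" "infinite Q"
  obtains x where "x \<in> Z" "infinite {n \<in> Q. x n = g n}"
  using assms seq_meagre_finitely_often[OF assms(2), of g] seq_meagre_subset[of _ Z] by blast

subsection \<open>Graded open colourings\<close>

text \<open>Attaching a real to every point turns a decreasing sequence of open colourings into a single
  one: the colouring \<open>K d\<close> is applied to pairs whose reals first differ at \<open>d\<close>.\<close>

lemma OCA_graded:
  fixes X :: "'x set" and \<kappa> :: "'x \<Rightarrow> nat \<Rightarrow> 'c::countable" and K :: "nat \<Rightarrow> 'x \<Rightarrow> 'x \<Rightarrow> bool"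
  assumes OCA and inj: "inj_on \<kappa> X" and sym: "\<And>d x y. K d x y \<Longrightarrow> K d y x"
    and mono: "\<And>d e x y. d \<le> e \<Longrightarrow> K e x y \<Longrightarrow> K d x y"
    and op: "\<And>d x y. \<lbrakk>x \<in> X; y \<in> X; K d x y\<rbrakk> \<Longrightarrow>
      \<exists>N. \<forall>x'\<in>X. \<forall>y'\<in>X. agree N (\<kappa> x) (\<kappa> x') \<longrightarrow> agree N (\<kappa> y) (\<kappa> y') \<longrightarrow> K d x' y'"
  obtains (K1) Z :: "nat \<Rightarrow> 'x set" and b :: "nat \<Rightarrow> nat" where "X = (\<Union>n. Z n)"
      "\<And>n x y. \<lbrakk>x \<in> Z n; y \<in> Z n\<rbrakk> \<Longrightarrow> \<not> K (b n) x y"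
    | (K0) Y :: "('x \<times> (nat \<Rightarrow> bool)) set" where "fst ` Y \<subseteq> X" "uncountable Y" "inj_on snd Y"
      "\<And>n x y. \<lbrakk>x \<in> Y; y \<in> Y; x \<noteq> y; agree n (snd x) (snd y)\<rbrakk> \<Longrightarrow> K n (fst x) (fst y)"
proof -
  define K' where "K' p q \<longleftrightarrow> (\<exists>d. agree d (snd p) (snd q) \<and> snd p d \<noteq> snd q d \<and> K d (fst p) (fst q))"
    for p q :: "'x \<times> (nat \<Rightarrow> bool)"
  define \<kappa>' where "\<kappa>' p i = (\<kappa> (fst p) i, snd p i)" for p :: "'x \<times> (nat \<Rightarrow> bool)" and i
  have inj': "inj_on \<kappa>' (X \<times> UNIV)"
    using inj by (auto simp: inj_on_def \<kappa>'_def fun_eq_iff)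
  have sym': "K' q p" if "K' p q" for p q
    using that sym agree_sym unfolding K'_def by metis
  have agr: "agree N (\<kappa> (fst p)) (\<kappa> (fst p'))" "agree N (snd p) (snd p')" if "\<forall>i<N. \<kappa>' p i = \<kappa>' p' i" for N p p'
    using that by (auto simp: \<kappa>'_def agree_def)
  have op': "\<exists>N. \<forall>p'\<in>X \<times> UNIV. \<forall>q'\<in>X \<times> UNIV. (\<forall>i<N. \<kappa>' p i = \<kappa>' p' i) \<longrightarrow> (\<forall>i<N. \<kappa>' q i = \<kappa>' q' i) \<longrightarrow> K' p' q'"
    if pq: "p \<in> X \<times> UNIV" "q \<in> X \<times> UNIV" "p \<noteq> q" "K' p q" for p q
  proof -
    obtain d where d: "agree d (snd p) (snd q)" "snd p d \<noteq> snd q d" "K d (fst p) (fst q)"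
      using pq(4) unfolding K'_def by blast
    have "fst p \<in> X" "fst q \<in> X" using pq by auto
    from op[OF this d(3)] obtain N where N: "\<And>x' y'. \<lbrakk>x' \<in> X; y' \<in> X; agree N (\<kappa> (fst p)) (\<kappa> x');
        agree N (\<kappa> (fst q)) (\<kappa> y')\<rbrakk> \<Longrightarrow> K d x' y'" by blast
    have "K' p' q'" if p': "p' \<in> X \<times> UNIV" "q' \<in> X \<times> UNIV" "\<forall>i<N + Suc d. \<kappa>' p i = \<kappa>' p' i"
      "\<forall>i<N + Suc d. \<kappa>' q i = \<kappa>' q' i" for p' q'
    proof -
      have "agree d (snd p') (snd q')" "snd p' d \<noteq> snd q' d"
        using d(1,2) agr(2)[OF p'(3)] agr(2)[OF p'(4)] by (auto simp: agree_def)
      moreover have "K d (fst p') (fst q')"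
        using p'(1,2) agr(1)[OF p'(3)] agr(1)[OF p'(4)] by (intro N) (auto intro: agree_mono)
      ultimately show ?thesis unfolding K'_def by blast
    qed
    then show ?thesis by blast
  qed
  show thesis
  proof (rule OCA_seq[OF \<open>OCA\<close> inj' sym' op'])
    fix W :: "nat \<Rightarrow> ('x \<times> (nat \<Rightarrow> bool)) set"
    assume K1: "X \<times> UNIV = (\<Union>n. W n)" "\<And>n x y. \<lbrakk>x \<in> W n; y \<in> W n; x \<noteq> y\<rbrakk> \<Longrightarrow> \<not> K' x y"
    \<comment> \<open>The points whose fibre in the \<open>k\<close>-th homogeneous set is dense in
      the box of \<open>s\<close>. By Baire category every point has such a fibre.\<close>
    define Z where "Z k s = {x \<in> X. \<forall>z m. length s \<le> m \<longrightarrow> map z [0..<length s] = s \<longrightarrow>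
      (\<exists>\<rho>. (x, \<rho>) \<in> W k \<and> agree m \<rho> z)}" for k s
    have "\<exists>k s. x \<in> Z k s" if x: "x \<in> X" for x
    proof -
      have "\<rho> \<in> UNIV \<Longrightarrow> \<exists>k. \<rho> \<in> {\<rho>. (x, \<rho>) \<in> W k}" for \<rho> using x K1(1) by blast
      from nonmeagre_UN_type[OF not_seq_meagre_UNIV this] obtain k where
        "\<not> seq_meagre {\<rho>. (x, \<rho>) \<in> W k}" by metis
      then obtain y n where yn: "\<And>z m. n \<le> m \<Longrightarrow> agree n z y \<Longrightarrow> \<exists>\<rho>\<in>{\<rho>. (x, \<rho>) \<in> W k}. agree m \<rho> z"
        using nonmeagre_dense[of "{\<rho>. (x, \<rho>) \<in> W k}"] by blast
      then have "x \<in> Z k (map y [0..<n])" using x by (auto simp: Z_def agree_def)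
      then show ?thesis by blast
    qed
    moreover have "Z k s \<subseteq> X" for k s by (auto simp: Z_def)
    ultimately have "X = (\<Union>(k, s). Z k s)" by auto
    also have "\<dots> = (\<Union>n. (\<lambda>(k, s). Z k s) (from_nat n))"
      by (metis UNIV_I UN_extend_simps(10) surj_from_nat)
    finally have cov: "X = (\<Union>n. (\<lambda>(k, s). Z k s) (from_nat n))" .
    have hom: "\<not> K (length s) x x'" if xx: "x \<in> Z k s" "x' \<in> Z k s" for k s x x'
    proof -
      \<comment> \<open>The two extensions of \<open>s\<close> first differ at
        \<open>length s\<close>, which is the grade at which the colouring must fail.\<close>
      define z where "z b i = (if i < length s then s ! i else b)" for b i
      have z: "map (z b) [0..<length s] = s" for b by (rule nth_equalityI) (auto simp: z_def)
      have "\<exists>\<rho>. (u, \<rho>) \<in> W k \<and> agree (Suc (length s)) \<rho> (z b)" if u: "u \<in> Z k s" for u b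
      proof -
        have "\<forall>v m. length s \<le> m \<longrightarrow> map v [0..<length s] = s \<longrightarrow> (\<exists>\<rho>. (u, \<rho>) \<in> W k \<and> agree m \<rho> v)"
          using u by (simp add: Z_def)
        then show ?thesis using z[of b] le_Suc_eq by blast
      qed
      from this[OF xx(1)] this[OF xx(2)] obtain \<rho> \<rho>' where \<rho>: "(x, \<rho>) \<in> W k" "agree (Suc (length s)) \<rho> (z True)"
        "(x', \<rho>') \<in> W k" "agree (Suc (length s)) \<rho>' (z False)" by blast
      have "agree (length s) \<rho> \<rho>'" "\<rho> (length s) \<noteq> \<rho>' (length s)"
        using \<rho>(2,4) by (auto simp: agree_def z_def)
      moreover from this have "\<not> K' (x, \<rho>) (x', \<rho>')" using K1(2)[OF \<rho>(1,3)] by auto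
      ultimately show ?thesis unfolding K'_def by auto
    qed
    show thesis
    proof (rule that(1)[OF cov, of "\<lambda>n. length (snd (from_nat n :: nat \<times> bool list))"])
      fix n x y assume "x \<in> (\<lambda>(k, s). Z k s) (from_nat n)" "y \<in> (\<lambda>(k, s). Z k s) (from_nat n)"
      then show "\<not> K (length (snd (from_nat n :: nat \<times> bool list))) x y"
        using hom by (auto simp: case_prod_beta)
    qed
  next
    fix Y assume K0: "Y \<subseteq> X \<times> UNIV" "uncountable Y" "\<And>x y. \<lbrakk>x \<in> Y; y \<in> Y; x \<noteq> y\<rbrakk> \<Longrightarrow> K' x y"
    show thesis
    proof (rule that(2)[of Y])
      show "fst ` Y \<subseteq> X" "uncountable Y" using K0(1,2) by auto
      show "inj_on snd Y"
      proof (rule inj_onI, rule ccontr)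
        fix p q assume "p \<in> Y" "q \<in> Y" "snd p = snd q" "p \<noteq> q"
        then show False using K0(3)[of p q] unfolding K'_def by auto
      qed
      fix n p q assume pq: "p \<in> Y" "q \<in> Y" "p \<noteq> q" "agree n (snd p) (snd q)"
      then obtain d where "snd p d \<noteq> snd q d" "K d (fst p) (fst q)" using K0(3)[of p q] unfolding K'_def by blast
      moreover from this have "n \<le> d" using pq(4) unfolding agree_def by (meson leI)
      ultimately show "K n (fst p) (fst q)" using mono by blast
    qed
  qed
qed

subsection \<open>Uniformization of coherent families\<close>

text \<open>Indices are attached to nodes of the binary tree. If each node carries finitely many
  values, branches along different reals share only finitely many points, so they form an almost
  disjoint family.\<close>

definition branch :: "(nat \<Rightarrow> bool list) \<Rightarrow> (nat \<Rightarrow> 'a option) \<Rightarrow> (nat \<Rightarrow> bool) \<Rightarrow> nat \<Rightarrow> 'a option"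
  where "branch \<nu> v r n = (if map r [0..<length (\<nu> n)] = \<nu> n then v n else None)"

lemma uncountable_collision:
  fixes g :: "'x \<Rightarrow> 'c::countable"
  assumes "uncountable S"
  obtains x y where "x \<in> S" "y \<in> S" "x \<noteq> y" "g x = g y"
proof -
  have "\<not> inj_on g S" using assms countable_image_inj_on[of g S] by auto
  then show thesis using that unfolding inj_on_def by blast
qed

lemma distinct_representatives:
  fixes S :: "'i \<Rightarrow> 'x set"
  assumes "finite I" "\<And>i. i \<in> I \<Longrightarrow> finite (S i) \<and> card I \<le> card (S i)"
  shows "\<exists>m. inj_on m I \<and> (\<forall>i\<in>I. m i \<in> S i)"
  using assms
proof (induction I rule: finite_induct)
  case (insert j I)
  have "\<forall>i\<in>I. finite (S i) \<and> card I \<le> card (S i)" using insert.prems insert.hyps by fastforce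
  then obtain m where m: "inj_on m I" "\<forall>i\<in>I. m i \<in> S i" using insert.IH by blast
  have "card (m ` I) < card (S j)"
    using insert.prems[of j] insert.hyps card_image_le[of I m] by simp
  then have "\<not> S j \<subseteq> m ` I" using card_mono[of "m ` I" "S j"] insert.hyps by auto
  then obtain a where a: "a \<in> S j" "a \<notin> m ` I" by blast
  have "inj_on (m(j := a)) (insert j I)"
    using m(1) a(2) insert.hyps by (auto simp: inj_on_def)
  moreover have "\<forall>i\<in>insert j I. (m(j := a)) i \<in> S i" using m(2) a(1) by auto
  ultimately show ?case by blast
qed simp

text \<open>Here \<open>f x n\<close> codes the value that the partial function \<open>x\<close>
  produces at \<open>n\<close>. Coherence says that, for any two members and outside a finite set,
  this value depends up to \<open>\<epsilon> / 2\<close> only on \<open>n\<close> and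
  \<open>x n\<close>. The last two assumptions make the family rich enough for category arguments
  and for generic objects.\<close>

locale coherent_family =
  fixes \<G> :: "(nat \<Rightarrow> nat option) set" and f :: "(nat \<Rightarrow> nat option) \<Rightarrow> nat \<Rightarrow> nat"
    and \<delta> :: "nat \<Rightarrow> nat \<Rightarrow> nat \<Rightarrow> real" and \<epsilon> :: real
  assumes eps_pos: "0 < \<epsilon>"
    and delta_refl: "\<And>n a. \<delta> n a a = 0" and delta_sym: "\<And>n a b. \<delta> n a b = \<delta> n b a"
    and delta_triangle: "\<And>n a b c. \<delta> n a c \<le> \<delta> n a b + \<delta> n b c"
    and coherent: "\<And>x y. \<lbrakk>x \<in> \<G>; y \<in> \<G>\<rbrakk> \<Longrightarrow>
      finite {n. x n \<noteq> None \<and> x n = y n \<and> \<epsilon> / 2 < \<delta> n (f x n) (f y n)}"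
    and nonmeagre: "\<not> seq_meagre \<G>"
    and branches: "\<And>\<nu> v. (\<And>\<sigma>. finite {n. \<nu> n = \<sigma> \<and> v n \<noteq> None}) \<Longrightarrow> countable {r. branch \<nu> v r \<notin> \<G>}"
begin

text \<open>The threshold is twice that of coherence: two members within
  \<open>\<epsilon> / 2\<close> of a third at \<open>n\<close> cannot conflict there.\<close>

definition conflict :: "(nat \<Rightarrow> nat option) \<Rightarrow> (nat \<Rightarrow> nat option) \<Rightarrow> nat set"
  where "conflict x y = {n. x n \<noteq> None \<and> x n = y n \<and> \<epsilon> < \<delta> n (f x n) (f y n)}"

text \<open>Recording \<open>f x n\<close> along with \<open>x n\<close> refines the topology so
  that a single conflict is decided by one coordinate of each code.\<close>

definition code :: "(nat \<Rightarrow> nat option) \<Rightarrow> nat \<Rightarrow> nat option \<times> nat"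
  where "code x n = (x n, f x n)"

lemma agree_code: "agree n (code x) (code y) \<longleftrightarrow> (\<forall>i<n. x i = y i \<and> f x i = f y i)"
  by (auto simp: agree_def code_def)

lemma conflict_sym: "conflict x y = conflict y x"
  by (auto simp: conflict_def delta_sym)

lemma finite_conflict:
  assumes "x \<in> \<G>" "y \<in> \<G>"
  shows "finite (conflict x y)"
  by (rule finite_subset[OF _ coherent[OF assms]]) (use eps_pos in \<open>auto simp: conflict_def\<close>)

lemma conflict_mono:
  assumes "agree N (code x) (code x')" "agree N (code y) (code y')" "n < N" "n \<in> conflict x y"
  shows "n \<in> conflict x' y'"
  using assms by (auto simp: conflict_def agree_code)

lemma conflict_above:
  assumes "agree N (code x) (code y)" "n \<in> conflict x y"
  shows "N \<le> n"
proof (rule ccontr)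
  assume "\<not> N \<le> n"
  then show False using assms eps_pos by (auto simp: conflict_def agree_code delta_refl)
qed

text \<open>Density of \<open>Z2\<close> in a box supplies, for every late \<open>n\<close> and
  every \<open>d\<close>, a member with value \<open>d\<close> at \<open>n\<close>; its
  \<open>f\<close>-value there defines \<open>\<phi> n d\<close>. All of \<open>Z1\<close> stays
  within \<open>\<epsilon>\<close> of it at late points, and an arbitrary \<open>g\<close> is
  compared with a member of \<open>Z1\<close> that equals \<open>g\<close> at infinitely many
  alleged bad points.\<close>

lemma cross_homogeneous_uniformizes:
  assumes Z: "\<not> seq_meagre Z1" "\<not> seq_meagre Z2" "Z1 \<subseteq> \<G>"
    and S: "finite S" "\<And>x y. x \<in> Z1 \<Longrightarrow> y \<in> Z2 \<Longrightarrow> conflict x y \<subseteq> S"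
  shows "\<exists>\<phi>. \<forall>g\<in>\<G>. finite {n. \<exists>d. g n = Some d \<and> 2 * \<epsilon> < \<delta> n (f g n) (\<phi> n d)}"
proof -
  obtain z k where zk: "\<And>z' m. k \<le> m \<Longrightarrow> agree k z' z \<Longrightarrow> \<exists>y\<in>Z2. agree m y z'"
    using nonmeagre_dense[OF Z(2)] by blast
  have "\<exists>y\<in>Z2. y n = Some d" if "k \<le> n" for n d
  proof -
    have "agree k (z(n := Some d)) z" using that by (auto simp: agree_def)
    then obtain y where "y \<in> Z2" "agree (Suc n) y (z(n := Some d))" using zk[of "Suc n" "z(n := Some d)"] le_SucI[OF \<open>k \<le> n\<close>] by blast
    then have "y n = Some d" unfolding agree_def by (metis fun_upd_same lessI)
    then show ?thesis using \<open>y \<in> Z2\<close> by blast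
  qed
  note ex = this
  define w where "w n d = (SOME y. y \<in> Z2 \<and> y n = Some d)" for n d
  have w: "w n d \<in> Z2 \<and> w n d n = Some d" if "k \<le> n" for n d
  proof -
    have "\<exists>y. y \<in> Z2 \<and> y n = Some d" using ex[OF that] by blast
    then show ?thesis unfolding w_def by (rule someI_ex)
  qed
  define \<phi> where "\<phi> n d = f (w n d) n" for n d
  obtain N where N: "\<And>n. n \<in> S \<Longrightarrow> n < N" using S(1) finite_nat_set_iff_bounded by auto
  have close: "\<delta> n (f x n) (\<phi> n d) \<le> \<epsilon>" if "x \<in> Z1" "x n = Some d" "max N k \<le> n" for x n d
  proof -
    have "n \<notin> conflict x (w n d)" using S(2)[OF that(1)] w[of n d] N that(3) by force
    then show ?thesis using that w[of n d] by (auto simp: conflict_def \<phi>_def)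
  qed
  have "finite {n. \<exists>d. g n = Some d \<and> 2 * \<epsilon> < \<delta> n (f g n) (\<phi> n d)}" (is "finite ?Q") if g: "g \<in> \<G>" for g
  proof (rule ccontr)
    assume "infinite ?Q"
    then obtain x where x: "x \<in> Z1" "infinite {n \<in> ?Q. x n = g n}"
      by (rule nonmeagre_infinitely_often[OF Z(1)])
    have "x \<in> \<G>" using x(1) Z(3) by blast
    have "{n \<in> ?Q. x n = g n} \<subseteq> {..<max N k} \<union> {n. g n \<noteq> None \<and> g n = x n \<and> \<epsilon> / 2 < \<delta> n (f g n) (f x n)}"
    proof
      fix n assume "n \<in> {n \<in> ?Q. x n = g n}"
      then obtain d where d: "x n = g n" "g n = Some d" "2 * \<epsilon> < \<delta> n (f g n) (\<phi> n d)" by blast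
      show "n \<in> {..<max N k} \<union> {n. g n \<noteq> None \<and> g n = x n \<and> \<epsilon> / 2 < \<delta> n (f g n) (f x n)}"
      proof (cases "n < max N k")
        case False
        then have "max N k \<le> n" by (simp only: not_less)
        then have "\<delta> n (f x n) (\<phi> n d) \<le> \<epsilon>" using close[OF x(1), of n d] d(1,2) by simp
        \<comment> \<open>More than \<open>2 * \<epsilon>\<close> on one side and at most
          \<open>\<epsilon>\<close> on the other leave more than \<open>\<epsilon> / 2\<close>,
          which coherence of \<open>g\<close> and \<open>x\<close> permits only finitely
          often.\<close>
        then have "\<epsilon> / 2 < \<delta> n (f g n) (f x n)"
          using delta_triangle[of n "f g n" "\<phi> n d" "f x n"] d(3) eps_pos by linarith
        then show ?thesis using d by auto
      qed auto
    qed
    then show False using x(2) coherent[OF g \<open>x \<in> \<G>\<close>] by (meson finite_Un finite_lessThan finite_subset)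
  qed
  then show ?thesis by blast
qed

text \<open>Among pairs of nonmeagre subsets choose one for which a largest possible set
  \<open>S\<close> lies in every conflict set. A further conflict between core members would persist
  on nonmeagre pieces where the codes at that point are fixed, and so would enlarge
  \<open>S\<close>.\<close>

lemma bounded_conflicts_uniformizes:
  assumes Z: "\<not> seq_meagre Z" "Z \<subseteq> \<G>" and M: "\<And>x y. x \<in> Z \<Longrightarrow> y \<in> Z \<Longrightarrow> card (conflict x y) \<le> M"
  shows "\<exists>\<phi>. \<forall>g\<in>\<G>. finite {n. \<exists>d. g n = Some d \<and> 2 * \<epsilon> < \<delta> n (f g n) (\<phi> n d)}"
proof -
  define Q where "Q j \<longleftrightarrow> (\<exists>Z1 Z2 S. Z1 \<subseteq> Z \<and> Z2 \<subseteq> Z \<and> \<not> seq_meagre Z1 \<and> \<not> seq_meagre Z2 \<and>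
    finite S \<and> card S = j \<and> (\<forall>x\<in>Z1. \<forall>y\<in>Z2. S \<subseteq> conflict x y))" for j
  have "Q 0" unfolding Q_def using Z(1) by (intro exI[of _ Z] exI[of _ "{}"]) auto
  have ne: "\<exists>x. x \<in> W" if "\<not> seq_meagre W" for W :: "(nat \<Rightarrow> nat option) set"
    using that seq_nowhere_dense_imp_meagre[OF seq_nowhere_dense_empty] by (metis ex_in_conv)
  have bd: "j \<le> M" if Qj: "Q j" for j
  proof -
    obtain Z1 Z2 S where *: "Z1 \<subseteq> Z" "Z2 \<subseteq> Z" "\<not> seq_meagre Z1" "\<not> seq_meagre Z2"
      "card S = j" "\<forall>x\<in>Z1. \<forall>y\<in>Z2. S \<subseteq> conflict x y" using Qj unfolding Q_def by blast
    obtain x y where "x \<in> Z1" "y \<in> Z2" using ne *(3,4) by blast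
    then have xy: "x \<in> Z" "y \<in> Z" "S \<subseteq> conflict x y" using *(1,2,6) by blast+
    then have "card S \<le> card (conflict x y)" using Z(2) by (intro card_mono finite_conflict) auto
    then show ?thesis using M[OF xy(1,2)] *(5) by simp
  qed
  define j where "j = Greatest Q"
  have "Q j" unfolding j_def using \<open>Q 0\<close> bd by (rule GreatestI_nat)
  have maxj: "\<not> Q (Suc j)" using Greatest_le_nat[of Q "Suc j" M] bd unfolding j_def by force
  obtain Z1 Z2 S where *: "Z1 \<subseteq> Z" "Z2 \<subseteq> Z" "\<not> seq_meagre Z1" "\<not> seq_meagre Z2"
      "finite S" "card S = j" "\<forall>x\<in>Z1. \<forall>y\<in>Z2. S \<subseteq> conflict x y" using \<open>Q j\<close> unfolding Q_def by blast
  define pc where "pc W u = {x \<in> W. code x (fst u) = snd u}" for W u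
  \<comment> \<open>Drops the countably many pieces, given by one coordinate and one code, that are
    meagre; every piece through a core point is therefore nonmeagre.\<close>
  define core where "core W = W - (\<Union>u\<in>{u. seq_meagre (pc W u)}. pc W u)" for W
  have core: "\<not> seq_meagre (core W)" if "\<not> seq_meagre W" for W
    unfolding core_def by (rule nonmeagre_Diff[OF that seq_meagre_UN]) auto
  show ?thesis
  proof (rule cross_homogeneous_uniformizes)
    show "\<not> seq_meagre (core Z1)" "\<not> seq_meagre (core Z2)" using core *(3,4) by blast+
    show "core Z1 \<subseteq> \<G>" using *(1) Z(2) unfolding core_def by blast
    show "finite S" by fact
    fix x y assume xy: "x \<in> core Z1" "y \<in> core Z2"
    show "conflict x y \<subseteq> S"
    proof (rule ccontr)
      assume "\<not> conflict x y \<subseteq> S"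
      then obtain n where n: "n \<in> conflict x y" "n \<notin> S" by blast
      define W1 where "W1 = pc Z1 (n, code x n)"
      define W2 where "W2 = pc Z2 (n, code y n)"
      have "x \<in> W1" "y \<in> W2" using xy by (auto simp: W1_def W2_def pc_def core_def)
      then have "\<not> seq_meagre W1" "\<not> seq_meagre W2"
        using xy unfolding core_def W1_def W2_def by blast+
      moreover have "W1 \<subseteq> Z1" "W2 \<subseteq> Z2" by (auto simp: W1_def W2_def pc_def)
      moreover have "insert n S \<subseteq> conflict x' y'" if "x' \<in> W1" "y' \<in> W2" for x' y'
      proof -
        have "x' n = x n" "f x' n = f x n" "y' n = y n" "f y' n = f y n" "x' \<in> Z1" "y' \<in> Z2"
          using that by (auto simp: W1_def W2_def pc_def code_def)
        then show ?thesis using n(1) *(7) by (auto simp: conflict_def)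
      qed
      ultimately have "Q (Suc j)" unfolding Q_def using *(1,2,5,6) n(2)
        by (intro exI[of _ W1] exI[of _ W2] exI[of _ "insert n S"]) auto
      then show False using maxj by simp
    qed
  qed
qed

text \<open>A list \<open>t\<close> is a finite part of a pair \<open>\<nu>, v\<close>, which along each real \<open>r\<close> defines the partial
  function \<open>branch \<nu> v r\<close>.  The pair \<open>x, y\<close> is captured along \<open>r\<close> if this function agrees with \<open>x\<close> and \<open>y\<close>
  at a point where they conflict.\<close>

definition captured :: "(bool list \<times> nat option) list \<Rightarrow> (nat \<Rightarrow> bool) \<Rightarrow> (nat \<Rightarrow> nat option) \<Rightarrow> (nat \<Rightarrow> nat option) \<Rightarrow> bool"
  where "captured t r x y \<longleftrightarrow> (\<exists>n<length t. map r [0..<length (fst (t ! n))] = fst (t ! n) \<and>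
    snd (t ! n) = x n \<and> n \<in> conflict x y)"

lemma captured_sym: "captured t r x y \<Longrightarrow> captured t r y x"
  unfolding captured_def by (metis (mono_tags, lifting) conflict_def conflict_sym mem_Collect_eq)

lemma captured_take: "captured t r x y \<Longrightarrow> take (length t) t' = t \<Longrightarrow> captured t' r x y"
  unfolding captured_def
  by (metis length_take min_less_iff_conj nth_take)

lemma captured_agree:
  assumes "captured t r x y" "length t \<le> N" "agree N (code x) (code x')" "agree N (code y) (code y')"
  shows "captured t r x' y'"
proof -
  obtain n where n: "n < length t" "map r [0..<length (fst (t ! n))] = fst (t ! n)"
    "snd (t ! n) = x n" "n \<in> conflict x y" using assms(1) unfolding captured_def by blast
  then have "n \<in> conflict x' y'" using conflict_mono assms by (meson less_le_trans)
  moreover have "x' n = x n" using assms(2,3) n(1) by (auto simp: agree_code)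
  ultimately show ?thesis using n unfolding captured_def by auto
qed

section \<open>The poset of finite labelled trees with finite sets of reals and members\<close>

definition conditions :: "((nat \<Rightarrow> nat option) \<times> (nat \<Rightarrow> bool)) set \<Rightarrow>
    ((bool list \<times> nat option) list \<times> (nat \<Rightarrow> bool) set \<times> ((nat \<Rightarrow> nat option) \<times> (nat \<Rightarrow> bool)) set) set"
  where "conditions Y = {(t, R, H). finite R \<and> finite H \<and> H \<subseteq> Y \<and>
    (\<forall>r\<in>R. \<forall>p\<in>H. \<forall>q\<in>H. p \<noteq> q \<longrightarrow> captured t r (fst p) (fst q))}"

text \<open>A new value goes only on a node at least as long as the current list. Once the list is
  longer than a node, that node receives no further value, so in the generic tree every node carries
  finitely many.\<close>

definition stronger :: "(bool list \<times> nat option) list \<Rightarrow> (bool list \<times> nat option) list \<Rightarrow> bool"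
  where "stronger t' t \<longleftrightarrow> take (length t) t' = t \<and>
    (\<forall>n. length t \<le> n \<longrightarrow> n < length t' \<longrightarrow> snd (t' ! n) \<noteq> None \<longrightarrow> length t \<le> length (fst (t' ! n)))"

definition condition_order where
  "condition_order Y = {((t', R', H'), (t, R, H)). (t', R', H') \<in> conditions Y \<and> (t, R, H) \<in> conditions Y \<and>
     stronger t' t \<and> R \<subseteq> R' \<and> H \<subseteq> H'}"

lemma stronger_refl: "stronger t t"
  by (simp add: stronger_def)

lemma stronger_length: "stronger t' t \<Longrightarrow> length t \<le> length t'"
  unfolding stronger_def by (metis length_take min.cobounded1 min.commute)

lemma stronger_trans:
  assumes "stronger t'' t'" "stronger t' t"
  shows "stronger t'' t"
proof -
  have le: "length t \<le> length t'" using stronger_length assms by blast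
  have "take (length t) t'' = take (length t) (take (length t') t'')" using le by (simp add: min_def)
  then have "take (length t) t'' = t" using assms unfolding stronger_def by metis
  moreover have "length t \<le> length (fst (t'' ! n))"
    if "length t \<le> n" "n < length t''" "snd (t'' ! n) \<noteq> None" for n
  proof (cases "n < length t'")
    case True
    then have "t'' ! n = t' ! n" using assms(1) unfolding stronger_def by (metis nth_take)
    then show ?thesis using assms(2) that True unfolding stronger_def by metis
  next
    case False
    then have "length t' \<le> length (fst (t'' ! n))"
      using assms(1) that(2,3) by (auto simp: stronger_def not_less)
    then show ?thesis using le by simp
  qed
  ultimately show ?thesis unfolding stronger_def by blast
qed

lemma partial_order_conditions: "partial_order_on (conditions Y) (condition_order Y)"
  unfolding partial_order_on_def preorder_on_def
proof (intro conjI)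
  show "refl_on (conditions Y) (condition_order Y)"
    by (auto simp: refl_on_def condition_order_def stronger_refl)
  show "condition_order Y \<subseteq> conditions Y \<times> conditions Y"
    by (auto simp: condition_order_def)
  show "trans (condition_order Y)"
    unfolding trans_def condition_order_def using stronger_trans by auto
  show "antisym (condition_order Y)"
  proof (rule antisymI)
    fix p q assume "(p, q) \<in> condition_order Y" "(q, p) \<in> condition_order Y"
    moreover have "t = t'" if "stronger t t'" "stronger t' t" for t t'
      using that stronger_length[OF that(1)] stronger_length[OF that(2)] unfolding stronger_def
      by (metis take_all)
    ultimately show "p = q" unfolding condition_order_def by auto
  qed
qed

text \<open>Members in corresponding positions share their codes below \<open>N\<close>, so pairs
  from different positions are already captured by \<open>t\<close>. Two different members in the
  same position have more than \<open>N\<close> conflicts, all at \<open>N\<close> or later, while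
  at most \<open>N\<close> requirements (one per position and real) are to be met; so distinct
  conflict points, still unlabelled, can be assigned to them.\<close>

lemma conditions_amalgamate:
  assumes Y: "\<And>n p q. \<lbrakk>p \<in> Y; q \<in> Y; p \<noteq> q; agree n (snd p) (snd q)\<rbrakk> \<Longrightarrow> n < card (conflict (fst p) (fst q))"
    and c: "(t, R1, H1) \<in> conditions Y" "(t, R2, H2) \<in> conditions Y"
    and h1: "distinct h1" "set h1 = H1" and h2: "distinct h2" "set h2 = H2" and len: "length h1 = length h2"
    and N: "length t + (card R1 + card R2) * length h1 \<le> N"
    and ag: "\<And>i. i < length h1 \<Longrightarrow> agree N (code (fst (h1 ! i))) (code (fst (h2 ! i))) \<and> agree N (snd (h1 ! i)) (snd (h2 ! i))"
  shows "forcing_compatible (conditions Y) (condition_order Y) (t, R1, H1) (t, R2, H2)"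
proof -
  define I where "I = {i. i < length h1 \<and> h1 ! i \<noteq> h2 ! i} \<times> (R1 \<union> R2)"
  define S where "S ir = conflict (fst (h1 ! fst ir)) (fst (h2 ! fst ir))" for ir :: "nat \<times> (nat \<Rightarrow> bool)"
  have fin: "finite R1" "finite R2" "finite H1" "finite H2" "H1 \<subseteq> Y" "H2 \<subseteq> Y"
    using c by (auto simp: conditions_def)
  have cardI: "finite I" "card I \<le> N"
  proof -
    show "finite I" using fin by (auto simp: I_def)
    have "card {i. i < length h1 \<and> h1 ! i \<noteq> h2 ! i} \<le> length h1"
      using card_mono[of "{..<length h1}" "{i. i < length h1 \<and> h1 ! i \<noteq> h2 ! i}"] by auto
    moreover have "card (R1 \<union> R2) \<le> card R1 + card R2" by (rule card_Un_le)
    ultimately have "card I \<le> length h1 * (card R1 + card R2)"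
      unfolding I_def card_cartesian_product by (rule mult_le_mono)
    then show "card I \<le> N" using N by (simp add: mult.commute)
  qed
  have hY: "h1 ! i \<in> Y" "h2 ! i \<in> Y" if "i < length h1" for i
    using that fin h1 h2 len by (metis nth_mem subsetD)+
  have "finite (S ir) \<and> card I \<le> card (S ir)" if "ir \<in> I" for ir
  proof -
    have i: "fst ir < length h1" "h1 ! fst ir \<noteq> h2 ! fst ir" using that by (auto simp: I_def)
    then have "N < card (S ir)" using Y[OF hY[OF i(1)] i(2)] ag[OF i(1)] unfolding S_def by blast
    then show ?thesis using cardI(2) by (metis card.infinite le_trans less_imp_le_nat not_less_zero)
  qed
  from distinct_representatives[of I S, OF cardI(1) this] obtain m
    where m: "inj_on m I" "\<And>ir. ir \<in> I \<Longrightarrow> m ir \<in> S ir" by blast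
  have mN: "N \<le> m ir" if "ir \<in> I" for ir
    using m(2)[OF that] ag[of "fst ir"] that conflict_above unfolding S_def I_def by auto
  define T where "T = Suc (Max (insert (length t) (m ` I)))"
  have mT: "m ir < T" if "ir \<in> I" for ir
    using cardI(1) that unfolding T_def by (intro le_imp_less_Suc Max_ge) auto
  \<comment> \<open>The node at \<open>m (i, r)\<close> is the initial segment of \<open>r\<close>
    of length \<open>length t\<close>: it lies on \<open>r\<close> and is the shortest that
    \<open>stronger\<close> allows. All other new places get no value.\<close>
  define entry where "entry n = (if n \<in> m ` I then
      let ir = inv_into I m n in (map (snd ir) [0..<length t], fst (h1 ! fst ir) n) else ([], None))" for n
  define t' where "t' = t @ map entry [length t..<T]"
  have t': "length t' = T" "length t \<le> T" "take (length t) t' = t"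
    "\<And>n. length t \<le> n \<Longrightarrow> n < T \<Longrightarrow> t' ! n = entry n"
  proof -
    have "length t \<le> Max (insert (length t) (m ` I))" using cardI(1) by (intro Max_ge) auto
    then show "length t \<le> T" by (simp add: T_def)
    then show "length t' = T" by (simp add: t'_def)
    show "take (length t) t' = t" by (simp add: t'_def)
    show "t' ! n = entry n" if "length t \<le> n" "n < T" for n
      using that by (simp add: t'_def nth_append)
  qed
  have str: "stronger t' t"
    unfolding stronger_def using t' by (auto simp: entry_def Let_def)
  have new: "captured t' r (fst (h1 ! i)) (fst (h2 ! i))"
    if "i < length h1" "h1 ! i \<noteq> h2 ! i" "r \<in> R1 \<union> R2" for i r
  proof -
    have ir: "(i, r) \<in> I" using that by (simp add: I_def)
    have "length t \<le> m (i, r)" using mN[OF ir] N by linarith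
    then have e: "t' ! m (i, r) = (map r [0..<length t], fst (h1 ! i) (m (i, r)))"
      using t'(4) mT[OF ir] ir m(1) by (simp add: entry_def)
    show ?thesis unfolding captured_def
      by (rule exI[of _ "m (i, r)"]) (use e mT[OF ir] m(2)[OF ir] t'(1) in \<open>simp add: S_def\<close>)
  qed
  have old: "captured t' r (fst p) (fst q)"
    if "i < length h1" "j < length h1" "i \<noteq> j" "p \<in> {h1 ! i, h2 ! i}" "q \<in> {h1 ! j, h2 ! j}" "r \<in> R1 \<union> R2" for i j p q r
  proof -
    have ne: "h1 ! i \<noteq> h1 ! j" "h2 ! i \<noteq> h2 ! j"
      using that h1(1) h2(1) len by (auto simp: nth_eq_iff_index_eq)
    have mem: "h1 ! i \<in> H1" "h1 ! j \<in> H1" "h2 ! i \<in> H2" "h2 ! j \<in> H2" using that h1 h2 len by auto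
    have agi: "agree N (code (fst (h1 ! i))) (code (fst p))" "agree N (code (fst (h2 ! i))) (code (fst p))"
      "agree N (code (fst (h1 ! j))) (code (fst q))" "agree N (code (fst (h2 ! j))) (code (fst q))"
      using ag[OF that(1)] ag[OF that(2)] that(4,5) agree_sym by auto
    have N': "length t \<le> N" using N by linarith
    from that(6) have "captured t r (fst p) (fst q)"
    proof
      assume "r \<in> R1"
      then have "captured t r (fst (h1 ! i)) (fst (h1 ! j))" using c(1) ne(1) mem by (auto simp: conditions_def)
      then show ?thesis by (rule captured_agree[OF _ N' agi(1,3)])
    next
      assume "r \<in> R2"
      then have "captured t r (fst (h2 ! i)) (fst (h2 ! j))" using c(2) ne(2) mem by (auto simp: conditions_def)
      then show ?thesis by (rule captured_agree[OF _ N' agi(2,4)])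
    qed
    then show ?thesis using captured_take t'(3) by blast
  qed
  have "captured t' r (fst p) (fst q)" if r: "r \<in> R1 \<union> R2" and pq: "p \<in> H1 \<union> H2" "q \<in> H1 \<union> H2" "p \<noteq> q" for r p q
  proof -
    obtain i where i: "i < length h1" "p \<in> {h1 ! i, h2 ! i}"
      using pq(1) h1(2) h2(2) len by (auto simp: in_set_conv_nth)
    obtain j where j: "j < length h1" "q \<in> {h1 ! j, h2 ! j}"
      using pq(2) h1(2) h2(2) len by (auto simp: in_set_conv_nth)
    show ?thesis
    proof (cases "i = j")
      case True
      then have "p = h1 ! i \<and> q = h2 ! i \<or> p = h2 ! i \<and> q = h1 ! i" using i j pq(3) by auto
      then show ?thesis using new[OF i(1) _ r] pq(3) captured_sym by auto
    qed (use old i j r in blast)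
  qed
  then have "(t', R1 \<union> R2, H1 \<union> H2) \<in> conditions Y" using fin by (auto simp: conditions_def)
  then show ?thesis unfolding forcing_compatible_def using c str
    by (intro bexI[of _ "(t', R1 \<union> R2, H1 \<union> H2)"]) (auto simp: condition_order_def)
qed

text \<open>A pattern consists of the list, the number of reals and the codes of the members below
  \<open>NN\<close>. There are countably many patterns, and conditions with equal patterns
  amalgamate.\<close>

lemma conditions_ccc:
  assumes Y: "\<And>n p q. \<lbrakk>p \<in> Y; q \<in> Y; p \<noteq> q; agree n (snd p) (snd q)\<rbrakk> \<Longrightarrow> n < card (conflict (fst p) (fst q))"
  shows "forcing_ccc (conditions Y) (condition_order Y)"
  unfolding forcing_ccc_def
proof (intro allI impI, rule ccontr)
  fix C assume C: "C \<subseteq> conditions Y" and unc: "uncountable C"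
    and anti: "\<forall>p\<in>C. \<forall>q\<in>C. p \<noteq> q \<longrightarrow> \<not> forcing_compatible (conditions Y) (condition_order Y) p q"
  define tt where "tt = (\<lambda>c :: (bool list \<times> nat option) list \<times> (nat \<Rightarrow> bool) set \<times> ((nat \<Rightarrow> nat option) \<times> (nat \<Rightarrow> bool)) set. fst c)"
  define RR where "RR = (\<lambda>c :: (bool list \<times> nat option) list \<times> (nat \<Rightarrow> bool) set \<times> ((nat \<Rightarrow> nat option) \<times> (nat \<Rightarrow> bool)) set. fst (snd c))"
  define HH where "HH = (\<lambda>c :: (bool list \<times> nat option) list \<times> (nat \<Rightarrow> bool) set \<times> ((nat \<Rightarrow> nat option) \<times> (nat \<Rightarrow> bool)) set. snd (snd c))"
  define hl where "hl c = (SOME l. distinct l \<and> set l = HH c)" for c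
  \<comment> \<open>\<open>card (RR c)\<close> is counted twice because the partner of
    \<open>c\<close> will have equally many reals.\<close>
  define NN where "NN c = length (tt c) + (card (RR c) + card (RR c)) * length (hl c)" for c
  define pat where "pat c = (tt c, card (RR c), map (\<lambda>p. (map (code (fst p)) [0..<NN c], map (snd p) [0..<NN c])) (hl c))" for c
  have hl: "distinct (hl c) \<and> set (hl c) = HH c" if "c \<in> C" for c
  proof -
    have "finite (HH c)" using C that by (auto simp: conditions_def HH_def)
    then have "\<exists>l. distinct l \<and> set l = HH c" using finite_distinct_list by blast
    then show ?thesis unfolding hl_def by (rule someI_ex)
  qed
  obtain c1 c2 where cc: "c1 \<in> C" "c2 \<in> C" "c1 \<noteq> c2" "pat c1 = pat c2"
    using uncountable_collision[OF unc, of pat] by blast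
  have same: "tt c1 = tt c2" "card (RR c1) = card (RR c2)" "length (hl c1) = length (hl c2)"
    using cc(4) by (auto simp: pat_def dest: map_eq_imp_length_eq)
  then have NN: "NN c1 = NN c2" by (simp add: NN_def)
  have ag: "agree (NN c1) (code (fst (hl c1 ! i))) (code (fst (hl c2 ! i))) \<and> agree (NN c1) (snd (hl c1 ! i)) (snd (hl c2 ! i))"
    if i: "i < length (hl c1)" for i
  proof -
    have "snd (snd (pat c1)) ! i = snd (snd (pat c2)) ! i" using cc(4) by simp
    then have "(map (code (fst (hl c1 ! i))) [0..<NN c1], map (snd (hl c1 ! i)) [0..<NN c1]) =
        (map (code (fst (hl c2 ! i))) [0..<NN c2], map (snd (hl c2 ! i)) [0..<NN c2])"
      using i same(3) unfolding pat_def by (simp only: snd_conv nth_map)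
    then show ?thesis unfolding agree_iff_map NN by blast
  qed
  have eq: "(tt c1, RR c1, HH c1) = c1" "(tt c1, RR c2, HH c2) = c2"
    subgoal by (simp add: tt_def RR_def HH_def)
    subgoal unfolding same(1) by (simp add: tt_def RR_def HH_def)
    done
  have "forcing_compatible (conditions Y) (condition_order Y) (tt c1, RR c1, HH c1) (tt c1, RR c2, HH c2)"
  proof (rule conditions_amalgamate[OF Y])
    show "(tt c1, RR c1, HH c1) \<in> conditions Y" "(tt c1, RR c2, HH c2) \<in> conditions Y"
      unfolding eq using C cc(1,2) by blast+
    show "length (tt c1) + (card (RR c1) + card (RR c2)) * length (hl c1) \<le> NN c1"
      using same by (simp add: NN_def)
  qed (use hl cc same ag in auto)
  then show False using anti cc(1-3) unfolding eq by blast
qed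

text \<open>Along almost every real, the branch of a generic pair belongs to the family and meets a conflict
  of any two of uncountably many members.  Coherence with the branch excludes this.\<close>

lemma no_uncountable_conflict:
  fixes Y :: "((nat \<Rightarrow> nat option) \<times> (nat \<Rightarrow> bool)) set"
  assumes MA_aleph1 and fY: "fst ` Y \<subseteq> \<G>" and unc: "uncountable Y" and inj: "inj_on snd Y"
    and Y: "\<And>n p q. \<lbrakk>p \<in> Y; q \<in> Y; p \<noteq> q; agree n (snd p) (snd q)\<rbrakk> \<Longrightarrow> n < card (conflict (fst p) (fst q))"
  shows False
proof -
  define P where "P = conditions Y"
  define ord where "ord = condition_order Y"
  \<comment> \<open>Each member enters together with its own real, so that a branch along a real of
    the homogeneous set can later be selected.\<close>
  define p where "p y = ([] :: (bool list \<times> nat option) list, {snd y}, {y})" for y :: "(nat \<Rightarrow> nat option) \<times> (nat \<Rightarrow> bool)"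
  define D where "D i = {c \<in> P. i \<le> length (fst c)}" for i
  have pP: "p y \<in> P" if "y \<in> Y" for y using that by (auto simp: p_def P_def conditions_def)
  have D: "forcing_dense P ord (D i)" for i
    unfolding forcing_dense_def
  proof (intro conjI ballI)
    show "D i \<subseteq> P" by (auto simp: D_def)
    fix c assume c: "c \<in> P"
    obtain t R H where trh: "c = (t, R, H)" by (cases c) auto
    define t' where "t' = t @ replicate i ([], None)"
    have tk: "take (length t) t' = t" by (simp add: t'_def)
    have "(t', R, H) \<in> P" using c captured_take[OF _ tk] unfolding trh P_def conditions_def by blast
    moreover have "stronger t' t" unfolding stronger_def using tk by (auto simp: t'_def nth_append)
    ultimately show "\<exists>q\<in>D i. (q, c) \<in> ord"
      using c by (intro bexI[of _ "(t', R, H)"]) (auto simp: D_def trh ord_def condition_order_def P_def t'_def)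
  qed
  have po: "partial_order_on P ord" unfolding P_def ord_def by (rule partial_order_conditions)
  have ccc: "forcing_ccc P ord" unfolding P_def ord_def by (rule conditions_ccc[OF Y])
  obtain G where G: "G \<subseteq> P" "\<And>a b. \<lbrakk>a \<in> G; b \<in> G\<rbrakk> \<Longrightarrow> \<exists>s\<in>G. (s, a) \<in> ord \<and> (s, b) \<in> ord"
    "\<And>i. G \<inter> D i \<noteq> {}" "uncountable {y \<in> Y. p y \<in> G}"
    by (rule MA_filter[of P ord Y p D, OF \<open>MA_aleph1\<close> po ccc unc pP D]) (assumption | rule that)+
  have leD: "stronger (fst a) (fst b)" "fst (snd b) \<subseteq> fst (snd a)" "snd (snd b) \<subseteq> snd (snd a)" if "(a, b) \<in> ord" for a b
    using that by (auto simp: ord_def condition_order_def)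
  have nth: "fst a ! n = fst b ! n" if "(a, b) \<in> ord" "n < length (fst b)" for a b n
    using leD(1)[OF that(1)] that(2) unfolding stronger_def by (metis nth_take)
  define cc where "cc n = (SOME c. c \<in> G \<inter> D (Suc n))" for n
  have cc: "cc n \<in> G" "n < length (fst (cc n))" for n
  proof -
    have "cc n \<in> G \<inter> D (Suc n)" unfolding cc_def by (rule someI_ex) (use G(3) in blast)
    then show "cc n \<in> G" "n < length (fst (cc n))" by (auto simp: D_def)
  qed
  define \<nu> where "\<nu> n = fst (fst (cc n) ! n)" for n
  define v where "v n = snd (fst (cc n) ! n)" for n
  have entry: "fst c ! n = (\<nu> n, v n)" if c: "c \<in> G" "n < length (fst c)" for c n
  proof -
    obtain s where "(s, c) \<in> ord" "(s, cc n) \<in> ord" using G(2)[OF c(1) cc(1)[of n]] by blast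
    then show ?thesis using nth[of s c n] nth[of s "cc n" n] c(2) cc(2) by (simp add: \<nu>_def v_def)
  qed
  have fin: "finite {n. \<nu> n = \<sigma> \<and> v n \<noteq> None}" for \<sigma>
  proof -
    define c where "c = cc (length \<sigma>)"
    have c: "c \<in> G" "length \<sigma> < length (fst c)" using cc by (auto simp: c_def)
    have "n < length (fst c)" if n: "\<nu> n = \<sigma>" "v n \<noteq> None" for n
    proof (rule ccontr)
      assume big: "\<not> n < length (fst c)"
      obtain s where s: "s \<in> G" "(s, c) \<in> ord" "(s, cc n) \<in> ord" using G(2)[OF c(1) cc(1)[of n]] by blast
      have "n < length (fst s)" using stronger_length[OF leD(1)[OF s(3)]] cc(2)[of n] by linarith
      moreover from this have "fst s ! n = (\<nu> n, v n)" using entry s(1) by blast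
      ultimately have "length (fst c) \<le> length (\<nu> n)"
        using leD(1)[OF s(2)] big n(2) unfolding stronger_def by (metis fst_conv leI snd_conv)
      then show False using n(1) c(2) by simp
    qed
    then have "{n. \<nu> n = \<sigma> \<and> v n \<noteq> None} \<subseteq> {..<length (fst c)}" by auto
    then show ?thesis using finite_subset by blast
  qed
  define V where "V = {y \<in> Y. p y \<in> G}"
  have "uncountable (snd ` V)"
  proof -
    have "inj_on snd V" using inj by (rule inj_on_subset) (auto simp: V_def)
    then show ?thesis using G(4) countable_image_inj_on unfolding V_def by blast
  qed
  moreover have "countable {r. branch \<nu> v r \<notin> \<G>}" by (rule branches[OF fin])
  \<comment> \<open>\<open>snd\<close> is injective, so \<open>V\<close> supplies uncountably many
    reals, while only countably many branches fall outside the family.\<close>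
  ultimately have "\<not> snd ` V \<subseteq> {r. branch \<nu> v r \<notin> \<G>}" using countable_subset by blast
  then obtain y0 where y0: "y0 \<in> V" "branch \<nu> v (snd y0) \<in> \<G>" by blast
  define z where "z = branch \<nu> v (snd y0)"
  have capt: "\<exists>n. z n = fst y n \<and> n \<in> conflict (fst y) (fst y')" if yy: "y \<in> V" "y' \<in> V" "y \<noteq> y'" for y y'
  proof -
    have "p y \<in> G" "p y' \<in> G" "p y0 \<in> G" using yy y0(1) by (auto simp: V_def)
    then obtain s0 s where "(s0, p y) \<in> ord" "(s0, p y') \<in> ord" "s \<in> G" "(s, s0) \<in> ord" "(s, p y0) \<in> ord"
      using G(2) by metis
    then have s: "s \<in> G" "y \<in> snd (snd s)" "y' \<in> snd (snd s)" "snd y0 \<in> fst (snd s)"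
      using leD(2,3)[of s "p y0"] leD(3)[of s s0] leD(3)[of s0 "p y"] leD(3)[of s0 "p y'"] by (auto simp: p_def)
    \<comment> \<open>The common extension has \<open>snd y0\<close> among its reals and both
      members among its side conditions, so their conflict is captured along the selected
      branch.\<close>
    then have "captured (fst s) (snd y0) (fst y) (fst y')"
      using G(1) yy(3) unfolding P_def conditions_def by (cases s) auto
    then obtain n where n: "n < length (fst s)" "map (snd y0) [0..<length (fst (fst s ! n))] = fst (fst s ! n)"
       "snd (fst s ! n) = fst y n" "n \<in> conflict (fst y) (fst y')" unfolding captured_def by blast
    then have "z n = fst y n" unfolding entry[OF s(1) n(1)] z_def branch_def by simp
    then show ?thesis using n(4) by blast
  qed
  have VG: "fst y \<in> \<G>" if "y \<in> V" for y using that fY by (auto simp: V_def)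
  have "\<exists>N. \<forall>n\<ge>N. z n \<noteq> None \<longrightarrow> z n = fst y n \<longrightarrow> \<delta> n (f z n) (f (fst y) n) \<le> \<epsilon> / 2" if y: "y \<in> V" for y
  proof -
    obtain N where "\<forall>n\<in>{n. z n \<noteq> None \<and> z n = fst y n \<and> \<epsilon> / 2 < \<delta> n (f z n) (f (fst y) n)}. n < N"
      using coherent[of z "fst y"] y0(2) VG[OF y] finite_nat_set_iff_bounded unfolding z_def by auto
    then show ?thesis by (intro exI[of _ N]) (force simp: not_less[symmetric])
  qed
  then obtain N where N: "\<And>y n. y \<in> V \<Longrightarrow> N y \<le> n \<Longrightarrow> z n \<noteq> None \<Longrightarrow> z n = fst y n \<Longrightarrow>
      \<delta> n (f z n) (f (fst y) n) \<le> \<epsilon> / 2" by metis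
  \<comment> \<open>Equal codes below the common bound push every conflict beyond it, and there each
    of the two members is within \<open>\<epsilon> / 2\<close> of \<open>z\<close> wherever it
    agrees with \<open>z\<close>.\<close>
  obtain y y' where yy: "y \<in> V" "y' \<in> V" "y \<noteq> y'"
    "(N y, map (code (fst y)) [0..<N y]) = (N y', map (code (fst y')) [0..<N y'])"
    using uncountable_collision[of V "\<lambda>y. (N y, map (code (fst y)) [0..<N y])"] G(4) unfolding V_def by blast
  then have NN: "N y' = N y" "agree (N y) (code (fst y)) (code (fst y'))" by (auto simp: agree_iff_map)
  obtain n where n: "z n = fst y n" "n \<in> conflict (fst y) (fst y')" using capt[OF yy(1-3)] by blast
  then have c: "z n \<noteq> None" "z n = fst y' n" "\<epsilon> < \<delta> n (f (fst y) n) (f (fst y') n)" by (auto simp: conflict_def)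
  have "N y \<le> n" using conflict_above[OF NN(2) n(2)] .
  then have "\<delta> n (f z n) (f (fst y) n) \<le> \<epsilon> / 2" "\<delta> n (f z n) (f (fst y') n) \<le> \<epsilon> / 2"
    using N[OF yy(1) _ c(1) n(1)] N[OF yy(2) _ c(1,2)] NN(1) by auto
  then show False using delta_triangle[of n "f (fst y) n" "f (fst y') n" "f z n"] delta_sym[of n "f z n"] c(3) by simp
qed

text \<open>At grade \<open>d\<close> a pair is coloured if it has more than \<open>d\<close>
  conflicts. In the first alternative of OCA conflicts are bounded on each of countably many pieces,
  one of which is nonmeagre; the second is excluded by
  \<open>no_uncountable_conflict\<close>.\<close>

theorem uniformization:
  assumes OCA MA_aleph1
  shows "\<exists>\<phi>. \<forall>g\<in>\<G>. finite {n. \<exists>d. g n = Some d \<and> 2 * \<epsilon> < \<delta> n (f g n) (\<phi> n d)}"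
proof (rule OCA_graded[OF \<open>OCA\<close>, of code \<G> "\<lambda>d x y. d < card (conflict x y)"])
  show "inj_on code \<G>" by (auto simp: inj_on_def code_def fun_eq_iff)
  show "d < card (conflict y x)" if "d < card (conflict x y)" for d x y using that conflict_sym by simp
  show "d < card (conflict x y)" if "d \<le> e" "e < card (conflict x y)" for d e x y using that by simp
  fix d x y assume xy: "x \<in> \<G>" "y \<in> \<G>" "d < card (conflict x y)"
  obtain N where N: "\<forall>n\<in>conflict x y. n < N" using finite_conflict[OF xy(1,2)] finite_nat_set_iff_bounded by auto
  have "d < card (conflict x' y')" if "x' \<in> \<G>" "y' \<in> \<G>" "agree N (code x) (code x')" "agree N (code y) (code y')" for x' y'
  proof -
    have "conflict x y \<subseteq> conflict x' y'" using N conflict_mono[OF that(3,4)] by blast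
    then have "card (conflict x y) \<le> card (conflict x' y')" using finite_conflict[OF that(1,2)] card_mono by blast
    then show ?thesis using xy(3) by linarith
  qed
  then show "\<exists>N. \<forall>x'\<in>\<G>. \<forall>y'\<in>\<G>. agree N (code x) (code x') \<longrightarrow> agree N (code y) (code y') \<longrightarrow> d < card (conflict x' y')"
    by blast
next
  fix Z :: "nat \<Rightarrow> (nat \<Rightarrow> nat option) set" and b
  assume Z: "\<G> = (\<Union>n. Z n)" "\<And>n x y. \<lbrakk>x \<in> Z n; y \<in> Z n\<rbrakk> \<Longrightarrow> \<not> b n < card (conflict x y)"
  obtain n where n: "\<not> seq_meagre (Z n)"
    using nonmeagre_UN_type[OF nonmeagre, of Z] Z(1) by blast
  have "Z n \<subseteq> \<G>" using Z(1) by blast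
  then show ?thesis by (rule bounded_conflicts_uniformizes[OF n, of "b n"]) (use Z(2) in \<open>auto simp: not_less\<close>)
next
  fix Y :: "((nat \<Rightarrow> nat option) \<times> (nat \<Rightarrow> bool)) set"
  assume "fst ` Y \<subseteq> \<G>" "uncountable Y" "inj_on snd Y"
    "\<And>n x y. \<lbrakk>x \<in> Y; y \<in> Y; x \<noteq> y; agree n (snd x) (snd y)\<rbrakk> \<Longrightarrow> n < card (conflict (fst x) (fst y))"
  then have False by (rule no_uncountable_conflict[OF \<open>MA_aleph1\<close>])
  then show ?thesis ..
qed

end

section \<open>Nonmeagreness of families that contain almost all branches of every tree\<close>

lemma uncountable_UNIV_nat_bool: "uncountable (UNIV :: (nat \<Rightarrow> bool) set)"
proof
  assume "countable (UNIV :: (nat \<Rightarrow> bool) set)"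
  moreover have "(UNIV :: nat set set) = Collect ` UNIV" by (metis Collect_mem_eq surjI)
  ultimately have "countable (UNIV :: nat set set)" by (metis countable_image)
  then obtain f :: "nat \<Rightarrow> nat set" where "range f = UNIV" by (metis UNIV_not_empty range_from_nat_into)
  then show False using Cantors_theorem[of "UNIV :: nat set"] by auto
qed

text \<open>Ramsey's theorem for a locally finite graph: an infinite clique would give its vertices
  infinitely many neighbours.\<close>

lemma infinite_independent:
  fixes R :: "nat \<Rightarrow> nat \<Rightarrow> bool"
  assumes Q: "infinite Q" and sym: "\<And>x y. R x y \<Longrightarrow> R y x" and fin: "\<And>x. x \<in> Q \<Longrightarrow> finite {y \<in> Q. R x y}"
  obtains b where "b \<subseteq> Q" "infinite b" "\<And>x y. \<lbrakk>x \<in> b; y \<in> b; x \<noteq> y\<rbrakk> \<Longrightarrow> \<not> R x y"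
proof -
  define c where "c e = (if \<exists>x y. e = {x, y} \<and> R x y then 0 else 1 :: nat)" for e
  have c: "c {x, y} = 0 \<longleftrightarrow> R x y" for x y
    using sym by (auto simp: c_def doubleton_eq_iff)
  have "\<forall>x\<in>Q. \<forall>y\<in>Q. x \<noteq> y \<longrightarrow> c {x, y} < 2" by (auto simp: c_def)
  from Ramsey2[OF Q this] obtain b t where b: "b \<subseteq> Q" "infinite b" "\<forall>x\<in>b. \<forall>y\<in>b. x \<noteq> y \<longrightarrow> c {x, y} = t"
    by blast
  have "t \<noteq> 0"
  proof
    assume "t = 0"
    obtain x where x: "x \<in> b" using b(2) by (metis ex_in_conv finite.emptyI)
    have "b - {x} \<subseteq> {y \<in> Q. R x y}" using b(1,3) x c \<open>t = 0\<close> by auto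
    then have "finite (b - {x})" using fin[of x] b(1) x finite_subset by blast
    then show False using b(2) by simp
  qed
  then have "\<not> R x y" if "x \<in> b" "y \<in> b" "x \<noteq> y" for x y using b(3) that c by metis
  then show thesis using that b(1,2) by blast
qed

text \<open>The initial segments are handled in turn, each time prolonging the block already found;
  earlier ones keep avoiding \<open>C\<close> because the block only grows.\<close>

lemma nowhere_dense_avoid_finitely_many:
  assumes C: "seq_nowhere_dense C" and H: "finite H"
  shows "\<exists>z m. n < m \<and> (\<forall>h\<in>H. \<forall>x. agree n x h \<longrightarrow> (\<forall>i. n \<le> i \<longrightarrow> i < m \<longrightarrow> x i = z i) \<longrightarrow> x \<notin> C)"
  using H
proof (induction H rule: finite_induct)
  case (insert h H)
  then obtain z m where zm: "n < m" "\<forall>h\<in>H. \<forall>x. agree n x h \<longrightarrow> (\<forall>i. n \<le> i \<longrightarrow> i < m \<longrightarrow> x i = z i) \<longrightarrow> x \<notin> C"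
    by blast
  define y where "y i = (if i < n then h i else z i)" for i
  obtain z' m' where z': "m \<le> m'" "agree m z' y" "\<forall>x. agree m' x z' \<longrightarrow> x \<notin> C"
    using C unfolding seq_nowhere_dense_def by blast
  have old: "z' i = z i" if "n \<le> i" "i < m" for i using z'(2) that by (simp add: agree_def y_def)
  have "x \<notin> C" if h': "h' \<in> insert h H" "agree n x h'" "\<forall>i. n \<le> i \<longrightarrow> i < m' \<longrightarrow> x i = z' i" for h' x
  proof (cases "h' \<in> H")
    case True
    then show ?thesis using zm(2) h'(2,3) old z'(1) by simp
  next
    case False
    then have "agree n x h" using h' by simp
    then have "agree m' x z'" using h'(3) z'(2) zm(1) unfolding agree_def y_def
      by (metis leI less_trans)
    then show ?thesis using z'(3) by blast
  qed
  then show ?case using zm(1) z'(1) by (intro exI[of _ z'] exI[of _ m']) auto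
qed (auto intro: exI[of _ "Suc n"])

text \<open>If nowhere dense sets \<open>C i\<close> covered the family, some labelled tree would
  have all its branches outside every \<open>C i\<close>: the block of values at the node of length
  \<open>i\<close> on \<open>r\<close> keeps the branch along \<open>r\<close> out of
  \<open>C i\<close>, whatever that branch retains of earlier blocks.\<close>

lemma nonmeagre_if_branches:
  fixes \<G> :: "(nat \<Rightarrow> nat option) set"
  assumes branches: "\<And>\<nu> v. (\<And>\<sigma>. finite {n. \<nu> n = \<sigma> \<and> v n \<noteq> None}) \<Longrightarrow> countable {r. branch \<nu> v r \<notin> \<G>}"
  shows "\<not> seq_meagre \<G>"
proof
  assume "seq_meagre \<G>"
  then obtain C :: "nat \<Rightarrow> (nat \<Rightarrow> nat option) set" where C: "\<And>i. seq_nowhere_dense (C i)" "\<G> \<subseteq> (\<Union>i. C i)"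
    unfolding seq_meagre_def by blast
  define node where "node k = (from_nat k :: bool list)" for k
  \<comment> \<open>A branch retains an unknown part \<open>S\<close> of the earlier values, so the
    new block must work for each of the finitely many \<open>S\<close>.\<close>
  define good where "good k n z m \<longleftrightarrow> (\<forall>S\<subseteq>{..<n}. \<forall>x. (\<forall>i<n. x i = (if i \<in> S then z i else None)) \<longrightarrow>
    (\<forall>i. n \<le> i \<longrightarrow> i < m \<longrightarrow> x i = z i) \<longrightarrow> x \<notin> C (length (node k)))" for k n m and z :: "nat \<Rightarrow> nat option"
  have "\<exists>f :: nat \<Rightarrow> (nat \<Rightarrow> nat option) \<times> nat. \<forall>k. True \<and>
     (snd (f k) < snd (f (Suc k)) \<and> agree (snd (f k)) (fst (f (Suc k))) (fst (f k)) \<and>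
      good k (snd (f k)) (fst (f (Suc k))) (snd (f (Suc k))))"
  proof (rule dependent_nat_choice)
    fix q :: "(nat \<Rightarrow> nat option) \<times> nat" and k
    define n where "n = snd q"
    define H where "H = (\<lambda>S i. if i \<in> S then fst q i else None) ` Pow {..<n}"
    have "finite H" by (simp add: H_def)
    from nowhere_dense_avoid_finitely_many[OF C(1) this, of n "length (node k)"]
    obtain z m where zm: "n < m" "\<forall>h\<in>H. \<forall>x. agree n x h \<longrightarrow> (\<forall>i. n \<le> i \<longrightarrow> i < m \<longrightarrow> x i = z i) \<longrightarrow> x \<notin> C (length (node k))"
      by blast
    define z' where "z' i = (if i < n then fst q i else z i)" for i
    have "good k n z' m"
      unfolding good_def
    proof (intro allI impI)
      fix S x assume S: "S \<subseteq> {..<n}" and x: "\<forall>i<n. x i = (if i \<in> S then z' i else None)" "\<forall>i. n \<le> i \<longrightarrow> i < m \<longrightarrow> x i = z' i"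
      define h where "h i = (if i \<in> S then fst q i else None)" for i
      have "h \<in> H" using S unfolding H_def h_def by blast
      moreover have "agree n x h" using x(1) by (auto simp: agree_def h_def z'_def)
      moreover have "\<forall>i. n \<le> i \<longrightarrow> i < m \<longrightarrow> x i = z i" using x(2) by (simp add: z'_def)
      ultimately show "x \<notin> C (length (node k))" using zm(2) by blast
    qed
    then show "\<exists>q'. True \<and> snd q < snd q' \<and> agree (snd q) (fst q') (fst q) \<and> good k (snd q) (fst q') (snd q')"
      using zm(1) by (intro exI[of _ "(z', m)"]) (auto simp: n_def agree_def z'_def)
  qed simp
  then obtain f :: "nat \<Rightarrow> (nat \<Rightarrow> nat option) \<times> nat" where f: "\<And>k. snd (f k) < snd (f (Suc k))"
    "\<And>k. agree (snd (f k)) (fst (f (Suc k))) (fst (f k))" "\<And>k. good k (snd (f k)) (fst (f (Suc k))) (snd (f (Suc k)))"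
    by blast
  define N where "N k = snd (f k)" for k
  have N: "strict_mono N" unfolding strict_mono_Suc_iff N_def using f(1) by blast
  have ag: "agree (N k) (fst (f l)) (fst (f k))" if "k \<le> l" for k l
    using that
  proof (induction l rule: dec_induct)
    case (step l)
    have "N k \<le> N l" using strict_mono_less_eq[OF N] step(1) by simp
    then show ?case using f(2)[of l] step.IH agree_mono agree_trans unfolding N_def by metis
  qed simp
  define idx where "idx n = (LEAST k. n < N (Suc k))" for n
  have ltN: "n < N (Suc n)" for n using strict_mono_imp_increasing[OF N, of "Suc n"] by simp
  have idx1: "n < N (Suc (idx n))" for n unfolding idx_def by (rule LeastI[of "\<lambda>k. n < N (Suc k)", OF ltN])
  have idx: "idx n = k" if "N k \<le> n" "n < N (Suc k)" for n k
    unfolding idx_def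
  proof (rule Least_equality)
    show "k \<le> j" if "n < N (Suc j)" for j
    proof (rule ccontr)
      assume "\<not> k \<le> j"
      then have "N (Suc j) \<le> N k" unfolding strict_mono_less_eq[OF N] by simp
      then show False using \<open>N k \<le> n\<close> that by simp
    qed
  qed (rule that(2))
  define val where "val n = fst (f (Suc (idx n))) n" for n
  have val: "val n = fst (f k) n" if "n < N k" for n k
  proof (cases "k \<le> Suc (idx n)")
    case True
    then show ?thesis using ag[OF True] that by (simp add: agree_def val_def)
  next
    case False
    then show ?thesis using ag[of "Suc (idx n)" k] idx1[of n] by (simp add: agree_def val_def)
  qed
  define \<nu> where "\<nu> n = node (idx n)" for n
  \<comment> \<open>\<open>from_nat\<close> may return one list at several indices. Values are kept
    only in the block whose index is \<open>to_nat\<close> of its node, so that each node carries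
    one finite block.\<close>
  define v where "v n = (if to_nat (\<nu> n) = idx n then val n else None)" for n
  have "finite {n. \<nu> n = \<sigma> \<and> v n \<noteq> None}" for \<sigma>
  proof -
    have "{n. \<nu> n = \<sigma> \<and> v n \<noteq> None} \<subseteq> {..<N (Suc (to_nat \<sigma>))}"
      using idx1 by (auto simp: v_def split: if_splits)
    then show ?thesis using finite_subset by blast
  qed
  from branches[of \<nu> v, OF this] have "countable {r. branch \<nu> v r \<notin> \<G>}" .
  moreover have "branch \<nu> v r \<notin> C i" for r i
  proof -
    define k where "k = to_nat (map r [0..<i])"
    define S where "S = {n. n < N k \<and> map r [0..<length (\<nu> n)] = \<nu> n \<and> to_nat (\<nu> n) = idx n}"
    have nk: "node k = map r [0..<i]" by (simp add: node_def k_def)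
    have "\<forall>n<N k. branch \<nu> v r n = (if n \<in> S then fst (f (Suc k)) n else None)"
    proof (intro allI impI)
      fix n assume n: "n < N k"
      moreover have "N k < N (Suc k)" using f(1) by (simp add: N_def)
      ultimately show "branch \<nu> v r n = (if n \<in> S then fst (f (Suc k)) n else None)"
        using val[of n "Suc k"] by (auto simp: branch_def S_def v_def)
    qed
    moreover have "\<forall>n. N k \<le> n \<longrightarrow> n < N (Suc k) \<longrightarrow> branch \<nu> v r n = fst (f (Suc k)) n"
    proof (intro allI impI)
      fix n assume n: "N k \<le> n" "n < N (Suc k)"
      then have "idx n = k" by (rule idx)
      then have "\<nu> n = map r [0..<i]" "to_nat (\<nu> n) = idx n" using nk by (auto simp: \<nu>_def k_def)
      then show "branch \<nu> v r n = fst (f (Suc k)) n" using val[OF n(2)] by (simp add: branch_def v_def)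
    qed
    moreover have "S \<subseteq> {..<N k}" by (auto simp: S_def)
    ultimately have "branch \<nu> v r \<notin> C (length (node k))"
      using f(3)[of k] unfolding good_def N_def[symmetric] by blast
    then show ?thesis by (simp add: nk)
  qed
  then have "{r. branch \<nu> v r \<notin> \<G>} = UNIV" using C(2) by blast
  ultimately show False using uncountable_UNIV_nat_bool by simp
qed

subsection \<open>Automorphisms of the power set modulo finite sets\<close>

lemma finite_bounded_choice:
  fixes P :: "'t \<Rightarrow> nat \<Rightarrow> bool"
  assumes "finite T" "\<And>t. t \<in> T \<Longrightarrow> \<exists>g. P t g" "\<And>t g g'. P t g \<Longrightarrow> g \<le> g' \<Longrightarrow> P t g'"
  shows "\<exists>g\<ge>N. \<forall>t\<in>T. P t g"
  using assms(1,2)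
proof (induction T rule: finite_induct)
  case (insert t T)
  then obtain g where g: "g \<ge> N" "\<forall>t\<in>T. P t g" by blast
  obtain g' where "P t g'" using insert.prems by blast
  then have "\<forall>s\<in>insert t T. P s (max g g')" using g(2) assms(3) by (metis insert_iff max.cobounded1 max.cobounded2)
  then show ?case using g(1) by (intro exI[of _ "max g g'"]) auto
qed auto

lemma eventually_cofinite_not_in: "finite C \<Longrightarrow> \<forall>\<^sub>F m in cofinite. m \<notin> C"
  by (simp add: eventually_cofinite)

lemma eventually_cofinite_ge: "\<forall>\<^sub>F m in cofinite. N \<le> (m :: nat)"
  by (simp add: eventually_cofinite not_le)

text \<open>\<open>F\<close> chooses representatives for an automorphism of the power set modulo
  finite sets. \<open>F_finite\<close> says that exactly the class of finite sets is sent to zero,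
  which makes the map well defined and injective on classes.\<close>

locale mod_finite_automorphism =
  fixes F :: "nat set \<Rightarrow> nat set"
  assumes F_Int: "\<And>A B. \<forall>\<^sub>F m in cofinite. m \<in> F (A \<inter> B) \<longleftrightarrow> m \<in> F A \<and> m \<in> F B"
    and F_Compl: "\<And>A. \<forall>\<^sub>F m in cofinite. m \<in> F (- A) \<longleftrightarrow> m \<notin> F A"
    and F_finite: "\<And>A. finite (F A) \<longleftrightarrow> finite A"
    and F_surj: "\<And>B. \<exists>A. \<forall>\<^sub>F m in cofinite. m \<in> F A \<longleftrightarrow> m \<in> B"
begin

lemma F_Diff: "\<forall>\<^sub>F m in cofinite. m \<in> F (A - B) \<longleftrightarrow> m \<in> F A \<and> m \<notin> F B"
proof -
  have "\<forall>\<^sub>F m in cofinite. m \<in> F (A \<inter> - B) \<longleftrightarrow> m \<in> F A \<and> m \<notin> F B"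
    using F_Int[of A "- B"] F_Compl[of B] by eventually_elim auto
  then show ?thesis by (simp add: Diff_eq)
qed

lemma F_Un: "\<forall>\<^sub>F m in cofinite. m \<in> F (A \<union> B) \<longleftrightarrow> m \<in> F A \<or> m \<in> F B"
proof -
  have "\<forall>\<^sub>F m in cofinite. m \<in> F (- (- A - B)) \<longleftrightarrow> m \<in> F A \<or> m \<in> F B"
    using F_Diff[of "- A" B] F_Compl[of "- A - B"] F_Compl[of A] by eventually_elim auto
  moreover have "- (- A - B) = A \<union> B" by blast
  ultimately show ?thesis by simp
qed

lemma F_mono:
  assumes "A \<subseteq> B"
  shows "\<forall>\<^sub>F m in cofinite. m \<in> F A \<longrightarrow> m \<in> F B"
  using F_Int[of A B] Int_absorb2[OF assms] by (auto elim: eventually_mono)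

section \<open>Sets on which the automorphism is induced by a finite-set-valued map\<close>

definition represents :: "(nat \<Rightarrow> nat set) \<Rightarrow> nat set \<Rightarrow> bool"
  where "represents k A \<longleftrightarrow> (\<forall>n\<in>A. finite (k n)) \<and> (\<forall>m. finite {n \<in> A. m \<in> k n}) \<and>
    (\<forall>b\<subseteq>A. \<forall>\<^sub>F m in cofinite. m \<in> F b \<longleftrightarrow> (\<exists>n\<in>b. m \<in> k n))"

definition trivial_on :: "nat set \<Rightarrow> bool"
  where "trivial_on A \<longleftrightarrow> (\<exists>k. represents k A)"

lemma trivial_on_iff:
  "trivial_on A \<longleftrightarrow> (\<exists>k :: nat \<Rightarrow> nat set. (\<forall>n\<in>A. finite (k n)) \<and> (\<forall>m. finite {n \<in> A. m \<in> k n}) \<and>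
    (\<forall>b\<subseteq>A. \<forall>\<^sub>F m in cofinite. m \<in> F b \<longleftrightarrow> (\<exists>n\<in>b. m \<in> k n)))"
  by (simp add: trivial_on_def represents_def)

text \<open>An infinite \<open>C\<close> would be, modulo finite, the image of an infinite
  \<open>c \<subseteq> a\<close>. A nonmeagre \<open>Z\<close> contains two members that differ
  infinitely often on \<open>c\<close>; the image of that difference is infinite, yet constancy
  makes it finite.\<close>

lemma constant_imp_finite:
  assumes Z: "\<not> seq_meagre Z" and C: "C \<subseteq> F a"
    and const: "\<And>x x' m. \<lbrakk>x \<in> Z; x' \<in> Z; m \<in> C\<rbrakk> \<Longrightarrow> m \<in> F {n \<in> a. x n} \<longleftrightarrow> m \<in> F {n \<in> a. x' n}"
  shows "finite C"
proof (rule ccontr)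
  assume inf: "infinite C"
  obtain c0 where c0: "\<forall>\<^sub>F m in cofinite. m \<in> F c0 \<longleftrightarrow> m \<in> C" using F_surj by blast
  define c where "c = c0 \<inter> a"
  have c: "\<forall>\<^sub>F m in cofinite. m \<in> F c \<longleftrightarrow> m \<in> C"
    unfolding c_def using c0 F_Int[of c0 a] by eventually_elim (use C in auto)
  have "infinite c"
  proof
    assume "finite c"
    then have "finite (F c)" by (simp add: F_finite)
    from eventually_cofinite_not_in[OF this] c have "\<forall>\<^sub>F m in cofinite. m \<notin> C" by eventually_elim auto
    then show False using inf by (simp add: eventually_cofinite)
  qed
  obtain x where x: "x \<in> Z" "infinite {n \<in> c. x n = True}"
    using nonmeagre_infinitely_often[OF Z \<open>infinite c\<close>, of "\<lambda>_. True"] by blast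
  obtain x' where x': "x' \<in> Z" "infinite {n \<in> c. x' n = (\<not> x n)}"
    using nonmeagre_infinitely_often[OF Z \<open>infinite c\<close>, of "\<lambda>n. \<not> x n"] by blast
  have fin: "finite {n \<in> c. u n \<and> \<not> v n}" if "u \<in> Z" "v \<in> Z" for u v
  proof -
    have eq: "{n \<in> c. u n \<and> \<not> v n} = ({n \<in> a. u n} - {n \<in> a. v n}) \<inter> c" by (auto simp: c_def)
    have "\<forall>\<^sub>F m in cofinite. m \<notin> F {n \<in> c. u n \<and> \<not> v n}"
      unfolding eq using F_Int[of "{n \<in> a. u n} - {n \<in> a. v n}" c] F_Diff[of "{n \<in> a. u n}" "{n \<in> a. v n}"] c
      by eventually_elim (use const[OF that] in blast)
    then have "finite (F {n \<in> c. u n \<and> \<not> v n})" by (simp add: eventually_cofinite)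
    then show ?thesis by (simp add: F_finite)
  qed
  have "{n \<in> c. x' n = (\<not> x n)} = {n \<in> c. x n \<and> \<not> x' n} \<union> {n \<in> c. x' n \<and> \<not> x n}" by auto
  then show False using x'(2) fin[OF x(1) x'(1)] fin[OF x'(1) x(1)] by simp
qed

text \<open>For \<open>y\<close> in a nonmeagre set each \<open>m\<close> reads the single
  coordinate \<open>h m\<close>, so the fibres of \<open>h\<close> are the candidate representation.
  An arbitrary \<open>b \<subseteq> a\<close> is reached through its intersections with such
  \<open>y\<close>: changing \<open>y\<close> at a point \<open>h m\<close> outside \<open>b\<close>
  does not alter the intersection.\<close>

lemma trivial_on_if_coordinates:
  assumes Z: "\<not> seq_meagre Z" and h: "\<And>m. m \<in> C \<Longrightarrow> h m \<in> a" and C: "C \<subseteq> F a" "finite (F a - C)"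
    and Zh: "\<And>y m. \<lbrakk>y \<in> Z; m \<in> C\<rbrakk> \<Longrightarrow> m \<in> F {n \<in> a. y n} \<longleftrightarrow> y (h m)"
    and cover: "\<And>b. b \<subseteq> a \<Longrightarrow> \<exists>k :: nat. b \<in> V k" and Q: "infinite Q"
    and modulus: "\<And>k M b b' m. \<lbrakk>M \<in> Q; k \<le> M; b \<in> V k; b' \<in> V k; b \<subseteq> a; b' \<subseteq> a; b \<inter> {..<M} = b' \<inter> {..<M};
      m < M; m \<in> F a\<rbrakk> \<Longrightarrow> m \<in> F b \<longleftrightarrow> m \<in> F b'"
  shows "trivial_on a"
proof -
  define k where "k n = {m \<in> C. h m = n}" for n
  have fink: "finite (k n)" for n
  proof -
    have "\<exists>v. y \<in> {y \<in> Z. y n = v}" if "y \<in> Z" for y using that by blast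
    \<comment> \<open>On the half of \<open>Z\<close> with this value at \<open>n\<close>,
      membership of every point of \<open>k n\<close> is constant.\<close>
    then obtain v where v: "\<not> seq_meagre {y \<in> Z. y n = v}" by (rule nonmeagre_UN_type[OF Z])
    show ?thesis
    proof (rule constant_imp_finite[OF v])
      show "k n \<subseteq> F a" using C(1) by (auto simp: k_def)
    qed (auto simp: k_def Zh)
  qed
  have upper: "\<forall>\<^sub>F m in cofinite. m \<in> F b \<longrightarrow> m \<in> C \<and> h m \<in> b" if b: "b \<subseteq> a" for b
  proof -
    define R where "R = (\<lambda>(k, N) y. {n \<in> a. y n} \<inter> b \<in> V k \<and>
      (\<forall>m\<ge>N. m \<in> F ({n \<in> a. y n} \<inter> b) \<longleftrightarrow> m \<in> F {n \<in> a. y n} \<and> m \<in> F b))"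
    have "\<exists>kN :: nat \<times> nat. y \<in> {y \<in> Z. R kN y}" if "y \<in> Z" for y
    proof -
      obtain k where "{n \<in> a. y n} \<inter> b \<in> V k" using cover[of "{n \<in> a. y n} \<inter> b"] b by blast
      moreover obtain N where "\<forall>m\<ge>N. m \<in> F ({n \<in> a. y n} \<inter> b) \<longleftrightarrow> m \<in> F {n \<in> a. y n} \<and> m \<in> F b"
        using F_Int[of "{n \<in> a. y n}" b] unfolding cofinite_eq_sequentially eventually_sequentially by blast
      ultimately show ?thesis using that by (intro exI[of _ "(k, N)"]) (simp add: R_def)
    qed
    then obtain kN :: "nat \<times> nat" where "\<not> seq_meagre {y \<in> Z. R kN y}" by (rule nonmeagre_UN_type[OF Z])
    then obtain y3 n3 where y3: "\<And>z m. n3 \<le> m \<Longrightarrow> agree n3 z y3 \<Longrightarrow> \<exists>y\<in>{y \<in> Z. R kN y}. agree m y z"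
      using nonmeagre_dense[of "{y \<in> Z. R kN y}"] by blast
    obtain k' N' where kN: "kN = (k', N')" by (cases kN)
    have no: "h m < n3" if m: "m \<in> C" "m \<in> F b" "h m \<notin> b" "N' \<le> m" for m
    proof (rule ccontr)
      assume "\<not> h m < n3"
      obtain M where M: "M \<in> Q" "max (max k' n3) (max (Suc m) (Suc (h m))) \<le> M"
        using Q infinite_nat_iff_unbounded_le by blast
      have ex: "\<exists>y\<in>Z. R kN y \<and> agree M y (y3(h m := v))" for v
      proof -
        have "agree n3 (y3(h m := v)) y3" using \<open>\<not> h m < n3\<close> by (auto simp: agree_def)
        then show ?thesis using y3[of M "y3(h m := v)"] M(2) by auto
      qed
      obtain y where y: "y \<in> Z" "R kN y" "agree M y (y3(h m := True))" using ex by blast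
      obtain y' where y': "y' \<in> Z" "R kN y'" "agree M y' (y3(h m := False))" using ex by blast
      have "{n \<in> a. y n} \<inter> b \<inter> {..<M} = {n \<in> a. y' n} \<inter> b \<inter> {..<M}"
        using y(3) y'(3) m(3) by (auto simp: agree_def split: if_splits)
      then have "m \<in> F ({n \<in> a. y n} \<inter> b) \<longleftrightarrow> m \<in> F ({n \<in> a. y' n} \<inter> b)"
        using y(2) y'(2) M m(1) C(1) by (intro modulus[of M k']) (auto simp: R_def kN)
      then have "m \<in> F {n \<in> a. y n} \<longleftrightarrow> m \<in> F {n \<in> a. y' n}"
        using y(2) y'(2) m(2,4) by (auto simp: R_def kN)
      then have "y (h m) \<longleftrightarrow> y' (h m)" using Zh y(1) y'(1) m(1) by blast
      then show False using y(3) y'(3) M(2) by (auto simp: agree_def)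
    qed
    have "finite (\<Union>n<n3. k n)" using fink by simp
    from eventually_cofinite_not_in[OF this] eventually_cofinite_not_in[OF C(2)]
      eventually_cofinite_ge[of N'] F_mono[OF b]
    show ?thesis
    proof eventually_elim
      case (elim m)
      show ?case
      proof
        assume "m \<in> F b"
        then have "m \<in> C" using elim by blast
        then show "m \<in> C \<and> h m \<in> b" using no[of m] elim \<open>m \<in> F b\<close> unfolding k_def by blast
      qed
    qed
  qed
  \<comment> \<open>The reverse implication comes from \<open>upper\<close> for the complement
    \<open>a - b\<close>.\<close>
  have "\<forall>\<^sub>F m in cofinite. m \<in> F b \<longleftrightarrow> (\<exists>n\<in>b. m \<in> k n)" if b: "b \<subseteq> a" for b
    using upper[OF b] upper[of "a - b", OF Diff_subset] F_Diff[of a b]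
  proof eventually_elim
    case (elim m)
    then show ?case using C(1) unfolding k_def by blast
  qed
  moreover have "finite {n \<in> a. m \<in> k n}" for m
    by (rule finite_subset[of _ "{h m}"]) (auto simp: k_def)
  ultimately show ?thesis unfolding trivial_on_iff using fink by blast
qed

text \<open>The relations between the values at \<open>x\<close>, \<open>y\<close>, \<open>x \<inter> y\<close> and \<open>x \<union> y\<close> show that every point of
  the image depends on a single coordinate of \<open>y\<close>.\<close>

lemma continuous_cover_imp_trivial_on:
  fixes V :: "nat \<Rightarrow> nat set set"
  assumes cover: "\<And>b. b \<subseteq> a \<Longrightarrow> \<exists>k. b \<in> V k" and Q: "infinite Q"
    and modulus: "\<And>k M b b' m. \<lbrakk>M \<in> Q; k \<le> M; b \<in> V k; b' \<in> V k; b \<subseteq> a; b' \<subseteq> a; b \<inter> {..<M} = b' \<inter> {..<M};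
      m < M; m \<in> F a\<rbrakk> \<Longrightarrow> m \<in> F b \<longleftrightarrow> m \<in> F b'"
  shows "trivial_on a"
proof -
  define \<Phi> where "\<Phi> x = {n \<in> a. x n}" for x :: "nat \<Rightarrow> bool"
  have Pa: "\<Phi> x \<subseteq> a" for x by (auto simp: \<Phi>_def)
  have "\<exists>k. x \<in> {x. \<Phi> x \<in> V k}" for x using cover[OF Pa] by blast
  then obtain k0 where "\<not> seq_meagre {x. \<Phi> x \<in> V k0}" by (rule nonmeagre_UN_type[OF not_seq_meagre_UNIV])
  define Z where "Z = {x. \<Phi> x \<in> V k0}"
  have Z: "\<not> seq_meagre Z" unfolding Z_def by fact
  \<comment> \<open>The index names the pieces that contain the intersection and the union, and a
    point from which \<open>F\<close> respects both operations. Countably many indices serve all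
    pairs.\<close>
  define R where "R = (\<lambda>(k1, k2, N) x y. \<Phi> x \<inter> \<Phi> y \<in> V k1 \<and> \<Phi> x \<union> \<Phi> y \<in> V k2 \<and>
    (\<forall>m\<ge>N. (m \<in> F (\<Phi> x \<inter> \<Phi> y) \<longleftrightarrow> m \<in> F (\<Phi> x) \<and> m \<in> F (\<Phi> y)) \<and>
            (m \<in> F (\<Phi> x \<union> \<Phi> y) \<longleftrightarrow> m \<in> F (\<Phi> x) \<or> m \<in> F (\<Phi> y))))"
  have exR: "\<exists>i :: nat \<times> nat \<times> nat. R i x y" for x y
  proof -
    obtain k1 k2 where k: "\<Phi> x \<inter> \<Phi> y \<in> V k1" "\<Phi> x \<union> \<Phi> y \<in> V k2"
      using cover[of "\<Phi> x \<inter> \<Phi> y"] cover[of "\<Phi> x \<union> \<Phi> y"] Pa by blast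
    have "\<forall>\<^sub>F m in cofinite. (m \<in> F (\<Phi> x \<inter> \<Phi> y) \<longleftrightarrow> m \<in> F (\<Phi> x) \<and> m \<in> F (\<Phi> y)) \<and>
            (m \<in> F (\<Phi> x \<union> \<Phi> y) \<longleftrightarrow> m \<in> F (\<Phi> x) \<or> m \<in> F (\<Phi> y))"
      using F_Int F_Un by (rule eventually_conj)
    then obtain N where "\<forall>m\<ge>N. (m \<in> F (\<Phi> x \<inter> \<Phi> y) \<longleftrightarrow> m \<in> F (\<Phi> x) \<and> m \<in> F (\<Phi> y)) \<and>
            (m \<in> F (\<Phi> x \<union> \<Phi> y) \<longleftrightarrow> m \<in> F (\<Phi> x) \<or> m \<in> F (\<Phi> y))"
      unfolding cofinite_eq_sequentially eventually_sequentially by blast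
    then show ?thesis using k by (intro exI[of _ "(k1, k2, N)"]) (simp add: R_def)
  qed
  \<comment> \<open>Relation \<open>i\<close> must hold with nonmeagrely many \<open>y\<close> in
    every box inside that of \<open>s\<close>, so such \<open>y\<close> exist with any prescribed
    finite continuation of \<open>s\<close>.\<close>
  define P where "P = (\<lambda>(i, s) x. \<forall>z m. length s \<le> m \<longrightarrow> map z [0..<length s] = s \<longrightarrow>
    \<not> seq_meagre {y \<in> {y \<in> Z. R i x y}. agree m y z})"
  have "\<exists>w :: (nat \<times> nat \<times> nat) \<times> bool list. x \<in> {x \<in> Z. P w x}" if x: "x \<in> Z" for x
  proof -
    have "\<exists>i. y \<in> {y \<in> Z. R i x y}" if "y \<in> Z" for y using exR that by blast
    then obtain i where i: "\<not> seq_meagre {y \<in> Z. R i x y}" by (rule nonmeagre_UN_type[OF Z])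
    obtain y n where yn: "\<forall>z m. n \<le> m \<longrightarrow> agree n z y \<longrightarrow> \<not> seq_meagre {y \<in> {y \<in> Z. R i x y}. agree m y z}"
      using nonmeagre_box[OF i] by blast
    then have "P (i, map y [0..<n]) x" by (auto simp: P_def agree_def)
    then show ?thesis using x by blast
  qed
  then obtain w where "\<not> seq_meagre {x \<in> Z. P w x}" by (rule nonmeagre_UN_type[OF Z])
  moreover obtain i s where "w = (i, s)" by (cases w)
  moreover define Z1 where "Z1 = {x \<in> Z. P (i, s) x}"
  ultimately have Z1: "\<not> seq_meagre Z1" by simp
  obtain x0 n1 where x0: "\<And>z m. n1 \<le> m \<Longrightarrow> agree n1 z x0 \<Longrightarrow> \<not> seq_meagre {x \<in> Z1. agree m x z}"
    using nonmeagre_box[OF Z1] by blast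
  obtain k1 k2 N where i: "i = (k1, k2, N)" by (cases i)
  define y0 where "y0 j = (if j < length s then s ! j else True)" for j
  define N0 where "N0 = Max {N, n1, length s, k0, k1, k2}"
  have N0: "N \<le> N0" "n1 \<le> N0" "length s \<le> N0" "k0 \<le> N0" "k1 \<le> N0" "k2 \<le> N0" by (auto simp: N0_def)
  have denseZ1: "\<not> seq_meagre {x \<in> Z1. agree m x z}" if "N0 \<le> m" "agree N0 z x0" for z m
    using x0[of m z] that N0(2) agree_mono by fastforce
  have denseZ: "\<not> seq_meagre {y \<in> {y \<in> Z. R i x y}. agree m y z}" if "x \<in> Z1" "N0 \<le> m" "agree N0 z y0" for x z m
  proof -
    have "map z [0..<length s] = map y0 [0..<length s]" using that(3) N0(3) by (auto simp: agree_def)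
    also have "\<dots> = s" by (rule nth_equalityI) (auto simp: y0_def)
    finally show ?thesis using that N0(3) unfolding Z1_def P_def by auto
  qed
  have ne: "\<exists>x. x \<in> W" if "\<not> seq_meagre W" for W :: "(nat \<Rightarrow> bool) set"
    using that seq_nowhere_dense_imp_meagre[OF seq_nowhere_dense_empty] by (metis ex_in_conv)
  define good where "good m n \<longleftrightarrow> n \<in> a \<and> (\<forall>y\<in>Z. agree N0 y y0 \<longrightarrow> (m \<in> F (\<Phi> y) \<longleftrightarrow> y n))" for m n
  have mod0: "m \<in> F (\<Phi> x) \<longleftrightarrow> m \<in> F (\<Phi> x')"
    if "x \<in> Z" "x' \<in> Z" "M \<in> Q" "N0 \<le> M" "m < M" "m \<in> F a" "\<And>j. j < M \<Longrightarrow> j \<in> a \<Longrightarrow> x j = x' j" for x x' M m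
    by (rule modulus[of M k0]) (use that N0 Pa in \<open>auto simp: Z_def \<Phi>_def\<close>)
  \<comment> \<open>Two members of \<open>Z1\<close> that differ below \<open>M\<close> at most at
    \<open>n\<close> and disagree about \<open>m\<close> make \<open>n\<close> the coordinate of
    \<open>m\<close>: if \<open>y n\<close> holds, their unions with \<open>y\<close> coincide below
    \<open>M\<close>, and otherwise their intersections do.\<close>
  have flip: "good m n"
    if x: "x \<in> Z1" "x' \<in> Z1" and M: "M \<in> Q" "N0 \<le> M" "m < M" and m: "m \<in> F a" "N0 \<le> m" and n: "n \<in> a"
      and xx: "\<And>j. j < M \<Longrightarrow> j \<noteq> n \<Longrightarrow> x j = x' j" and mx: "m \<in> F (\<Phi> x)" "m \<notin> F (\<Phi> x')" for x x' M m n
    unfolding good_def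
  proof (intro conjI ballI impI)
    fix y assume y: "y \<in> Z" "agree N0 y y0"
    obtain y1 where y1: "y1 \<in> Z" "R i x y1" "agree M y1 y" using ne[OF denseZ[OF x(1) M(2) y(2)]] by blast
    obtain y2 where y2: "y2 \<in> Z" "R i x' y2" "agree M y2 y" using ne[OF denseZ[OF x(2) M(2) y(2)]] by blast
    have Fy: "m \<in> F (\<Phi> y1) \<longleftrightarrow> m \<in> F (\<Phi> y)" "m \<in> F (\<Phi> y2) \<longleftrightarrow> m \<in> F (\<Phi> y)"
      using y1(3) y2(3) by (intro mod0[OF _ y(1) M m(1)] y1(1) y2(1); simp add: agree_def)+
    have R1: "\<Phi> x \<inter> \<Phi> y1 \<in> V k1" "\<Phi> x \<union> \<Phi> y1 \<in> V k2" "m \<in> F (\<Phi> x \<inter> \<Phi> y1) \<longleftrightarrow> m \<in> F (\<Phi> x) \<and> m \<in> F (\<Phi> y1)"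
        "m \<in> F (\<Phi> x \<union> \<Phi> y1) \<longleftrightarrow> m \<in> F (\<Phi> x) \<or> m \<in> F (\<Phi> y1)"
      using y1(2) N0(1) m(2) unfolding R_def i by auto
    have R2: "\<Phi> x' \<inter> \<Phi> y2 \<in> V k1" "\<Phi> x' \<union> \<Phi> y2 \<in> V k2" "m \<in> F (\<Phi> x' \<inter> \<Phi> y2) \<longleftrightarrow> m \<in> F (\<Phi> x') \<and> m \<in> F (\<Phi> y2)"
        "m \<in> F (\<Phi> x' \<union> \<Phi> y2) \<longleftrightarrow> m \<in> F (\<Phi> x') \<or> m \<in> F (\<Phi> y2)"
      using y2(2) N0(1) m(2) unfolding R_def i by auto
    have yy: "y1 j = y j" "y2 j = y j" if "j < M" for j using y1(3) y2(3) that by (auto simp: agree_def)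
    show "m \<in> F (\<Phi> y) \<longleftrightarrow> y n"
    proof (cases "y n")
      case True
      have "j \<in> \<Phi> x \<union> \<Phi> y1 \<longleftrightarrow> j \<in> \<Phi> x' \<union> \<Phi> y2" if "j < M" for j
        using xx[OF that] yy[OF that] True by (cases "j = n") (auto simp: \<Phi>_def)
      then have "(\<Phi> x \<union> \<Phi> y1) \<inter> {..<M} = (\<Phi> x' \<union> \<Phi> y2) \<inter> {..<M}" by blast
      then have "m \<in> F (\<Phi> x \<union> \<Phi> y1) \<longleftrightarrow> m \<in> F (\<Phi> x' \<union> \<Phi> y2)"
        using M N0 Pa m(1) R1(2) R2(2) by (intro modulus[of M k2]) auto
      then show ?thesis using R1(4) R2(4) mx Fy True by blast
    next
      case False
      have "j \<in> \<Phi> x \<inter> \<Phi> y1 \<longleftrightarrow> j \<in> \<Phi> x' \<inter> \<Phi> y2" if "j < M" for j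
        using xx[OF that] yy[OF that] False by (cases "j = n") (auto simp: \<Phi>_def)
      then have "(\<Phi> x \<inter> \<Phi> y1) \<inter> {..<M} = (\<Phi> x' \<inter> \<Phi> y2) \<inter> {..<M}" by blast
      then have "m \<in> F (\<Phi> x \<inter> \<Phi> y1) \<longleftrightarrow> m \<in> F (\<Phi> x' \<inter> \<Phi> y2)"
        using M N0 Pa m(1) R1(1) R2(1) by (intro modulus[of M k1]) auto
      then show ?thesis using R1(3) R2(3) mx Fy False by blast
    qed
  qed (rule n)
  define B where "B = {m \<in> F a. N0 \<le> m \<and> \<not> (\<exists>n. good m n)}"
  have const: "m \<in> F (\<Phi> x) \<longleftrightarrow> m \<in> F (\<Phi> x')"
    if x: "x \<in> Z1" "x' \<in> Z1" "agree N0 x x0" "agree N0 x' x0" and m: "m \<in> B" for x x' m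
  proof -
    obtain M where M: "M \<in> Q" "max N0 (Suc m) \<le> M" using Q infinite_nat_iff_unbounded_le by blast
    have m': "m \<in> F a" "N0 \<le> m" "\<And>n. \<not> good m n" using m by (auto simp: B_def)
    have ZZ: "x \<in> Z" if "x \<in> Z1" for x using that by (simp add: Z1_def)
    \<comment> \<open>Passes from \<open>x\<close> to \<open>x'\<close> one coordinate at a time. A
      change of membership at some step would make that coordinate good for
      \<open>m\<close>.\<close>
    have "m \<in> F (\<Phi> x'') \<longleftrightarrow> m \<in> F (\<Phi> x)"
      if "N0 \<le> j" "j \<le> M" "x'' \<in> Z1" "agree j x'' x'" "\<And>l. j \<le> l \<Longrightarrow> l < M \<Longrightarrow> x'' l = x l" for j x''
      using that
    proof (induction j arbitrary: x'' rule: dec_induct)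
      case base
      have "agree N0 x'' x" using base(3) x(3,4) agree_sym agree_trans by metis
      then have "x'' l = x l" if "l < M" for l using that base(4)[of l] by (cases "l < N0") (auto simp: agree_def)
      then show ?case using M m' base(2) x(1) ZZ by (intro mod0[of _ _ M]) auto
    next
      case (step j)
      \<comment> \<open>The hybrid need not lie in \<open>Z1\<close>, but density gives a member of
        \<open>Z1\<close> equal to it below \<open>M\<close>.\<close>
      define z where "z l = (if l < j then x' l else x l)" for l
      have "agree N0 z x0" using step(1) x(4) by (auto simp: agree_def z_def)
      then obtain x3 where x3: "x3 \<in> Z1" "agree M x3 z" using ne[OF denseZ1[of M z]] M(2) by auto
      have "agree j x3 x'" using x3(2) step.prems(1) by (auto simp: agree_def z_def)
      moreover have "x3 l = x l" if "j \<le> l" "l < M" for l using x3(2) that by (auto simp: agree_def z_def)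
      ultimately have IH: "m \<in> F (\<Phi> x3) \<longleftrightarrow> m \<in> F (\<Phi> x)" using step.IH[of x3] x3(1) step.prems(1) by simp
      have same: "x'' l = x3 l" if "l < M" "l \<noteq> j" for l
        using that step.prems(3)  step.prems(4)[of l] x3(2) by (cases "l < j") (auto simp: agree_def z_def)
      have "m \<in> F (\<Phi> x'') \<longleftrightarrow> m \<in> F (\<Phi> x3)"
      proof (cases "j \<in> a")
        case True
        then show ?thesis using flip[of x'' x3 M m j] flip[of x3 x'' M m j] same step.prems(2) x3(1) M m' by auto
      next
        case False
        then have "x'' l = x3 l" if "l < M" "l \<in> a" for l using same that by metis
        then show ?thesis using M m' step.prems(2) x3(1) ZZ by (intro mod0[of _ _ M]) auto
      qed
      then show ?case using IH by simp
    qed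
    from this[of M x'] show ?thesis using M x(2) by auto
  qed
  have "finite B"
  proof (rule constant_imp_finite)
    show "\<not> seq_meagre {x \<in> Z1. agree N0 x x0}" using denseZ1[of N0 x0] by simp
    show "B \<subseteq> F a" by (auto simp: B_def)
    fix x x' m assume "x \<in> {x \<in> Z1. agree N0 x x0}" "x' \<in> {x \<in> Z1. agree N0 x x0}" "m \<in> B"
    then show "m \<in> F {n \<in> a. x n} \<longleftrightarrow> m \<in> F {n \<in> a. x' n}" using const[of x x' m] by (simp add: \<Phi>_def)
  qed
  define C where "C = {m \<in> F a. \<exists>n. good m n}"
  define h where "h m = (SOME n. good m n)" for m
  have h: "good m (h m)" if "m \<in> C" for m using that someI_ex[of "good m"] unfolding C_def h_def by blast
  obtain x1 where "x1 \<in> Z1" using ne[OF Z1] by blast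
  show ?thesis
  proof (rule trivial_on_if_coordinates[where V = V and Q = Q and C = C and h = h])
    have "{y \<in> {y \<in> Z. R i x1 y}. agree N0 y y0} \<subseteq> {y \<in> Z. agree N0 y y0}" by blast
    then show "\<not> seq_meagre {y \<in> Z. agree N0 y y0}"
      using denseZ[OF \<open>x1 \<in> Z1\<close>, of N0 y0] seq_meagre_subset by auto
    have "F a - C \<subseteq> {..<N0} \<union> B" by (auto simp: C_def B_def)
    then show "finite (F a - C)" using \<open>finite B\<close> finite_subset by blast
    show "h m \<in> a" if "m \<in> C" for m using h[OF that] by (simp add: good_def)
    show "C \<subseteq> F a" by (auto simp: C_def)
    show "m \<in> F {n \<in> a. y n} \<longleftrightarrow> y (h m)" if "y \<in> {y \<in> Z. agree N0 y y0}" "m \<in> C" for y m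
      using h[OF that(2)] that(1) by (auto simp: good_def \<Phi>_def)
  qed (fact cover Q modulus)+
qed

section \<open>OCA along the branches of a tree\<close>

lemma trivial_on_Un:
  assumes "trivial_on A" "trivial_on B" "A \<inter> B = {}"
  shows "trivial_on (A \<union> B)"
proof -
  obtain k :: "nat \<Rightarrow> nat set" where k: "\<forall>n\<in>A. finite (k n)" "\<And>m. finite {n \<in> A. m \<in> k n}"
    "\<And>b. b \<subseteq> A \<Longrightarrow> \<forall>\<^sub>F m in cofinite. m \<in> F b \<longleftrightarrow> (\<exists>n\<in>b. m \<in> k n)" using assms(1) unfolding trivial_on_iff by blast
  obtain l :: "nat \<Rightarrow> nat set" where l: "\<forall>n\<in>B. finite (l n)" "\<And>m. finite {n \<in> B. m \<in> l n}"
    "\<And>b. b \<subseteq> B \<Longrightarrow> \<forall>\<^sub>F m in cofinite. m \<in> F b \<longleftrightarrow> (\<exists>n\<in>b. m \<in> l n)" using assms(2) unfolding trivial_on_iff by blast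
  define h where "h n = (if n \<in> A then k n else l n)" for n
  have "\<forall>\<^sub>F m in cofinite. m \<in> F b \<longleftrightarrow> (\<exists>n\<in>b. m \<in> h n)" if b: "b \<subseteq> A \<union> B" for b
  proof -
    have eq: "b = b \<inter> A \<union> b \<inter> B" using b by blast
    have "\<forall>\<^sub>F m in cofinite. m \<in> F (b \<inter> A \<union> b \<inter> B) \<longleftrightarrow> (\<exists>n\<in>b. m \<in> h n)"
      using F_Un[of "b \<inter> A" "b \<inter> B"] k(3)[of "b \<inter> A", OF Int_lower2] l(3)[of "b \<inter> B", OF Int_lower2]
    proof eventually_elim
      case (elim m)
      have "(\<exists>n\<in>b. m \<in> h n) \<longleftrightarrow> (\<exists>n\<in>b \<inter> A. m \<in> k n) \<or> (\<exists>n\<in>b \<inter> B. m \<in> l n)"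
        using b assms(3) unfolding h_def by (auto split: if_splits)
      then show ?case using elim by blast
    qed
    then show ?thesis using eq by simp
  qed
  moreover have "finite {n \<in> A \<union> B. m \<in> h n}" for m
    by (rule finite_subset[of _ "{n \<in> A. m \<in> k n} \<union> {n \<in> B. m \<in> l n}"]) (auto simp: h_def k(2) l(2))
  moreover have "\<forall>n\<in>A \<union> B. finite (h n)" using k(1) l(1) by (auto simp: h_def)
  ultimately show ?thesis unfolding trivial_on_iff by (intro exI[of _ h]) blast
qed

text \<open>A homogeneous set yields a set \<open>z\<close> with \<open>z \<inter> a = b\<close> for uncountably many pairs
  \<open>b \<subseteq> a\<close>, and then \<open>F z\<close> separates all the images.\<close>

lemma branches_trivial:
  fixes v :: "nat \<Rightarrow> 'a option"
  assumes OCA and fin: "\<And>\<sigma>. finite {n. \<nu> n = \<sigma> \<and> v n \<noteq> None}"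
  shows "countable {r. \<not> trivial_on (dom (branch \<nu> v r))}"
proof -
  define A where "A r = dom (branch \<nu> v r)" for r
  have A: "n \<in> A r \<longleftrightarrow> v n \<noteq> None \<and> map r [0..<length (\<nu> n)] = \<nu> n" for n r
    by (auto simp: A_def branch_def dom_def split: if_splits)
  define L where "L i = {n. length (\<nu> n) \<le> i \<and> v n \<noteq> None}" for i
  have finL: "finite (L i)" for i
  proof -
    have "L i = (\<Union>\<sigma>\<in>{\<sigma>. set \<sigma> \<subseteq> UNIV \<and> length \<sigma> \<le> i}. {n. \<nu> n = \<sigma> \<and> v n \<noteq> None})" by (auto simp: L_def)
    moreover have "finite {\<sigma> :: bool list. set \<sigma> \<subseteq> UNIV \<and> length \<sigma> \<le> i}" by (rule finite_lists_length_le) simp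
    ultimately show ?thesis using fin by simp
  qed
  have AL: "A r \<inter> A r' \<subseteq> L i" if "r i \<noteq> r' i" for r r' i
  proof
    fix n assume n: "n \<in> A r \<inter> A r'"
    then have "map r [0..<length (\<nu> n)] = map r' [0..<length (\<nu> n)]" using A by auto
    then have "agree (length (\<nu> n)) r r'" by (simp only: agree_iff_map)
    then have "length (\<nu> n) \<le> i" using that unfolding agree_def by (auto simp: not_less[symmetric])
    then show "n \<in> L i" using n A by (simp add: L_def)
  qed
  define X where "X = {(r, a, b) | r a b. b \<subseteq> a \<and> a \<subseteq> A r}"
  define \<kappa> where "\<kappa> = (\<lambda>(r :: nat \<Rightarrow> bool, a, b) n. (r n, n \<in> a, n \<in> b, n \<in> F a, n \<in> F b))"
  \<comment> \<open>As \<open>b \<subseteq> a\<close> and \<open>b' \<subseteq> a'\<close>, the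
    equation says that \<open>b\<close> and \<open>b'\<close> are consistent on the overlap of
    \<open>a\<close> and \<open>a'\<close>; the colour asks that their images be
    inconsistent.\<close>
  define K where "K = (\<lambda>(r :: nat \<Rightarrow> bool, a, b) (r' :: nat \<Rightarrow> bool, a', b').
    r \<noteq> r' \<and> a \<inter> b' = a' \<inter> b \<and> F a \<inter> F b' \<noteq> F a' \<inter> F b)"
  have inj: "inj_on \<kappa> X"
  proof (rule inj_onI)
    fix p q assume eq: "\<kappa> p = \<kappa> q"
    obtain r a b where p: "p = (r, a, b)" by (cases p)
    obtain r' a' b' where q: "q = (r', a', b')" by (cases q)
    have "\<kappa> p n = \<kappa> q n" for n using eq by simp
    then show "p = q" unfolding p q \<kappa>_def by auto
  qed
  have sym: "K q p" if "K p q" for p q using that unfolding K_def by (auto simp: Int_commute)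
  have op: "\<exists>N. \<forall>p'\<in>X. \<forall>q'\<in>X. (\<forall>i<N. \<kappa> p i = \<kappa> p' i) \<longrightarrow> (\<forall>i<N. \<kappa> q i = \<kappa> q' i) \<longrightarrow> K p' q'"
    if pq: "p \<in> X" "q \<in> X" "p \<noteq> q" "K p q" for p q
  proof -
    obtain r a b where p: "p = (r, a, b)" by (cases p)
    obtain r' a' b' where q: "q = (r', a', b')" by (cases q)
    have *: "b \<subseteq> a" "a \<subseteq> A r" "b' \<subseteq> a'" "a' \<subseteq> A r'" "r \<noteq> r'" "a \<inter> b' = a' \<inter> b" "F a \<inter> F b' \<noteq> F a' \<inter> F b"
      using pq unfolding p q X_def K_def by auto
    obtain i where i: "r i \<noteq> r' i" using *(5) by (auto simp: fun_eq_iff)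
    obtain m where m: "m \<in> F a \<inter> F b' \<longleftrightarrow> m \<notin> F a' \<inter> F b" using *(7) by blast
    \<comment> \<open>Below \<open>N\<close> the reals have split, a witness \<open>m\<close> of
      inconsistency has appeared, and all of \<open>L i\<close>, which contains the overlap, has
      been seen; so finite parts of the codes decide the colour.\<close>
    define N where "N = Suc (Max (insert i (insert m (L i))))"
    have N: "i < N" "m < N" "\<And>n. n \<in> L i \<Longrightarrow> n < N"
      unfolding N_def less_Suc_eq_le by (rule Max_ge; simp add: finL)+
    have "K p' q'" if pq': "p' \<in> X" "q' \<in> X" "\<forall>i<N. \<kappa> p i = \<kappa> p' i" "\<forall>i<N. \<kappa> q i = \<kappa> q' i" for p' q'
    proof -
      obtain r1 a1 b1 where p': "p' = (r1, a1, b1)" by (cases p')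
      obtain r1' a1' b1' where q': "q' = (r1', a1', b1')" by (cases q')
      have s: "b1 \<subseteq> a1" "a1 \<subseteq> A r1" "b1' \<subseteq> a1'" "a1' \<subseteq> A r1'" using pq'(1,2) unfolding p' q' X_def by auto
      have e: "r n = r1 n" "n \<in> a \<longleftrightarrow> n \<in> a1" "n \<in> b \<longleftrightarrow> n \<in> b1" "n \<in> F a \<longleftrightarrow> n \<in> F a1" "n \<in> F b \<longleftrightarrow> n \<in> F b1"
        "r' n = r1' n" "n \<in> a' \<longleftrightarrow> n \<in> a1'" "n \<in> b' \<longleftrightarrow> n \<in> b1'" "n \<in> F a' \<longleftrightarrow> n \<in> F a1'" "n \<in> F b' \<longleftrightarrow> n \<in> F b1'"
        if "n < N" for n
      proof -
        have eq: "\<kappa> (r, a, b) n = \<kappa> (r1, a1, b1) n" "\<kappa> (r', a', b') n = \<kappa> (r1', a1', b1') n"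
          using pq'(3,4) that unfolding p q p' q' by blast+
        have *: "(r n, n \<in> a, n \<in> b, n \<in> F a, n \<in> F b) = (r1 n, n \<in> a1, n \<in> b1, n \<in> F a1, n \<in> F b1)"
          "(r' n, n \<in> a', n \<in> b', n \<in> F a', n \<in> F b') = (r1' n, n \<in> a1', n \<in> b1', n \<in> F a1', n \<in> F b1')"
          by (rule eq(1)[unfolded \<kappa>_def prod.case], rule eq(2)[unfolded \<kappa>_def prod.case])
        show "r n = r1 n" "n \<in> a \<longleftrightarrow> n \<in> a1" "n \<in> b \<longleftrightarrow> n \<in> b1" "n \<in> F a \<longleftrightarrow> n \<in> F a1" "n \<in> F b \<longleftrightarrow> n \<in> F b1"
          "r' n = r1' n" "n \<in> a' \<longleftrightarrow> n \<in> a1'" "n \<in> b' \<longleftrightarrow> n \<in> b1'" "n \<in> F a' \<longleftrightarrow> n \<in> F a1'" "n \<in> F b' \<longleftrightarrow> n \<in> F b1'"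
          using * unfolding prod.inject by - (elim conjE, assumption)+
      qed
      have "r1 i \<noteq> r1' i" using i e(1,6)[OF N(1)] by simp
      then have "A r1 \<inter> A r1' \<subseteq> L i" by (rule AL)
      then have sub: "a1 \<inter> a1' \<subseteq> L i" using s(2,4) by blast
      have "n \<in> a1 \<inter> b1' \<longleftrightarrow> n \<in> a1' \<inter> b1" for n
      proof (cases "n < N")
        case True
        then show ?thesis using e[OF True] *(6) by blast
      next
        case False
        then have "n \<notin> a1 \<inter> a1'" using sub N(3) by blast
        then show ?thesis using s by blast
      qed
      then have "a1 \<inter> b1' = a1' \<inter> b1" by blast
      moreover have "F a1 \<inter> F b1' \<noteq> F a1' \<inter> F b1" using m e[OF N(2)] by blast
      moreover have "r1 \<noteq> r1'" using \<open>r1 i \<noteq> r1' i\<close> by auto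
      ultimately show ?thesis unfolding p' q' K_def by simp
    qed
    then show ?thesis by blast
  qed
  show ?thesis
  proof (rule OCA_seq[OF \<open>OCA\<close> inj sym op])
    fix Y assume Y: "Y \<subseteq> X" "uncountable Y" "\<And>p q. \<lbrakk>p \<in> Y; q \<in> Y; p \<noteq> q\<rbrakk> \<Longrightarrow> K p q"
    define z where "z = (\<Union>(r, a, b)\<in>Y. b)"
    have za: "z \<inter> a = b" if p: "(r, a, b) \<in> Y" for r a b
    proof
      have ba: "b \<subseteq> a" using p Y(1) by (auto simp: X_def)
      then show "b \<subseteq> z \<inter> a" using p unfolding z_def by blast
      show "z \<inter> a \<subseteq> b"
      proof
        fix n assume n: "n \<in> z \<inter> a"
        then obtain r' a' b' where q: "(r', a', b') \<in> Y" "n \<in> b'" unfolding z_def by blast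
        show "n \<in> b"
        proof (cases "(r, a, b) = (r', a', b')")
          case False
          then have "a \<inter> b' = a' \<inter> b" using Y(3)[OF p q(1)] unfolding K_def by simp
          then show ?thesis using n q(2) by blast
        qed (use q in simp)
      qed
    qed
    have "\<exists>N. \<forall>m\<ge>N. m \<in> F (snd (snd p)) \<longleftrightarrow> m \<in> F z \<and> m \<in> F (fst (snd p))" if "p \<in> Y" for p
      using F_Int[of z "fst (snd p)"] za[of "fst p" "fst (snd p)" "snd (snd p)"] that
      unfolding cofinite_eq_sequentially eventually_sequentially by simp
    then obtain N where N: "\<And>p m. p \<in> Y \<Longrightarrow> N p \<le> m \<Longrightarrow> m \<in> F (snd (snd p)) \<longleftrightarrow> m \<in> F z \<and> m \<in> F (fst (snd p))"
      by metis
    \<comment> \<open>With a common bound and common codes below it, the images are consistent: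
      below the bound by the codes, beyond it because both are cut out by
      \<open>F z\<close>.\<close>
    obtain p q where pq: "p \<in> Y" "q \<in> Y" "p \<noteq> q" "(N p, map (\<kappa> p) [0..<N p]) = (N q, map (\<kappa> q) [0..<N q])"
      using uncountable_collision[OF Y(2), of "\<lambda>p. (N p, map (\<kappa> p) [0..<N p])"] by blast
    obtain r a b where p: "p = (r, a, b)" by (cases p)
    obtain r' a' b' where q: "q = (r', a', b')" by (cases q)
    have NN: "N q = N p" "agree (N p) (\<kappa> p) (\<kappa> q)" using pq(4) by (auto simp: agree_iff_map)
    have "m \<in> F a \<inter> F b' \<longleftrightarrow> m \<in> F a' \<inter> F b" for m
    proof (cases "m < N p")
      case True
      then have "\<kappa> p m = \<kappa> q m" using NN(2) by (simp add: agree_def)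
      then show ?thesis unfolding p q \<kappa>_def by auto
    next
      case False
      then show ?thesis using N[OF pq(1), of m] N[OF pq(2), of m] NN(1) unfolding p q by auto
    qed
    then have "F a \<inter> F b' = F a' \<inter> F b" by blast
    then show ?thesis using Y(3)[OF pq(1-3)] unfolding p q K_def by simp
  next
    fix W assume W: "X = (\<Union>k :: nat. W k)" "\<And>k p q. \<lbrakk>p \<in> W k; q \<in> W k; p \<noteq> q\<rbrakk> \<Longrightarrow> \<not> K p q"
    have "\<exists>S. countable S \<and> S \<subseteq> W k \<and> (\<forall>p\<in>W k. \<forall>N. \<exists>s\<in>S. agree N (\<kappa> s) (\<kappa> p))" for k
      using countable_seq_dense[of "W k" \<kappa>] unfolding agree_def by metis
    then obtain E where E: "\<And>k. countable (E k)" "\<And>k. E k \<subseteq> W k"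
      "\<And>k p N. p \<in> W k \<Longrightarrow> \<exists>s\<in>E k. agree N (\<kappa> s) (\<kappa> p)" by metis
    \<comment> \<open>Only reals occurring in the countable dense subsets are exceptional. For other
      \<open>r\<close>, an element of \<open>E k\<close> always has a different real and so can be
      compared with members along \<open>r\<close>.\<close>
    have "trivial_on (A r)" if r: "r \<notin> (\<Union>k. fst ` E k)" for r
    proof -
      \<comment> \<open>Below \<open>N\<close> there are finitely many codes, so one bound
        \<open>g N\<close> serves a representative of each of them.\<close>
      have "\<exists>g>N. \<forall>k\<le>N. \<forall>e\<in>E k. \<exists>e'\<in>E k. agree N (\<kappa> e) (\<kappa> e') \<and> A r \<inter> A (fst e') \<subseteq> {..<g}" for N
      proof -
        define T where "T = {(k, map (\<kappa> e) [0..<N]) | k e. k \<le> N \<and> e \<in> E k}"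
        define Q where "Q t g \<longleftrightarrow> (\<exists>e'\<in>E (fst t). map (\<kappa> e') [0..<N] = snd t \<and> A r \<inter> A (fst e') \<subseteq> {..<g})" for t g
        have "T \<subseteq> {..N} \<times> {l. set l \<subseteq> UNIV \<and> length l = N}" by (auto simp: T_def)
        moreover have "finite {l :: (bool \<times> bool \<times> bool \<times> bool \<times> bool) list. set l \<subseteq> UNIV \<and> length l = N}"
          by (rule finite_lists_length_eq) simp
        ultimately have "finite T" using finite_subset by blast
        moreover have "\<exists>g. Q t g" if "t \<in> T" for t
        proof -
          obtain k e where t: "t = (k, map (\<kappa> e) [0..<N])" "e \<in> E k" using \<open>t \<in> T\<close> unfolding T_def by blast
          then have "fst e \<noteq> r" using r by blast
          then obtain i where "r i \<noteq> fst e i" by (auto simp: fun_eq_iff)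
          then have "finite (A r \<inter> A (fst e))" by (rule finite_subset[OF AL finL])
          then obtain g where "A r \<inter> A (fst e) \<subseteq> {..<g}" using finite_nat_iff_bounded by blast
          then show ?thesis unfolding Q_def t using t(2) by auto
        qed
        moreover have "Q t g'" if "Q t g" "g \<le> g'" for t g g' using that unfolding Q_def by fastforce
        ultimately obtain g where g: "g \<ge> Suc N" "\<forall>t\<in>T. Q t g" using finite_bounded_choice[of T Q "Suc N"] by blast
        have "\<exists>e'\<in>E k. agree N (\<kappa> e) (\<kappa> e') \<and> A r \<inter> A (fst e') \<subseteq> {..<g}" if "k \<le> N" "e \<in> E k" for k e
        proof -
          have "(k, map (\<kappa> e) [0..<N]) \<in> T" using that unfolding T_def by blast
          then have "Q (k, map (\<kappa> e) [0..<N]) g" using g(2) by blast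
          then obtain e' where "e' \<in> E k" "map (\<kappa> e') [0..<N] = map (\<kappa> e) [0..<N]" "A r \<inter> A (fst e') \<subseteq> {..<g}"
            unfolding Q_def fst_conv snd_conv by blast
          then show ?thesis unfolding agree_iff_map by (intro bexI[of _ e'] conjI) (simp_all only:)
        qed
        then show ?thesis using g(1) by (intro exI[of _ g]) auto
      qed
      then obtain g where g: "\<And>N. N < g N"
        "\<And>N k e. \<lbrakk>k \<le> N; e \<in> E k\<rbrakk> \<Longrightarrow> \<exists>e'\<in>E k. agree N (\<kappa> e) (\<kappa> e') \<and> A r \<inter> A (fst e') \<subseteq> {..<g N}" by metis
      \<comment> \<open>Since \<open>a\<close> omits the interval from \<open>M\<close> to
        \<open>g M\<close>, it meets the approximating \<open>a1\<close> only below
        \<open>M\<close>, where the codes agree. Hence \<open>b\<close> and \<open>b'\<close> are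
        both consistent with \<open>b1\<close>, and homogeneity transfers this to the
        images.\<close>
      have modulus: "m \<in> F b \<longleftrightarrow> m \<in> F b'"
        if a: "a \<subseteq> A r" "a \<inter> {M..<g M} = {}" and kM: "k \<le> M" and b: "(r, a, b) \<in> W k" "(r, a, b') \<in> W k" "b \<subseteq> a" "b' \<subseteq> a"
          "b \<inter> {..<M} = b' \<inter> {..<M}" and m: "m < M" "m \<in> F a" for a M k b b' m
      proof -
        obtain e where e: "e \<in> E k" "agree M (\<kappa> e) (\<kappa> (r, a, b))" using E(3)[OF b(1)] by blast
        obtain e' where e': "e' \<in> E k" "agree M (\<kappa> e) (\<kappa> e')" "A r \<inter> A (fst e') \<subseteq> {..<g M}" using g(2)[OF kM e(1)] by blast
        obtain r1 a1 b1 where t: "e' = (r1, a1, b1)" by (cases e')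
        have "r1 \<noteq> r" using r e'(1) t by force
        have "e' \<in> X" using e'(1) E(2) W(1) by blast
        then have s: "b1 \<subseteq> a1" "a1 \<subseteq> A r1" by (auto simp: t X_def)
        have ag: "agree M (\<kappa> (r, a, b)) (\<kappa> (r1, a1, b1))" using e(2) e'(2) agree_sym agree_trans unfolding t by metis
        then have ag': "n \<in> a \<longleftrightarrow> n \<in> a1" "n \<in> b \<longleftrightarrow> n \<in> b1" "n \<in> F a \<longleftrightarrow> n \<in> F a1" if "n < M" for n
          using that by (auto simp: agree_def \<kappa>_def)
        have lt: "n < M" if "n \<in> a" "n \<in> a1" for n
        proof -
          have "n < g M" using that s(2) a(1) e'(3) t by auto
          then show ?thesis using that a(2) by (metis IntI atLeastLessThan_iff empty_iff leI)
        qed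
        have "m \<in> F c \<longleftrightarrow> m \<in> F b1" if c: "(r, a, c) \<in> W k" "c \<subseteq> a" "c \<inter> {..<M} = b \<inter> {..<M}" for c
        proof -
          have "n \<in> a \<inter> b1 \<longleftrightarrow> n \<in> a1 \<inter> c" for n
          proof (cases "n < M")
            case True
            then show ?thesis using ag'[OF True] c(3) by blast
          next
            case False
            then show ?thesis using lt s(1) c(2) by blast
          qed
          then have "a \<inter> b1 = a1 \<inter> c" by blast
          moreover have "(r1, a1, b1) \<in> W k" using e'(1) E(2) t by blast
          ultimately have "F a \<inter> F b1 = F a1 \<inter> F c"
            using W(2)[OF c(1), of "(r1, a1, b1)"] \<open>r1 \<noteq> r\<close> unfolding K_def by auto
          then show ?thesis using ag'(3)[OF m(1)] m(2) by blast
        qed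
        from this[OF b(1,3) refl] this[OF b(2,4) b(5)[symmetric]] show ?thesis by simp
      qed
      define M where "M i = (g ^^ i) 0" for i
      have M: "strict_mono M" unfolding strict_mono_Suc_iff using g(1) by (simp add: M_def)
      define idx where "idx n = (LEAST i. n < M (Suc i))" for n
      have idx: "idx n = i" if "M i \<le> n" "n < M (Suc i)" for n i
        unfolding idx_def
      proof (rule Least_equality)
        show "i \<le> j" if "n < M (Suc j)" for j
        proof (rule ccontr)
          assume "\<not> i \<le> j"
          then have "M (Suc j) \<le> M i" unfolding strict_mono_less_eq[OF M] by simp
          then show False using \<open>M i \<le> n\<close> that by simp
        qed
      qed (rule that(2))
      \<comment> \<open>Each half of the blocks omits infinitely many of the required intervals,
        namely the blocks of the other parity.\<close>
      have tr: "trivial_on {n \<in> A r. even (idx n) = d}" for d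
      proof (rule continuous_cover_imp_trivial_on)
        let ?a = "{n \<in> A r. even (idx n) = d}"
        show "\<exists>k. b \<in> {b. (r, ?a, b) \<in> W k}" if "b \<subseteq> ?a" for b
        proof -
          have "(r, ?a, b) \<in> X" using that by (auto simp: X_def)
          then show ?thesis using W(1) by auto
        qed
        have inf: "infinite {i :: nat. even i \<noteq> d}"
          unfolding infinite_nat_iff_unbounded_le
        proof
          fix j :: nat
          show "\<exists>i\<ge>j. i \<in> {i. even i \<noteq> d}"
            by (cases "even j \<noteq> d") (auto intro: exI[of _ j] exI[of _ "Suc j"])
        qed
        have "inj_on M {i. even i \<noteq> d}" by (rule strict_mono_imp_inj_on[OF M])
        then show "infinite (M ` {i. even i \<noteq> d})" using inf finite_imageD by blast
        fix k N b b' m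
        assume N: "N \<in> M ` {i. even i \<noteq> d}" and kN: "k \<le> N" and "b \<in> {b. (r, ?a, b) \<in> W k}" "b' \<in> {b. (r, ?a, b) \<in> W k}"
          "b \<subseteq> ?a" "b' \<subseteq> ?a" "b \<inter> {..<N} = b' \<inter> {..<N}" "m < N" "m \<in> F ?a"
        moreover obtain i where i: "N = M i" "even i \<noteq> d" using N by blast
        have "M (Suc i) = g N" by (simp add: M_def i(1))
        then have "?a \<inter> {N..<g N} = {}" using idx[of i] i by auto
        ultimately show "m \<in> F b \<longleftrightarrow> m \<in> F b'" by (intro modulus[of ?a N k b b' m]) auto
      qed
      have "trivial_on ({n \<in> A r. even (idx n) = True} \<union> {n \<in> A r. even (idx n) = False})"
        by (rule trivial_on_Un[OF tr tr]) auto
      moreover have "{n \<in> A r. even (idx n) = True} \<union> {n \<in> A r. even (idx n) = False} = A r" by blast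
      ultimately show ?thesis by simp
    qed
    then have "{r. \<not> trivial_on (A r)} \<subseteq> (\<Union>k. fst ` E k)" by blast
    moreover have "countable (\<Union>k. fst ` E k)" using E(1) by simp
    ultimately show ?thesis unfolding A_def using countable_subset by blast
  qed
qed

section \<open>One representation for all sets on which the automorphism is trivial\<close>

lemma represents_subset_mod_finite:
  assumes k: "represents k A" and l: "represents l B"
  shows "finite {n \<in> A \<inter> B. \<not> k n \<subseteq> l n}" (is "finite ?Q")
proof (rule ccontr)
  assume inf: "infinite ?Q"
  have "\<forall>n\<in>?Q. \<exists>m. m \<in> k n \<and> m \<notin> l n" by blast
  from bchoice[OF this] obtain d where d: "\<And>n. n \<in> ?Q \<Longrightarrow> d n \<in> k n \<and> d n \<notin> l n" by blast
  \<comment> \<open>On an \<open>R\<close>-independent set the points \<open>d n\<close> are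
    distinct and lie outside every \<open>l y\<close>, so the two representations of one image would
    disagree infinitely often.\<close>
  define R where "R x y \<longleftrightarrow> d x \<in> l y \<or> d y \<in> l x \<or> d x = d y" for x y
  have fin: "finite {y \<in> ?Q. R x y}" if x: "x \<in> ?Q" for x
  proof (rule finite_subset)
    show "{y \<in> ?Q. R x y} \<subseteq> {y \<in> B. d x \<in> l y} \<union> (\<Union>m\<in>l x. {y \<in> A. m \<in> k y}) \<union> {y \<in> A. d x \<in> k y}"
    proof
      fix y assume y: "y \<in> {y \<in> ?Q. R x y}"
      then have "d y \<in> k y" "y \<in> A" "y \<in> B" using d by blast+
      then show "y \<in> {y \<in> B. d x \<in> l y} \<union> (\<Union>m\<in>l x. {y \<in> A. m \<in> k y}) \<union> {y \<in> A. d x \<in> k y}"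
        using y unfolding R_def by auto
    qed
    show "finite ({y \<in> B. d x \<in> l y} \<union> (\<Union>m\<in>l x. {y \<in> A. m \<in> k y}) \<union> {y \<in> A. d x \<in> k y})"
    proof -
      have "finite {y \<in> B. d x \<in> l y}" "finite {y \<in> A. m \<in> k y}" for m using k l unfolding represents_def by blast+
      moreover have "finite (l x)" using l x unfolding represents_def by blast
      ultimately show ?thesis by simp
    qed
  qed
  have sym: "R y x" if "R x y" for x y using that by (auto simp: R_def)
  obtain b where b: "b \<subseteq> ?Q" "infinite b" "\<And>x y. \<lbrakk>x \<in> b; y \<in> b; x \<noteq> y\<rbrakk> \<Longrightarrow> \<not> R x y"
    using infinite_independent[of ?Q R, OF inf sym fin] by blast
  have "b \<subseteq> A" "b \<subseteq> B" using b(1) by auto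
  then have "\<forall>\<^sub>F m in cofinite. m \<in> F b \<longleftrightarrow> (\<exists>n\<in>b. m \<in> k n)" "\<forall>\<^sub>F m in cofinite. m \<in> F b \<longleftrightarrow> (\<exists>n\<in>b. m \<in> l n)"
    using k l unfolding represents_def by blast+
  then have "\<forall>\<^sub>F m in cofinite. (\<exists>n\<in>b. m \<in> k n) \<longleftrightarrow> (\<exists>n\<in>b. m \<in> l n)" by eventually_elim blast
  then have "finite {m. \<not> ((\<exists>n\<in>b. m \<in> k n) \<longleftrightarrow> (\<exists>n\<in>b. m \<in> l n))}" by (simp add: eventually_cofinite)
  moreover have "d ` b \<subseteq> {m. \<not> ((\<exists>n\<in>b. m \<in> k n) \<longleftrightarrow> (\<exists>n\<in>b. m \<in> l n))}"
  proof
    fix m assume "m \<in> d ` b"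
    then obtain x where x: "x \<in> b" "m = d x" by blast
    have "m \<notin> l y" if "y \<in> b" for y
      using b(3)[OF x(1) that] d[of x] b(1) x by (cases "x = y") (auto simp: R_def)
    moreover have "m \<in> k x" using d[of x] b(1) x by blast
    ultimately show "m \<in> {m. \<not> ((\<exists>n\<in>b. m \<in> k n) \<longleftrightarrow> (\<exists>n\<in>b. m \<in> l n))}" using x(1) by blast
  qed
  moreover have "inj_on d b"
    by (rule inj_onI, rule ccontr) (use b(3) in \<open>auto simp: R_def\<close>)
  ultimately show False using b(2) finite_imageD finite_subset by blast
qed

lemma represents_cong:
  assumes k: "represents k A" and l: "\<And>n. finite (l n)" and fin: "finite {n \<in> A. k n \<noteq> l n}"
  shows "represents l A"
proof -
  define E where "E = {n \<in> A. k n \<noteq> l n}"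
  have "finite {n \<in> A. m \<in> l n}" for m
    by (rule finite_subset[of _ "E \<union> {n \<in> A. m \<in> k n}"]) (use k fin in \<open>auto simp: E_def represents_def\<close>)
  moreover have "\<forall>\<^sub>F m in cofinite. m \<in> F b \<longleftrightarrow> (\<exists>n\<in>b. m \<in> l n)" if b: "b \<subseteq> A" for b
  proof -
    have kb: "\<forall>\<^sub>F m in cofinite. m \<in> F b \<longleftrightarrow> (\<exists>n\<in>b. m \<in> k n)" using k b unfolding represents_def by blast
    have "finite (\<Union>n\<in>E. k n \<union> l n)" using fin k l unfolding E_def represents_def by auto
    from kb eventually_cofinite_not_in[OF this] show ?thesis
    proof eventually_elim
      case (elim m)
      have "m \<in> k n \<longleftrightarrow> m \<in> l n" if "n \<in> b" for n
        using elim(2) that b by (cases "n \<in> E") (auto simp: E_def)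
      then show ?case using elim(1) by blast
    qed
  qed
  ultimately show ?thesis unfolding represents_def using l by blast
qed

text \<open>Any two representations agree almost everywhere on their common domain, so they form a
  coherent family, indexed by partial functions through their domains. The uniformization is read
  off at value 0.\<close>

lemma uniform_representation:
  assumes OCA MA_aleph1
  obtains K where "\<And>n. finite (K n)" "\<And>A. trivial_on A \<Longrightarrow> represents K A"
proof -
  define \<G> where "\<G> = {x :: nat \<Rightarrow> nat option. trivial_on (dom x)}"
  define kk where "kk A = (SOME k. represents k A)" for A
  have kk: "represents (kk A) A" if "trivial_on A" for A
    using that unfolding trivial_on_def kk_def by (rule someI_ex)
  define f where "f x n = set_encode (kk (dom x) n)" for x :: "nat \<Rightarrow> nat option" and n
  \<comment> \<open>The discrete metric, scaled so that distinct values are farther apart than 2,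
    the error of a uniformization with \<open>\<epsilon> = 1\<close>.\<close>
  define \<delta> where "\<delta> = (\<lambda>(_ :: nat) (a :: nat) (b :: nat). if a = b then 0 else 10 :: real)"
  have br: "countable {r. branch \<nu> v r \<notin> \<G>}" if "\<And>\<sigma>. finite {n. \<nu> n = \<sigma> \<and> v n \<noteq> None}"
    for \<nu> :: "nat \<Rightarrow> bool list" and v :: "nat \<Rightarrow> nat option"
    unfolding \<G>_def using branches_trivial[OF \<open>OCA\<close>, of \<nu> v] that by simp
  have "coherent_family \<G> f \<delta> 1"
  proof
    show "finite {n. x n \<noteq> None \<and> x n = y n \<and> 1 / 2 < \<delta> n (f x n) (f y n)}" if "x \<in> \<G>" "y \<in> \<G>" for x y
    proof -
      have x: "represents (kk (dom x)) (dom x)" "represents (kk (dom y)) (dom y)" using that kk by (auto simp: \<G>_def)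
      have "finite ({n \<in> dom x \<inter> dom y. \<not> kk (dom x) n \<subseteq> kk (dom y) n} \<union> {n \<in> dom y \<inter> dom x. \<not> kk (dom y) n \<subseteq> kk (dom x) n})"
        using represents_subset_mod_finite[OF x] represents_subset_mod_finite[OF x(2,1)] by simp
      moreover have "{n. x n \<noteq> None \<and> x n = y n \<and> 1 / 2 < \<delta> n (f x n) (f y n)} \<subseteq>
          {n \<in> dom x \<inter> dom y. \<not> kk (dom x) n \<subseteq> kk (dom y) n} \<union> {n \<in> dom y \<inter> dom x. \<not> kk (dom y) n \<subseteq> kk (dom x) n}"
      proof
        fix n assume "n \<in> {n. x n \<noteq> None \<and> x n = y n \<and> 1 / 2 < \<delta> n (f x n) (f y n)}"
        then have n: "n \<in> dom x" "n \<in> dom y" "f x n \<noteq> f y n" by (auto simp: \<delta>_def dom_def)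
        then have "kk (dom x) n \<noteq> kk (dom y) n" unfolding f_def by metis
        then show "n \<in> {n \<in> dom x \<inter> dom y. \<not> kk (dom x) n \<subseteq> kk (dom y) n} \<union> {n \<in> dom y \<inter> dom x. \<not> kk (dom y) n \<subseteq> kk (dom x) n}"
          using n(1,2) by blast
      qed
      ultimately show ?thesis using finite_subset by blast
    qed
    show "\<not> seq_meagre \<G>" using nonmeagre_if_branches br by blast
  qed (use br in \<open>auto simp: \<delta>_def\<close>)
  then obtain \<phi> where \<phi>: "\<And>g. g \<in> \<G> \<Longrightarrow> finite {n. \<exists>d. g n = Some d \<and> 2 * 1 < \<delta> n (f g n) (\<phi> n d)}"
    using coherent_family.uniformization[OF _ assms] by blast
  define K where "K n = set_decode (\<phi> n 0)" for n
  have fK: "finite (K n)" for n by (simp add: K_def)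
  moreover have "represents K A" if A: "trivial_on A" for A
  proof (rule represents_cong[OF kk[OF A] fK])
    define x :: "nat \<Rightarrow> nat option" where "x n = (if n \<in> A then Some 0 else None)" for n
    have dx: "dom x = A" by (auto simp: x_def dom_def)
    then have "finite {n. \<exists>d. x n = Some d \<and> 2 * 1 < \<delta> n (f x n) (\<phi> n d)}" using \<phi> A by (simp add: \<G>_def)
    moreover have "2 * 1 < \<delta> n (f x n) (\<phi> n 0)" if "n \<in> A" "kk A n \<noteq> K n" for n
    proof -
      have "finite (kk A n)" using kk[OF A] that(1) by (auto simp: represents_def)
      then have "f x n \<noteq> \<phi> n 0" using that(2) unfolding f_def dx K_def by (metis set_encode_inverse)
      then show ?thesis by (simp add: \<delta>_def)
    qed
    ultimately show "finite {n \<in> A. kk A n \<noteq> K n}"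
      by (elim finite_subset[rotated]) (auto simp: x_def)
  qed
  ultimately show thesis by (rule that)
qed

text \<open>Embed the binary tree into \<open>c\<close>: every branch is infinite, and
  \<open>F\<close> is trivial on all but countably many of them.\<close>

lemma infinite_trivial_subset:
  assumes OCA "infinite c"
  obtains c' where "c' \<subseteq> c" "infinite c'" "trivial_on c'"
proof -
  define p where "p \<sigma> = enumerate c (to_nat (\<sigma> :: bool list))" for \<sigma>
  have p: "inj p" "range p \<subseteq> c"
  proof -
    have "inj (enumerate c)" by (rule strict_mono_imp_inj_on[OF strict_mono_enumerate[OF assms(2)]])
    then have "inj (enumerate c \<circ> (to_nat :: bool list \<Rightarrow> nat))" using inj_to_nat by (rule inj_compose)
    then show "inj p" by (simp add: p_def[abs_def] comp_def)
    show "range p \<subseteq> c" using enumerate_in_set[OF assms(2)] by (auto simp: p_def)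
  qed
  define \<nu> where "\<nu> = inv_into UNIV p"
  define v where "v n = (if n \<in> range p then Some (0 :: nat) else None)" for n
  have "{n. \<nu> n = \<sigma> \<and> v n \<noteq> None} \<subseteq> {p \<sigma>}" for \<sigma>
    using p(1) by (auto simp: \<nu>_def v_def split: if_splits)
  then have "finite {n. \<nu> n = \<sigma> \<and> v n \<noteq> None}" for \<sigma> by (meson finite.emptyI finite.insertI finite_subset)
  from branches_trivial[OF \<open>OCA\<close>, of \<nu> v, OF this] obtain r where r: "trivial_on (dom (branch \<nu> v r))"
    using uncountable_UNIV_nat_bool by (metis (mono_tags, lifting) UNIV_I countable_subset mem_Collect_eq subsetI)
  have sub: "dom (branch \<nu> v r) \<subseteq> c" using p(2) by (auto simp: branch_def v_def split: if_splits)
  have "p (map r [0..<j]) \<in> dom (branch \<nu> v r)" for j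
    using p(1) by (simp add: branch_def v_def \<nu>_def dom_def)
  then have "range (\<lambda>j. p (map r [0..<j])) \<subseteq> dom (branch \<nu> v r)" by blast
  moreover have "inj (\<lambda>j. p (map r [0..<j]))"
  proof (rule injI)
    fix i j assume "p (map r [0..<i]) = p (map r [0..<j])"
    then have "map r [0..<i] = map r [0..<j]" using p(1) by (auto dest: injD)
    then have "length (map r [0..<i]) = length (map r [0..<j])" by simp
    then show "i = j" by simp
  qed
  ultimately have "infinite (dom (branch \<nu> v r))" using finite_imageD finite_subset by blast
  then show thesis using that sub r by blast
qed

text \<open>Infinitely many discrepancies would already show on an infinite subset of
  \<open>b\<close> where \<open>F\<close> is trivial, and there \<open>K\<close> represents
  \<open>F\<close>.\<close>

lemma represents_everywhere:
  assumes OCA MA_aleph1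
  obtains K where "\<And>n. finite (K n)" "\<And>m. finite {n. m \<in> K n}"
    "\<And>b. \<forall>\<^sub>F m in cofinite. m \<in> F b \<longleftrightarrow> (\<exists>n\<in>b. m \<in> K n)"
proof -
  obtain K where K: "\<And>n. finite (K n)" "\<And>A. trivial_on A \<Longrightarrow> represents K A"
    using uniform_representation[OF assms] by blast
  have fib: "finite {n. m \<in> K n}" for m
  proof (rule ccontr)
    assume "infinite {n. m \<in> K n}"
    then obtain c where c: "c \<subseteq> {n. m \<in> K n}" "infinite c" "trivial_on c"
      using infinite_trivial_subset[OF \<open>OCA\<close>] by blast
    then have "finite {n \<in> c. m \<in> K n}" using K(2) by (auto simp: represents_def)
    moreover have "{n \<in> c. m \<in> K n} = c" using c(1) by blast
    ultimately show False using c(2) by simp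
  qed
  have "\<forall>\<^sub>F m in cofinite. m \<in> F b \<longleftrightarrow> (\<exists>n\<in>b. m \<in> K n)" for b
  proof -
    define D1 where "D1 = {m \<in> F b. \<not> (\<exists>n\<in>b. m \<in> K n)}"
    define D0 where "D0 = {m. (\<exists>n\<in>b. m \<in> K n) \<and> m \<notin> F b}"
    have "finite D1"
    proof (rule ccontr)
      assume inf: "infinite D1"
      \<comment> \<open>Surjectivity presents the uncovered points, modulo finite, as the image of
        some \<open>c \<subseteq> b\<close>.\<close>
      obtain c0 where c0: "\<forall>\<^sub>F m in cofinite. m \<in> F c0 \<longleftrightarrow> m \<in> D1" using F_surj by blast
      define c where "c = c0 \<inter> b"
      have c: "\<forall>\<^sub>F m in cofinite. m \<in> F c \<longleftrightarrow> m \<in> D1"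
        unfolding c_def using c0 F_Int[of c0 b] by eventually_elim (auto simp: D1_def)
      have "infinite c"
      proof
        assume "finite c"
        then have "finite (F c)" by (simp add: F_finite)
        from eventually_cofinite_not_in[OF this] c have "\<forall>\<^sub>F m in cofinite. m \<notin> D1" by eventually_elim auto
        then show False using inf by (simp add: eventually_cofinite)
      qed
      then obtain c' where c': "c' \<subseteq> c" "infinite c'" "trivial_on c'"
        using infinite_trivial_subset[OF \<open>OCA\<close>] by blast
      have "\<forall>\<^sub>F m in cofinite. m \<in> F c' \<longleftrightarrow> (\<exists>n\<in>c'. m \<in> K n)"
        using K(2)[OF c'(3)] unfolding represents_def by blast
      then have "\<forall>\<^sub>F m in cofinite. m \<notin> F c'"
        using c F_mono[OF c'(1)] by eventually_elim (use c'(1) in \<open>auto simp: D1_def c_def\<close>)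
      then have "finite (F c')" by (simp add: eventually_cofinite)
      then show False using c'(2) by (simp add: F_finite)
    qed
    moreover have "finite D0"
    proof (rule ccontr)
      assume inf: "infinite D0"
      \<comment> \<open>As the values of \<open>K\<close> are finite, infinitely many
        \<open>n\<close> are responsible for \<open>D0\<close>; finite fibres later turn infinitely
        many \<open>n\<close> back into infinitely many points.\<close>
      define Q where "Q = {n \<in> b. \<not> K n \<subseteq> F b}"
      have "D0 \<subseteq> (\<Union>n\<in>Q. K n)" by (auto simp: D0_def Q_def)
      then have "infinite Q" using inf K(1) by (meson finite_UN finite_subset)
      then obtain c where c: "c \<subseteq> Q" "infinite c" "trivial_on c"
        using infinite_trivial_subset[OF \<open>OCA\<close>] by blast
      have "c \<subseteq> b" using c(1) by (auto simp: Q_def)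
      have "\<forall>\<^sub>F m in cofinite. m \<in> F c \<longleftrightarrow> (\<exists>n\<in>c. m \<in> K n)"
        using K(2)[OF c(3)] unfolding represents_def by blast
      then have "\<forall>\<^sub>F m in cofinite. (\<exists>n\<in>c. m \<in> K n) \<longrightarrow> m \<in> F b"
        using F_mono[OF \<open>c \<subseteq> b\<close>] by eventually_elim blast
      then have "finite {m. (\<exists>n\<in>c. m \<in> K n) \<and> m \<notin> F b}" by (simp add: eventually_cofinite)
      moreover have "c \<subseteq> (\<Union>m\<in>{m. (\<exists>n\<in>c. m \<in> K n) \<and> m \<notin> F b}. {n. m \<in> K n})"
        using c(1) unfolding Q_def by blast
      ultimately show False using c(2) fib by (meson finite_UN finite_subset)
    qed
    ultimately have "finite (D0 \<union> D1)" by simp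
    from eventually_cofinite_not_in[OF this] show ?thesis
      by eventually_elim (auto simp: D0_def D1_def)
  qed
  then show thesis using that K(1) fib by blast
qed

text \<open>Almost all \<open>K n\<close> are singletons, distinct from each other: infinitely many
  empty values contradict \<open>F_finite\<close>, infinitely many overlaps contradict
  \<open>F_Compl\<close>, and infinitely many values with two points contradict
  \<open>F_surj\<close>. The image of \<open>g\<close> is cofinite because that of the whole set
  is.\<close>

theorem almost_permutation:
  assumes OCA MA_aleph1
  obtains F\<^sub>1 F\<^sub>2 g where "finite F\<^sub>1" "finite F\<^sub>2" "bij_betw g (- F\<^sub>1) (- F\<^sub>2)"
    "\<And>b. \<forall>\<^sub>F m in cofinite. m \<in> F b \<longleftrightarrow> m \<in> g ` (b - F\<^sub>1)"
proof -
  obtain K where K: "\<And>n. finite (K n)" "\<And>m. finite {n. m \<in> K n}"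
    "\<And>b. \<forall>\<^sub>F m in cofinite. m \<in> F b \<longleftrightarrow> (\<exists>n\<in>b. m \<in> K n)"
    using represents_everywhere[OF assms] by blast
  define N0 where "N0 = {n. K n = {}}"
  have "finite N0"
  proof -
    have "\<forall>\<^sub>F m in cofinite. m \<notin> F N0" using K(3)[of N0] by eventually_elim (auto simp: N0_def)
    then have "finite (F N0)" by (simp add: eventually_cofinite)
    then show ?thesis by (simp add: F_finite)
  qed
  define N1 where "N1 = {n. \<exists>n'. n' \<noteq> n \<and> K n \<inter> K n' \<noteq> {}}"
  have "finite N1"
  proof (rule ccontr)
    assume inf: "infinite N1"
    have "\<forall>n\<in>N1. \<exists>n'. n' \<noteq> n \<and> K n \<inter> K n' \<noteq> {}" by (simp add: N1_def)
    from bchoice[OF this] obtain q where q: "\<And>n. n \<in> N1 \<Longrightarrow> q n \<noteq> n \<and> K n \<inter> K (q n) \<noteq> {}" by blast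
    define R where "R x y \<longleftrightarrow> q x = y \<or> q y = x" for x y
    have fin: "finite {y \<in> N1. R x y}" if "x \<in> N1" for x
    proof (rule finite_subset)
      show "{y \<in> N1. R x y} \<subseteq> {q x} \<union> (\<Union>m\<in>K x. {n. m \<in> K n})"
        using q unfolding R_def by fastforce
      show "finite ({q x} \<union> (\<Union>m\<in>K x. {n. m \<in> K n}))" using K(1,2) by simp
    qed
    \<comment> \<open>Independence puts the partner \<open>q n\<close> of every
      \<open>n \<in> b\<close> outside \<open>b\<close>, so the images of \<open>b\<close> and
      \<open>- b\<close> would share infinitely many points.\<close>
    obtain b where b: "b \<subseteq> N1" "infinite b" "\<And>x y. \<lbrakk>x \<in> b; y \<in> b; x \<noteq> y\<rbrakk> \<Longrightarrow> \<not> R x y"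
      by (rule infinite_independent[OF inf _ fin]) (auto simp: R_def)
    have "\<forall>\<^sub>F m in cofinite. \<not> ((\<exists>n\<in>b. m \<in> K n) \<and> (\<exists>n\<in>- b. m \<in> K n))"
      using K(3)[of b] K(3)[of "- b"] F_Compl[of b] by eventually_elim blast
    then have "finite {m. (\<exists>n\<in>b. m \<in> K n) \<and> (\<exists>n\<in>- b. m \<in> K n)}" by (simp add: eventually_cofinite)
    moreover have "b \<subseteq> (\<Union>m\<in>{m. (\<exists>n\<in>b. m \<in> K n) \<and> (\<exists>n\<in>- b. m \<in> K n)}. {n. m \<in> K n})"
    proof
      fix n assume n: "n \<in> b"
      then obtain m where m: "m \<in> K n" "m \<in> K (q n)" using q b(1) by blast
      have "q n \<noteq> n" using q n b(1) by blast
      then have "q n \<in> - b" using b(3)[OF n, of "q n"] by (auto simp: R_def)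
      with n m have "m \<in> {m. (\<exists>n\<in>b. m \<in> K n) \<and> (\<exists>n\<in>- b. m \<in> K n)}" by blast
      then show "n \<in> (\<Union>m\<in>{m. (\<exists>n\<in>b. m \<in> K n) \<and> (\<exists>n\<in>- b. m \<in> K n)}. {n. m \<in> K n})"
        by (rule UN_I) (simp add: m)
    qed
    ultimately show False using b(2) K(2) by (meson finite_UN finite_subset)
  qed
  define N2 where "N2 = {n. n \<notin> N1 \<and> (\<exists>m m'. m \<in> K n \<and> m' \<in> K n \<and> m \<noteq> m')}"
  have disj: "n' = n" if "n \<notin> N1" "m \<in> K n" "m \<in> K n'" for n n' m
    using that unfolding N1_def by blast
  have "finite N2"
  proof (rule ccontr)
    assume inf: "infinite N2"
    have "\<forall>n\<in>N2. \<exists>m. fst m \<in> K n \<and> snd m \<in> K n \<and> fst m \<noteq> snd m" unfolding N2_def by auto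
    from bchoice[OF this] obtain u where u: "\<And>n. n \<in> N2 \<Longrightarrow> fst (u n) \<in> K n \<and> snd (u n) \<in> K n \<and> fst (u n) \<noteq> snd (u n)"
      by blast
    \<comment> \<open>Takes one point from each of infinitely many values with two points; no union
      of values equals such a set modulo finite.\<close>
    define M where "M = (\<lambda>n. fst (u n)) ` N2"
    obtain c where c: "\<forall>\<^sub>F m in cofinite. m \<in> F c \<longleftrightarrow> m \<in> M" using F_surj by blast
    have "\<forall>\<^sub>F m in cofinite. (\<exists>n\<in>c. m \<in> K n) \<longleftrightarrow> m \<in> M" using c K(3)[of c] by eventually_elim blast
    then have "finite {m. \<not> ((\<exists>n\<in>c. m \<in> K n) \<longleftrightarrow> m \<in> M)}" by (simp add: eventually_cofinite)
    moreover have "N2 \<subseteq> (\<Union>m\<in>{m. \<not> ((\<exists>n\<in>c. m \<in> K n) \<longleftrightarrow> m \<in> M)}. {n. m \<in> K n})"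
    proof
      fix n assume n: "n \<in> N2"
      then have n1: "n \<notin> N1" by (simp add: N2_def)
      have "\<exists>m\<in>K n. \<not> ((\<exists>n\<in>c. m \<in> K n) \<longleftrightarrow> m \<in> M)"
      proof (cases "n \<in> c")
        case True
        have "snd (u n) \<notin> M"
        proof
          assume "snd (u n) \<in> M"
          then obtain n' where n': "n' \<in> N2" "snd (u n) = fst (u n')" by (auto simp: M_def)
          then have "n' = n" using disj[OF n1, of "snd (u n)" n'] u[OF n] u[OF n'(1)] by simp
          then show False using u[OF n] n'(2) by simp
        qed
        then show ?thesis using u[OF n] True by blast
      next
        case False
        have "fst (u n) \<notin> K n'" if "n' \<in> c" for n' using disj[OF n1, of "fst (u n)" n'] u[OF n] that False by blast
        moreover have "fst (u n) \<in> M" using n by (simp add: M_def)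
        ultimately show ?thesis using u[OF n] by blast
      qed
      then show "n \<in> (\<Union>m\<in>{m. \<not> ((\<exists>n\<in>c. m \<in> K n) \<longleftrightarrow> m \<in> M)}. {n. m \<in> K n})" by blast
    qed
    ultimately show False using inf K(2) by (meson finite_UN finite_subset)
  qed
  define F1 where "F1 = N0 \<union> N1 \<union> N2"
  define g where "g n = (SOME m. m \<in> K n)" for n
  have g: "K n = {g n}" if "n \<notin> F1" for n
  proof -
    have "\<exists>m. m \<in> K n" using that by (auto simp: F1_def N0_def)
    then have "g n \<in> K n" unfolding g_def by (rule someI_ex)
    then show ?thesis using that by (auto simp: F1_def N2_def)
  qed
  have fin1: "finite F1" using \<open>finite N0\<close> \<open>finite N1\<close> \<open>finite N2\<close> by (simp add: F1_def)
  have inj: "inj_on g (- F1)"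
  proof (rule inj_onI)
    fix x y assume "x \<in> - F1" "y \<in> - F1" "g x = g y"
    moreover from this have "y \<notin> N1" by (simp add: F1_def)
    ultimately show "x = y" using disj[of y "g y" x] g[of x] g[of y] by simp
  qed
  have fK: "finite (\<Union>n\<in>F1. K n)" using fin1 K(1) by simp
  have main: "\<forall>\<^sub>F m in cofinite. m \<in> F b \<longleftrightarrow> m \<in> g ` (b - F1)" for b
    using K(3)[of b] eventually_cofinite_not_in[OF fK]
  proof eventually_elim
    case (elim m)
    then show ?case using g by auto
  qed
  have "\<forall>\<^sub>F m in cofinite. m \<notin> - g ` (- F1)"
  proof -
    have "finite (F {})" by (simp add: F_finite)
    from eventually_cofinite_not_in[OF this] F_Compl[of "{}"] main[of UNIV] show ?thesis
      by eventually_elim (auto simp: Compl_eq_Diff_UNIV)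
  qed
  then have "finite (- g ` (- F1))" unfolding eventually_cofinite by (simp add: Compl_eq)
  moreover have "bij_betw g (- F1) (- (- g ` (- F1)))" using inj by (simp add: bij_betw_def)
  ultimately show thesis using that[OF fin1] main by blast
qed

end

subsection \<open>Idempotents in a C*-algebra\<close>

context unital_cstar_algebra
begin

text \<open>Newton's step for the equation \<open>p \<otimes> p = p\<close> divides by
  \<open>2p - 1\<close>. The square of that element is \<open>1 + 4e\<close>, so it nearly inverts
  itself and multiplication can replace division. The new defect, \<open>e\<close> squared times
  \<open>4e - 3\<close>, is quadratic in the old one.\<close>

lemma newton_identity:
  assumes p: "p \<in> carrier A"
  defines "e \<equiv> p \<otimes> p \<ominus> p"
  defines "q \<equiv> p \<ominus> (p \<oplus> p \<ominus> \<one>) \<otimes> e"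
  shows "q \<otimes> q \<ominus> q = (e \<otimes> e) \<otimes> (e \<oplus> e \<oplus> e \<oplus> e \<ominus> (\<one> \<oplus> \<one> \<oplus> \<one>))"
proof -
  define c where "c = p \<oplus> p \<ominus> \<one>"
  have e: "e \<in> carrier A" and c: "c \<in> carrier A" using p by (simp_all add: e_def c_def)
  define w where "w = c \<otimes> e"
  have w: "w \<in> carrier A" using c e by (simp add: w_def)
  have cc: "c \<otimes> c = e \<oplus> e \<oplus> e \<oplus> e \<oplus> \<one>" using p unfolding c_def e_def by (simp add: ring_simprules)
  have ce: "e \<otimes> c = c \<otimes> e" using p unfolding c_def e_def by (simp add: ring_simprules)
  have qw: "q = p \<ominus> w" by (simp add: q_def w_def c_def)
  have 1: "q \<otimes> q \<ominus> q = e \<ominus> (p \<otimes> w \<oplus> w \<otimes> p \<ominus> w) \<oplus> w \<otimes> w"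
    unfolding qw e_def using p w by (simp add: ring_simprules)
  have 2: "w \<otimes> w = (c \<otimes> c) \<otimes> (e \<otimes> e)"
  proof -
    have "w \<otimes> w = c \<otimes> ((e \<otimes> c) \<otimes> e)" using c e by (simp add: w_def m_assoc)
    also have "\<dots> = (c \<otimes> c) \<otimes> (e \<otimes> e)" unfolding ce using c e by (simp add: m_assoc)
    finally show ?thesis .
  qed
  have 3: "p \<otimes> w \<oplus> w \<otimes> p \<ominus> w = (c \<otimes> c) \<otimes> e"
  proof -
    have pc: "p \<otimes> c = c \<otimes> p" using p unfolding c_def by (simp add: ring_simprules)
    have pe: "e \<otimes> p = p \<otimes> e" using p unfolding e_def by (simp add: ring_simprules)
    have "p \<otimes> w = c \<otimes> (p \<otimes> e)" using p c e pc by (simp add: w_def flip: m_assoc)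
    moreover have "w \<otimes> p = c \<otimes> (p \<otimes> e)" using p c e pe by (simp add: w_def m_assoc)
    moreover have "c \<otimes> (p \<otimes> e) \<oplus> c \<otimes> (p \<otimes> e) \<ominus> c \<otimes> e = c \<otimes> ((p \<oplus> p \<ominus> \<one>) \<otimes> e)"
      using p c e by (simp add: ring_simprules)
    ultimately show ?thesis using c e by (simp add: w_def m_assoc flip: c_def)
  qed
  show ?thesis unfolding 1 2 3 cc using e by (simp add: ring_simprules)
qed

lemma minus_eq_zero_iff:
  assumes "x \<in> carrier A" "y \<in> carrier A"
  shows "x \<ominus> y = \<zero> \<longleftrightarrow> x = y"
  using assms by (metis a_minus_def a_inv_closed minus_equality minus_minus r_neg)

lemma minus_self: "x \<in> carrier A \<Longrightarrow> x \<ominus> x = \<zero>"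
  by (simp add: minus_eq_zero_iff)

lemma add_cancel:
  assumes "x \<in> carrier A" "y \<in> carrier A" "z \<in> carrier A"
  shows "x \<oplus> (y \<oplus> \<ominus> x) = y" "x \<oplus> (y \<oplus> (z \<oplus> \<ominus> x)) = y \<oplus> z"
proof -
  show "x \<oplus> (y \<oplus> \<ominus> x) = y" using assms by (simp add: a_lcomm[of x y] r_neg)
  then show "x \<oplus> (y \<oplus> (z \<oplus> \<ominus> x)) = y \<oplus> z" using assms by (simp add: a_lcomm[of x y] a_lcomm[of x z] r_neg)
qed

lemma minus_eq_smult:
  assumes "x \<in> carrier A"
  shows "\<ominus> x = (- 1) \<odot> x"
proof -
  have "(- 1) \<odot> x \<oplus> 1 \<odot> x = (- 1 + 1) \<odot> x"
    using scalar.smult_l_distr[of "- 1" 1 x] assms by (simp add: complex_ring_def)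
  also have "\<dots> = \<zero>" using scalar.smult_l_null[OF assms] by (simp add: complex_ring_def)
  finally have "(- 1) \<odot> x \<oplus> x = \<zero>" using scalar.smult_one[OF assms] by (simp add: complex_ring_def)
  moreover have "(- 1) \<odot> x \<in> carrier A" using scalar.smult_closed[of "- 1" x] assms by (simp add: complex_ring_def)
  ultimately show ?thesis using assms by (metis minus_equality)
qed

lemma smult_closed': "x \<in> carrier A \<Longrightarrow> c \<odot> x \<in> carrier A"
  using scalar.smult_closed[of c x] by (simp add: complex_ring_def)

lemma nrm_zero: "nrm A \<zero> = 0"
  by (simp add: nrm_eq_zero)

lemma nrm_uminus: "x \<in> carrier A \<Longrightarrow> nrm A (\<ominus> x) = nrm A x"
  by (simp add: minus_eq_smult nrm_smult)

lemma nrm_minus_le: "x \<in> carrier A \<Longrightarrow> y \<in> carrier A \<Longrightarrow> nrm A (x \<ominus> y) \<le> nrm A x + nrm A y"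
  using nrm_triangle[of x "\<ominus> y"] by (simp add: a_minus_def nrm_uminus)

lemma nrm_minus_commute: "x \<in> carrier A \<Longrightarrow> y \<in> carrier A \<Longrightarrow> nrm A (x \<ominus> y) = nrm A (y \<ominus> x)"
  using nrm_uminus[of "y \<ominus> x"] by (simp add: a_minus_def minus_add a_comm)

lemma nrm_minus_triangle:
  assumes "x \<in> carrier A" "y \<in> carrier A" "z \<in> carrier A"
  shows "nrm A (x \<ominus> z) \<le> nrm A (x \<ominus> y) + nrm A (y \<ominus> z)"
proof -
  have "x \<ominus> z = (x \<ominus> y) \<oplus> (y \<ominus> z)" using assms by (simp add: ring_simprules)
  then show ?thesis using nrm_triangle[of "x \<ominus> y" "y \<ominus> z"] assms by simp
qed

lemma nrm_le_diff: "x \<in> carrier A \<Longrightarrow> y \<in> carrier A \<Longrightarrow> nrm A x \<le> nrm A (x \<ominus> y) + nrm A y"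
  using nrm_minus_triangle[of x y \<zero>] by (simp add: a_minus_def)

lemma adj_one: "adj A \<one> = \<one>"
proof -
  have c: "adj A \<one> \<in> carrier A" by (simp add: adj_closed)
  have "adj A (adj A \<one> \<otimes> \<one>) = adj A \<one> \<otimes> adj A (adj A \<one>)" using c by (intro adj_mult one_closed)
  then show ?thesis using c adj_adj[OF one_closed] r_one[OF c] by simp
qed

lemma nrm_one: "nrm A \<one> = 1"
proof -
  have "nrm A \<one> = (nrm A \<one>)\<^sup>2" using cstar_identity[of \<one>] by (simp add: adj_one)
  moreover have "nrm A \<one> \<noteq> 0" using one_not_zero by (simp add: nrm_eq_zero)
  ultimately show ?thesis by (simp add: power2_eq_square)
qed

lemma metric_space_cstar: "Metric_space (carrier A) (cstar_dist A)"
proof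
  show "0 \<le> cstar_dist A x y" for x y by (simp add: cstar_dist_def nrm_nonneg)
  show "cstar_dist A x y = cstar_dist A y x" for x y by (simp add: cstar_dist_def nrm_minus_commute)
  show "cstar_dist A x y = 0 \<longleftrightarrow> x = y" if "x \<in> carrier A" "y \<in> carrier A" for x y
    using that by (simp add: cstar_dist_def nrm_eq_zero minus_eq_zero_iff)
  show "cstar_dist A x z \<le> cstar_dist A x y + cstar_dist A y z"
    if "x \<in> carrier A" "y \<in> carrier A" "z \<in> carrier A" for x y z
    using that by (simp add: cstar_dist_def nrm_minus_triangle)
qed

text \<open>Newton iteration for the equation \<open>p\<^sup>2 = p\<close>.\<close>

lemma idempotent_near:
  assumes q: "q \<in> carrier A" "nrm A q \<le> K" and \<delta>: "nrm A (q \<otimes> q \<ominus> q) \<le> \<delta>" "\<delta> \<le> 1 / 14" "2 * (2 * K + 3) * \<delta> \<le> 1"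
  obtains p where "p \<in> carrier A" "p \<otimes> p = p" "nrm A (p \<ominus> q) \<le> 2 * (2 * K + 3) * \<delta>"
proof -
  define P where "P = rec_nat q (\<lambda>_ p. p \<ominus> (p \<oplus> p \<ominus> \<one>) \<otimes> (p \<otimes> p \<ominus> p))"
  define e where "e k = P k \<otimes> P k \<ominus> P k" for k
  have P0: "P 0 = q" and PS: "\<And>k. P (Suc k) = P k \<ominus> (P k \<oplus> P k \<ominus> \<one>) \<otimes> e k"
    by (simp_all add: P_def e_def)
  have Pc: "P k \<in> carrier A" for k by (induction k) (simp_all add: P0 PS e_def q(1))
  have ec: "e k \<in> carrier A" for k using Pc by (simp add: e_def)
  have K0: "0 \<le> K" using q nrm_nonneg[of q] by linarith
  have d0: "0 \<le> \<delta>" using \<delta>(1) nrm_nonneg[of "q \<otimes> q \<ominus> q"] q(1) by (meson a_minus_def a_inv_closed a_closed m_closed minus_closed order_trans)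
  have enorm: "nrm A (e k) \<le> \<delta> / 2 ^ k" for k
  proof (induction k)
    case 0
    then show ?case using \<delta>(1) by (simp add: e_def P0)
  next
    case (Suc k)
    have eS: "e (Suc k) = (e k \<otimes> e k) \<otimes> (e k \<oplus> e k \<oplus> e k \<oplus> e k \<ominus> (\<one> \<oplus> \<one> \<oplus> \<one>))"
      using newton_identity[OF Pc[of k]] unfolding PS e_def .
    have "\<delta> / 2 ^ k \<le> \<delta>" using d0 by (simp add: divide_le_eq mult_left_le mult_le_cancel_left1)
    \<comment> \<open>The factor \<open>4e - 3\<close> has norm at most 7, so a defect of at most
      \<open>1 / 14\<close> is at least halved by each step.\<close>
    then have e1: "nrm A (e k) \<le> 1 / 14" using Suc \<delta>(2) by linarith
    have "nrm A (e k \<oplus> e k \<oplus> e k \<oplus> e k \<ominus> (\<one> \<oplus> \<one> \<oplus> \<one>)) \<le> nrm A (e k \<oplus> e k \<oplus> e k \<oplus> e k) + nrm A (\<one> \<oplus> \<one> \<oplus> \<one>)"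
      using ec by (intro nrm_minus_le) auto
    also have "\<dots> \<le> (nrm A (e k) + nrm A (e k) + nrm A (e k) + nrm A (e k)) + (nrm A \<one> + nrm A \<one> + nrm A \<one>)"
      using ec by (intro add_mono order_trans[OF nrm_triangle] order_refl) auto
    also have "\<dots> \<le> 7" using e1 by (simp add: nrm_one)
    finally have f: "nrm A (e k \<oplus> e k \<oplus> e k \<oplus> e k \<ominus> (\<one> \<oplus> \<one> \<oplus> \<one>)) \<le> 7" .
    have "nrm A (e (Suc k)) \<le> nrm A (e k \<otimes> e k) * nrm A (e k \<oplus> e k \<oplus> e k \<oplus> e k \<ominus> (\<one> \<oplus> \<one> \<oplus> \<one>))"
      unfolding eS using ec by (intro nrm_mult) auto
    also have "\<dots> \<le> (nrm A (e k) * nrm A (e k)) * 7"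
      using ec f by (intro mult_mono nrm_mult) (auto simp: nrm_nonneg)
    also have "\<dots> \<le> (nrm A (e k) * (1 / 14)) * 7"
      using e1 nrm_nonneg[OF ec] by (intro mult_right_mono mult_left_mono) auto
    also have "\<dots> \<le> \<delta> / 2 ^ Suc k" using Suc by simp
    finally show ?case .
  qed
  \<comment> \<open>The iterates stay within distance 1 of \<open>q\<close>, so \<open>c\<close>
    bounds the norm of \<open>2 P k - 1\<close>; steps of length at most
    \<open>c * \<delta> / 2 ^ k\<close> add up to at most \<open>2 * c * \<delta>\<close>.\<close>
  define c where "c = 2 * K + 3"
  have c: "c > 0" "2 * c * \<delta> \<le> 1" using K0 \<delta>(3) by (auto simp: c_def)
  have cd: "0 \<le> 2 * c * \<delta>" using c(1) d0 by simp
  have dist: "nrm A (P k \<ominus> q) \<le> 2 * c * \<delta> * (1 - 1 / 2 ^ k) \<and> nrm A (P (Suc k) \<ominus> P k) \<le> c * \<delta> / 2 ^ k" for k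
  proof -
    have step: "nrm A (P (Suc k) \<ominus> P k) \<le> c * \<delta> / 2 ^ k" if "nrm A (P k \<ominus> q) \<le> 2 * c * \<delta> * (1 - 1 / 2 ^ k)" for k
    proof -
      have "2 * c * \<delta> * (1 - 1 / 2 ^ k) \<le> 2 * c * \<delta> * 1" using cd by (rule mult_left_mono[rotated]) auto
      then have "nrm A (P k) \<le> 1 + K" using that c(2) nrm_le_diff[OF Pc q(1), of k] q(2) by linarith
      moreover have "nrm A (P k \<oplus> P k \<ominus> \<one>) \<le> (nrm A (P k) + nrm A (P k)) + nrm A \<one>"
        using Pc by (intro order_trans[OF nrm_minus_le] add_mono nrm_triangle order_refl) auto
      ultimately have f: "nrm A (P k \<oplus> P k \<ominus> \<one>) \<le> c" by (simp add: nrm_one c_def)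
      have "P (Suc k) \<ominus> P k = \<ominus> ((P k \<oplus> P k \<ominus> \<one>) \<otimes> e k)"
      proof -
        define w where "w = (P k \<oplus> P k \<ominus> \<one>) \<otimes> e k"
        have "w \<in> carrier A" using Pc ec by (simp add: w_def)
        then have "P k \<ominus> w \<ominus> P k = \<ominus> w" using Pc[of k] by (simp add: a_minus_def a_assoc a_comm[of "\<ominus> w"] r_neg2)
        then show ?thesis by (simp add: PS w_def)
      qed
      then have "nrm A (P (Suc k) \<ominus> P k) = nrm A ((P k \<oplus> P k \<ominus> \<one>) \<otimes> e k)" using Pc ec by (simp add: nrm_uminus)
      also have "\<dots> \<le> nrm A (P k \<oplus> P k \<ominus> \<one>) * nrm A (e k)" using Pc ec by (intro nrm_mult) auto
      also have "\<dots> \<le> c * (\<delta> / 2 ^ k)" using f enorm c(1) nrm_nonneg[OF ec] by (intro mult_mono) auto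
      finally show ?thesis by simp
    qed
    have "nrm A (P k \<ominus> q) \<le> 2 * c * \<delta> * (1 - 1 / 2 ^ k)" for k
    proof (induction k)
      case 0
      then show ?case using q(1) by (simp add: P0 nrm_zero minus_self)
    next
      case (Suc k)
      have "nrm A (P (Suc k) \<ominus> q) \<le> nrm A (P (Suc k) \<ominus> P k) + nrm A (P k \<ominus> q)"
        using Pc q(1) by (intro nrm_minus_triangle)
      also have "\<dots> \<le> c * \<delta> / 2 ^ k + 2 * c * \<delta> * (1 - 1 / 2 ^ k)" using step[OF Suc] Suc by linarith
      also have "\<dots> = 2 * c * \<delta> * (1 - 1 / 2 ^ Suc k)" by (simp add: field_simps)
      finally show ?case .
    qed
    then show ?thesis using step by blast
  qed
  have tail: "nrm A (P (k + j) \<ominus> P k) \<le> 2 * c * \<delta> / 2 ^ k * (1 - 1 / 2 ^ j)" for k j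
  proof (induction j)
    case 0
    then show ?case using Pc[of k] by (simp add: nrm_zero minus_self)
  next
    case (Suc j)
    have "nrm A (P (k + Suc j) \<ominus> P k) \<le> nrm A (P (Suc (k + j)) \<ominus> P (k + j)) + nrm A (P (k + j) \<ominus> P k)"
      using nrm_minus_triangle[OF Pc Pc Pc, of "k + Suc j" k "k + j"] by simp
    also have "\<dots> \<le> c * \<delta> / 2 ^ (k + j) + 2 * c * \<delta> / 2 ^ k * (1 - 1 / 2 ^ j)" using Suc dist[of "k + j"] by linarith
    also have "\<dots> = 2 * c * \<delta> / 2 ^ k * (1 - 1 / 2 ^ Suc j)" by (simp add: field_simps power_add)
    finally show ?case .
  qed
  interpret M: Metric_space "carrier A" "cstar_dist A" by (rule metric_space_cstar)
  have tail': "nrm A (P l \<ominus> P k) \<le> 2 * c * \<delta> / 2 ^ k" if "k \<le> l" for k l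
  proof -
    have "2 * c * \<delta> / 2 ^ k * (1 - 1 / 2 ^ (l - k)) \<le> 2 * c * \<delta> / 2 ^ k * 1"
      using divide_nonneg_nonneg[OF cd, of "2 ^ k"] by (rule mult_left_mono[rotated]) auto
    then show ?thesis using tail[of k "l - k"] that by simp
  qed
  have small: "\<exists>k. \<forall>l\<ge>k. 2 * c * \<delta> / 2 ^ l < \<epsilon>" if "\<epsilon> > 0" for \<epsilon> :: real
  proof -
    have "(\<lambda>l. 2 * c * \<delta> / 2 ^ l) \<longlonglongrightarrow> 0" by (rule LIMSEQ_divide_realpow_zero) simp
    then have "eventually (\<lambda>l. 2 * c * \<delta> / 2 ^ l < \<epsilon>) sequentially" using that by (rule order_tendstoD)
    then show ?thesis by (simp add: eventually_sequentially)
  qed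
  have "M.MCauchy P"
    unfolding M.MCauchy_def
  proof (intro conjI allI impI)
    show "range P \<subseteq> carrier A" using Pc by blast
    fix \<epsilon> :: real assume "\<epsilon> > 0"
    then obtain k where k: "\<forall>l\<ge>k. 2 * c * \<delta> / 2 ^ l < \<epsilon>" using small by blast
    have "cstar_dist A (P n) (P n') < \<epsilon>" if "k \<le> n" "k \<le> n'" for n n'
    proof (cases "n \<le> n'")
      case True
      then have "nrm A (P n' \<ominus> P n) < \<epsilon>" using tail'[OF True] k that(1) by fastforce
      then show ?thesis using Pc nrm_minus_commute by (simp add: cstar_dist_def)
    next
      case False
      then have "nrm A (P n \<ominus> P n') < \<epsilon>" using tail'[of n' n] k that(2) by fastforce
      then show ?thesis using Pc by (simp add: cstar_dist_def)
    qed
    then show "\<exists>N. \<forall>n n'. N \<le> n \<longrightarrow> N \<le> n' \<longrightarrow> cstar_dist A (P n) (P n') < \<epsilon>" by blast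
  qed
  then obtain p where p: "limitin M.mtopology P p sequentially"
    using complete unfolding M.mcomplete_def by blast
  then have pc: "p \<in> carrier A" and lim: "\<And>\<epsilon>. \<epsilon> > 0 \<Longrightarrow> \<exists>N. \<forall>n\<ge>N. nrm A (P n \<ominus> p) < \<epsilon>"
    unfolding M.limit_metric_sequentially using Pc by (auto simp: cstar_dist_def)
  have "nrm A (p \<ominus> q) \<le> 2 * c * \<delta>"
  proof (rule field_le_epsilon)
    fix \<epsilon> :: real assume "\<epsilon> > 0"
    then obtain n where n: "nrm A (P n \<ominus> p) < \<epsilon>" using lim by blast
    have "nrm A (p \<ominus> q) \<le> nrm A (p \<ominus> P n) + nrm A (P n \<ominus> q)" using pc Pc q(1) by (intro nrm_minus_triangle)
    moreover have "nrm A (P n \<ominus> q) \<le> 2 * c * \<delta>" using tail'[of 0 n] by (simp add: P0)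
    ultimately show "nrm A (p \<ominus> q) \<le> 2 * c * \<delta> + \<epsilon>" using n nrm_minus_commute[OF pc Pc, of n] by linarith
  qed
  moreover have "p \<otimes> p = p"
  proof -
    define B where "B = nrm A p + 1"
    have B: "B \<ge> 1" using nrm_nonneg[OF pc] by (simp add: B_def)
    have "nrm A (p \<otimes> p \<ominus> p) \<le> 0"
    proof (rule field_le_epsilon)
      fix \<epsilon> :: real assume \<epsilon>: "\<epsilon> > 0"
      \<comment> \<open>Chosen so that the errors \<open>B * \<eta>\<close>,
        \<open>\<eta> * B\<close> and \<open>\<eta>\<close> together take at most half of
        \<open>\<epsilon>\<close>.\<close>
      define \<eta> where "\<eta> = min 1 (\<epsilon> / (2 * (2 * B + 1)))"
      have \<eta>: "\<eta> > 0" "\<eta> \<le> 1" using \<epsilon> B by (auto simp: \<eta>_def)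
      have "\<eta> \<le> \<epsilon> / (2 * (2 * B + 1))" by (simp add: \<eta>_def)
      then have \<eta>2: "\<eta> * (2 * B + 1) \<le> \<epsilon> / 2" using B by (simp add: field_simps)
      obtain N where N: "\<forall>n\<ge>N. nrm A (P n \<ominus> p) < \<eta>" using lim \<eta>(1) by blast
      obtain N' where N': "\<forall>l\<ge>N'. 2 * c * \<delta> / 2 ^ l < \<epsilon>" using small \<epsilon> by blast
      obtain N'' where N'': "\<forall>l\<ge>N''. \<delta> / 2 ^ l < \<epsilon> / 2"
      proof -
        have "(\<lambda>l. \<delta> / 2 ^ l) \<longlonglongrightarrow> 0" by (rule LIMSEQ_divide_realpow_zero) simp
        then have "\<forall>\<^sub>F l in sequentially. \<delta> / 2 ^ l < \<epsilon> / 2" using \<epsilon> by (intro order_tendstoD) auto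
        then show ?thesis using that unfolding eventually_sequentially by blast
      qed
      define n where "n = max N N''"
      have n: "nrm A (P n \<ominus> p) < \<eta>" "nrm A (e n) < \<epsilon> / 2"
        using N N'' enorm[of n] le_less_trans[OF enorm, of n "\<epsilon> / 2"] by (auto simp: n_def)
      have n': "nrm A (p \<ominus> P n) < \<eta>" using n(1) nrm_minus_commute[OF pc Pc] by simp
      have Pn: "nrm A (P n) \<le> B" using nrm_le_diff[OF Pc pc, of n] n(1) \<eta>(2) by (simp add: B_def)
      have "p \<otimes> p \<ominus> p = p \<otimes> (p \<ominus> P n) \<oplus> (p \<ominus> P n) \<otimes> P n \<oplus> e n \<oplus> (P n \<ominus> p)"
        unfolding e_def using pc Pc[of n] by (simp add: ring_simprules add_cancel)
      then have "nrm A (p \<otimes> p \<ominus> p) \<le> nrm A (p \<otimes> (p \<ominus> P n)) + nrm A ((p \<ominus> P n) \<otimes> P n) + nrm A (e n) + nrm A (P n \<ominus> p)"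
        using pc Pc[of n] ec[of n] by (auto intro!: order_trans[OF nrm_triangle])
      also have "\<dots> \<le> B * \<eta> + \<eta> * B + \<epsilon> / 2 + \<eta>"
      proof (intro add_mono)
        show "nrm A (p \<otimes> (p \<ominus> P n)) \<le> B * \<eta>"
          using pc Pc[of n] n' B by (intro order_trans[OF nrm_mult] mult_mono) (auto simp: B_def nrm_nonneg)
        show "nrm A ((p \<ominus> P n) \<otimes> P n) \<le> \<eta> * B"
          using pc Pc[of n] n' B Pn \<eta>(1) by (intro order_trans[OF nrm_mult] mult_mono) (auto simp: nrm_nonneg)
      qed (use n in auto)
      also have "\<dots> \<le> 0 + \<epsilon>" using \<eta>2 by (simp add: algebra_simps)
      finally show "nrm A (p \<otimes> p \<ominus> p) \<le> 0 + \<epsilon>" .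
    qed
    then have "p \<otimes> p \<ominus> p = \<zero>" using nrm_eq_zero[of "p \<otimes> p \<ominus> p"] nrm_nonneg[of "p \<otimes> p \<ominus> p"] pc by simp
    then show ?thesis using pc by (simp add: minus_eq_zero_iff)
  qed
  ultimately show thesis using that pc by (simp add: c_def)
qed

text \<open>With \<open>s = adj A p\<close>, centrality makes the product of \<open>adj A x\<close>
  and \<open>x = p \<ominus> s \<otimes> p\<close> collapse to zero. The C*-identity then gives
  \<open>p = s \<otimes> p\<close>, which is self-adjoint.\<close>

lemma central_idempotent_is_projection:
  assumes p: "p \<in> carrier A" "p \<otimes> p = p" and central: "\<And>a. a \<in> carrier A \<Longrightarrow> p \<otimes> a = a \<otimes> p"
  shows "central_projection A p"
proof -
  define s where "s = adj A p"
  have s: "s \<in> carrier A" "s \<otimes> s = s" "p \<otimes> s = s \<otimes> p"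
    unfolding s_def by (rule adj_closed[OF p(1)], simp only: adj_mult[OF p(1,1), symmetric] p(2),
      rule central[OF adj_closed[OF p(1)]])
  define x where "x = p \<ominus> s \<otimes> p"
  have x: "x \<in> carrier A" using p s by (simp add: x_def)
  have "adj A (\<one> \<ominus> s) = \<one> \<ominus> p"
  proof -
    have "adj A (\<one> \<ominus> s) = adj A \<one> \<oplus> adj A ((- 1) \<odot> s)"
      unfolding a_minus_def minus_eq_smult[OF s(1)] using s(1) by (intro adj_add one_closed smult_closed')
    also have "\<dots> = \<one> \<ominus> p" unfolding adj_smult[OF s(1)] a_minus_def minus_eq_smult[OF p(1)] adj_one unfolding s_def adj_adj[OF p(1)] by simp
    finally show ?thesis .
  qed
  moreover have "x = (\<one> \<ominus> s) \<otimes> p" using p(1) s(1) by (simp add: x_def ring_simprules)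
  ultimately have "adj A x = s \<otimes> (\<one> \<ominus> p)" using p(1) s(1) by (simp add: adj_mult s_def)
  also have "\<dots> = (\<one> \<ominus> p) \<otimes> s" using p(1) s by (simp add: ring_simprules)
  finally have "adj A x \<otimes> x = ((\<one> \<ominus> p) \<otimes> s) \<otimes> (p \<otimes> (\<one> \<ominus> s))"
    using \<open>x = (\<one> \<ominus> s) \<otimes> p\<close> central[of "\<one> \<ominus> s"] s(1) by simp
  also have "\<dots> = (\<one> \<ominus> p) \<otimes> ((s \<otimes> p) \<otimes> (\<one> \<ominus> s))" using p(1) s(1) by (simp add: m_assoc)
  also have "\<dots> = ((\<one> \<ominus> p) \<otimes> p) \<otimes> (s \<otimes> (\<one> \<ominus> s))" unfolding s(3)[symmetric] using p(1) s(1) by (simp add: m_assoc)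
  also have "(\<one> \<ominus> p) \<otimes> p = \<zero>" using p by (simp add: ring_simprules)
  finally have "adj A x \<otimes> x = \<zero>" using p(1) s(1) by simp
  then have "x = \<zero>" using cstar_identity[OF x] nrm_eq_zero[OF x] by (simp add: nrm_zero)
  then have eq: "p = s \<otimes> p" using p s minus_eq_zero_iff[of p "s \<otimes> p"] by (simp add: x_def)
  have "s = adj A (s \<otimes> p)" using eq s_def by (rule subst)
  also have "\<dots> = s \<otimes> p" unfolding adj_mult[OF s(1) p(1)] unfolding s_def adj_adj[OF p(1)] by (rule refl)
  finally have "adj A p = p" using eq unfolding s_def by (rule trans[OF _ sym])
  then show ?thesis unfolding central_projection_def using p central by blast
qed

text \<open>Near \<open>q\<close> there is an idempotent \<open>p\<close> whose commutators have
  relative size below 1, and such an idempotent is exactly central: the corner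
  \<open>x = pa - pap\<close> satisfies \<open>px = x\<close> and \<open>xp = 0\<close>, so it
  equals its own commutator with \<open>p\<close> and vanishes; likewise, up to sign, for
  \<open>ap - pap\<close>.\<close>

lemma near_central_idempotent:
  assumes np: "no_nontrivial_central_projections A" and q: "q \<in> carrier A" "nrm A q \<le> K"
    and \<delta>: "nrm A (q \<otimes> q \<ominus> q) \<le> \<delta>" "\<delta> \<le> 1 / 14" "5 * (2 * K + 3) * \<delta> < 1"
    and comm: "\<And>a. a \<in> carrier A \<Longrightarrow> nrm A (q \<otimes> a \<ominus> a \<otimes> q) \<le> \<delta> * nrm A a"
  shows "nrm A q \<le> 2 * (2 * K + 3) * \<delta> \<or> nrm A (q \<ominus> \<one>) \<le> 2 * (2 * K + 3) * \<delta>"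
proof -
  have K0: "0 \<le> K" using q nrm_nonneg[of q] by linarith
  have d0: "0 \<le> \<delta>" using \<delta>(1) nrm_nonneg[of "q \<otimes> q \<ominus> q"] q(1) by (meson minus_closed m_closed order_trans)
  define \<eta> where "\<eta> = 2 * (2 * K + 3) * \<delta>"
  \<comment> \<open>Replacing \<open>q\<close> by \<open>p\<close> costs \<open>2 * \<eta>\<close>
    in commutators, and \<open>\<delta> + 2 * \<eta>\<close> is at most
    \<open>5 * (2 * K + 3) * \<delta>\<close>.\<close>
  have \<eta>: "\<delta> + 2 * \<eta> < 1"  "\<eta> \<le> 1"
  proof -
    have "0 \<le> K * \<delta>" using K0 d0 by simp
    then show "\<eta> \<le> 1" using \<delta>(3) d0 unfolding \<eta>_def by (simp add: algebra_simps)
    show "\<delta> + 2 * \<eta> < 1" using \<delta>(3) d0 \<open>0 \<le> K * \<delta>\<close> unfolding \<eta>_def by (simp add: algebra_simps)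
  qed
  obtain p where p: "p \<in> carrier A" "p \<otimes> p = p" "nrm A (p \<ominus> q) \<le> \<eta>"
    using idempotent_near[OF q \<delta>(1,2)] \<eta>(2) unfolding \<eta>_def by blast
  define \<rho> where "\<rho> = \<delta> + 2 * \<eta>"
  have commp: "nrm A (p \<otimes> x \<ominus> x \<otimes> p) \<le> \<rho> * nrm A x" if x: "x \<in> carrier A" for x
  proof -
    have "p \<otimes> x \<ominus> x \<otimes> p = (q \<otimes> x \<ominus> x \<otimes> q) \<oplus> (p \<ominus> q) \<otimes> x \<ominus> x \<otimes> (p \<ominus> q)"
      using p(1) q(1) x by (simp add: ring_simprules add_cancel)
    then have "nrm A (p \<otimes> x \<ominus> x \<otimes> p) \<le> nrm A (q \<otimes> x \<ominus> x \<otimes> q) + nrm A ((p \<ominus> q) \<otimes> x) + nrm A (x \<otimes> (p \<ominus> q))"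
      using p(1) q(1) x by (auto intro!: order_trans[OF nrm_minus_le] nrm_triangle)
    also have "\<dots> \<le> \<delta> * nrm A x + \<eta> * nrm A x + nrm A x * \<eta>"
      using p q(1) x comm by (intro add_mono order_trans[OF nrm_mult] mult_mono) (auto simp: nrm_nonneg intro: order_trans[OF nrm_nonneg p(3)])
    finally show ?thesis by (simp add: \<rho>_def algebra_simps)
  qed
  have zero: "x = \<zero>" if x: "x \<in> carrier A" "nrm A (p \<otimes> x \<ominus> x \<otimes> p) = nrm A x" for x
  proof -
    have "nrm A x \<le> \<rho> * nrm A x" using commp[OF x(1)] x(2) by simp
    then have "(1 - \<rho>) * nrm A x \<le> 0" by (simp add: algebra_simps)
    moreover have "1 - \<rho> > 0" using \<eta>(1) by (simp add: \<rho>_def)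
    ultimately have "nrm A x \<le> 0" by (simp add: mult_le_0_iff)
    then show ?thesis using nrm_nonneg[OF x(1)] nrm_eq_zero[OF x(1)] by simp
  qed
  have "p \<otimes> a = a \<otimes> p" if a: "a \<in> carrier A" for a
  proof -
    define x where "x = p \<otimes> a \<ominus> p \<otimes> (a \<otimes> p)"
    define y where "y = a \<otimes> p \<ominus> p \<otimes> (a \<otimes> p)"
    have xy: "x \<in> carrier A" "y \<in> carrier A" using p a by (simp_all add: x_def y_def)
    have pp: "p \<otimes> (p \<otimes> b) = p \<otimes> b" if "b \<in> carrier A" for b using p that by (simp flip: m_assoc)
    have px: "p \<otimes> x = x" "x \<otimes> p = \<zero>" "p \<otimes> y = \<zero>" "y \<otimes> p = y"
      using p a pp by (simp_all add: x_def y_def ring_simprules)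
    have "x = \<zero>" using px xy by (intro zero) (simp_all add: a_minus_def)
    moreover have "y = \<zero>" using px xy by (intro zero) (simp_all add: a_minus_def nrm_uminus)
    ultimately show ?thesis
      using p(1) a minus_eq_zero_iff[of "p \<otimes> a" "p \<otimes> (a \<otimes> p)"] minus_eq_zero_iff[of "a \<otimes> p" "p \<otimes> (a \<otimes> p)"]
      by (simp add: x_def y_def)
  qed
  then have "central_projection A p" using p by (intro central_idempotent_is_projection)
  then have "p = \<zero> \<or> p = \<one>" using np by (simp add: no_nontrivial_central_projections_def)
  then show ?thesis
  proof
    assume "p = \<zero>"
    then show ?thesis using p(3) q(1) by (simp add: \<eta>_def a_minus_def nrm_uminus)
  next
    assume "p = \<one>"
    then show ?thesis using p(3) q(1) nrm_minus_commute[of q \<one>] by (simp add: \<eta>_def)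
  qed
qed

lemma separable_dense_sequence:
  assumes "separable_cstar A"
  obtains c :: "nat \<Rightarrow> 'a" where "\<And>d. c d \<in> carrier A"
    "\<And>a \<epsilon>. a \<in> carrier A \<Longrightarrow> \<epsilon> > 0 \<Longrightarrow> \<exists>d. nrm A (c d \<ominus> a) < \<epsilon>"
proof -
  interpret M: Metric_space "carrier A" "cstar_dist A" by (rule metric_space_cstar)
  obtain C where C: "countable C" "C \<subseteq> carrier A" "M.mtopology closure_of C = carrier A"
    using assms unfolding separable_cstar_def separable_space_def by auto
  have dense: "\<exists>y\<in>C. nrm A (y \<ominus> a) < \<epsilon>" if a: "a \<in> carrier A" and \<epsilon>: "\<epsilon> > 0" for a \<epsilon>
  proof -
    have "a \<in> M.mtopology closure_of C" using C(3) a by simp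
    then obtain y where "y \<in> C" "y \<in> M.mball a \<epsilon>" unfolding M.metric_closure_of using \<epsilon> by auto
    then show ?thesis using nrm_minus_commute[of a y] a C(2)
      by (auto simp: M.in_mball cstar_dist_def intro!: bexI[of _ y])
  qed
  then have "C \<noteq> {}" using zero_closed zero_less_one by blast
  show thesis
  proof (rule that[of "from_nat_into C"])
    show "from_nat_into C d \<in> carrier A" for d using from_nat_into[OF \<open>C \<noteq> {}\<close>] C(2) by blast
    fix a \<epsilon> assume "a \<in> carrier A" "(\<epsilon> :: real) > 0"
    then obtain y where "y \<in> C" "nrm A (y \<ominus> a) < \<epsilon>" using dense by blast
    then show "\<exists>d. nrm A (from_nat_into C d \<ominus> a) < \<epsilon>"
      using from_nat_into_surj[OF C(1)] by metis
  qed
qed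

end

subsection \<open>Reduced products\<close>

lemma tendsto_0_iff_eventually_zero:
  fixes f :: "nat \<Rightarrow> real"
  assumes "\<And>n. f n = 0 \<or> f n = 1"
  shows "f \<longlonglongrightarrow> 0 \<longleftrightarrow> (\<forall>\<^sub>F n in cofinite. f n = 0)"
proof
  assume "f \<longlonglongrightarrow> 0"
  then have "\<forall>\<^sub>F n in sequentially. f n < 1" by (rule order_tendstoD) simp
  then show "\<forall>\<^sub>F n in cofinite. f n = 0"
    unfolding cofinite_eq_sequentially by eventually_elim (use assms in force)
qed (auto simp: cofinite_eq_sequentially intro: tendsto_eventually)

locale cstar_family =
  fixes A :: "nat \<Rightarrow> 'a cstar"
  assumes algebra: "unital_cstar_algebra (A n)"
begin

sublocale coord: unital_cstar_algebra "A n" for n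
  by (rule algebra)

abbreviation bounded_seqs :: "(nat \<Rightarrow> 'a) set"
  where "bounded_seqs \<equiv> carrier (cstar_prod A)"

lemma bounded_seqs_iff:
  "x \<in> bounded_seqs \<longleftrightarrow> (\<forall>n. x n \<in> carrier (A n)) \<and> (\<exists>K. \<forall>n. nrm (A n) (x n) \<le> K)"
  by (simp add: cstar_prod_def)

lemma bounded_seqsI: "(\<And>n. x n \<in> carrier (A n)) \<Longrightarrow> (\<And>n. nrm (A n) (x n) \<le> K) \<Longrightarrow> x \<in> bounded_seqs"
  unfolding bounded_seqs_iff by blast

lemma bounded_seqs_coord: "x \<in> bounded_seqs \<Longrightarrow> x n \<in> carrier (A n)"
  by (simp add: bounded_seqs_iff)

lemma bounded_seqs_bound:
  assumes "x \<in> bounded_seqs"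
  obtains K where "K \<ge> 0" "\<And>n. nrm (A n) (x n) \<le> K"
  using assms coord.nrm_nonneg unfolding bounded_seqs_iff by (metis order_trans)

lemma add_bounded: "x \<in> bounded_seqs \<Longrightarrow> y \<in> bounded_seqs \<Longrightarrow> (\<lambda>n. x n \<oplus>\<^bsub>A n\<^esub> y n) \<in> bounded_seqs"
proof -
  assume x: "x \<in> bounded_seqs" and y: "y \<in> bounded_seqs"
  obtain K :: real where K: "\<And>n. nrm (A n) (x n) \<le> K" using bounded_seqs_bound[OF x] by metis
  obtain K' :: real where K': "\<And>n. nrm (A n) (y n) \<le> K'" using bounded_seqs_bound[OF y] by metis
  show ?thesis
    using x y add_mono[OF K K'] by (intro bounded_seqsI[where K = "K + K'"] order_trans[OF coord.nrm_triangle])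
      (auto simp: bounded_seqs_coord)
qed

lemma mult_bounded: "x \<in> bounded_seqs \<Longrightarrow> y \<in> bounded_seqs \<Longrightarrow> (\<lambda>n. x n \<otimes>\<^bsub>A n\<^esub> y n) \<in> bounded_seqs"
proof -
  assume x: "x \<in> bounded_seqs" and y: "y \<in> bounded_seqs"
  obtain K :: real where K: "K \<ge> 0" "\<And>n. nrm (A n) (x n) \<le> K" using bounded_seqs_bound[OF x] by metis
  obtain K' :: real where K': "\<And>n. nrm (A n) (y n) \<le> K'" using bounded_seqs_bound[OF y] by metis
  show ?thesis
    using x y K(1) mult_mono[OF K(2) K'] by (intro bounded_seqsI[where K = "K * K'"] order_trans[OF coord.nrm_mult])
      (auto simp: bounded_seqs_coord coord.nrm_nonneg)
qed

lemma uminus_bounded: "x \<in> bounded_seqs \<Longrightarrow> (\<lambda>n. \<ominus>\<^bsub>A n\<^esub> x n) \<in> bounded_seqs"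
  by (auto simp: bounded_seqs_iff coord.nrm_uminus)

lemma const_bounded: "(\<lambda>n. \<zero>\<^bsub>A n\<^esub>) \<in> bounded_seqs" "(\<lambda>n. \<one>\<^bsub>A n\<^esub>) \<in> bounded_seqs"
  by (auto intro!: bounded_seqsI[where K = 1] simp: coord.nrm_zero coord.nrm_one)

lemma minus_bounded: "x \<in> bounded_seqs \<Longrightarrow> y \<in> bounded_seqs \<Longrightarrow> (\<lambda>n. x n \<ominus>\<^bsub>A n\<^esub> y n) \<in> bounded_seqs"
  unfolding a_minus_def by (intro add_bounded uminus_bounded)

lemma cstar_prod_simps:
  "x \<otimes>\<^bsub>cstar_prod A\<^esub> y = (\<lambda>n. x n \<otimes>\<^bsub>A n\<^esub> y n)"
  "x \<oplus>\<^bsub>cstar_prod A\<^esub> y = (\<lambda>n. x n \<oplus>\<^bsub>A n\<^esub> y n)"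
  "\<one>\<^bsub>cstar_prod A\<^esub> = (\<lambda>n. \<one>\<^bsub>A n\<^esub>)"
  "\<zero>\<^bsub>cstar_prod A\<^esub> = (\<lambda>n. \<zero>\<^bsub>A n\<^esub>)"
  by (simp_all add: cstar_prod_def)

lemma ring_cstar_prod: "ring (cstar_prod A)"
proof (rule ringI)
  show "abelian_group (cstar_prod A)"
  proof (rule abelian_groupI)
    fix x assume x: "x \<in> bounded_seqs"
    show "\<exists>y\<in>bounded_seqs. y \<oplus>\<^bsub>cstar_prod A\<^esub> x = \<zero>\<^bsub>cstar_prod A\<^esub>"
      using x by (intro bexI[OF _ uminus_bounded[OF x]]) (simp add: cstar_prod_simps coord.l_neg bounded_seqs_coord)
  qed (auto simp: cstar_prod_simps add_bounded const_bounded bounded_seqs_coord coord.a_ac)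
  show "monoid (cstar_prod A)"
    by (rule monoidI) (auto simp: cstar_prod_simps mult_bounded const_bounded bounded_seqs_coord coord.m_assoc)
qed (auto simp: cstar_prod_simps bounded_seqs_coord coord.l_distr coord.r_distr)

sublocale prod: ring "cstar_prod A"
  by (rule ring_cstar_prod)

lemma uminus_cstar_prod: "x \<in> bounded_seqs \<Longrightarrow> \<ominus>\<^bsub>cstar_prod A\<^esub> x = (\<lambda>n. \<ominus>\<^bsub>A n\<^esub> x n)"
  by (rule prod.minus_equality) (auto simp: cstar_prod_simps uminus_bounded bounded_seqs_coord coord.l_neg)

lemma minus_cstar_prod:
  "x \<in> bounded_seqs \<Longrightarrow> y \<in> bounded_seqs \<Longrightarrow> x \<ominus>\<^bsub>cstar_prod A\<^esub> y = (\<lambda>n. x n \<ominus>\<^bsub>A n\<^esub> y n)"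
  by (simp add: a_minus_def uminus_cstar_prod cstar_prod_simps)

lemma ideal_cstar_sum: "ideal (cstar_sum A) (cstar_prod A)"
proof (rule idealI)
  have mult: "x \<otimes>\<^bsub>cstar_prod A\<^esub> y \<in> cstar_sum A \<and> y \<otimes>\<^bsub>cstar_prod A\<^esub> x \<in> cstar_sum A"
    if x: "x \<in> cstar_sum A" and y: "y \<in> bounded_seqs" for x y
  proof -
    have xc: "x \<in> bounded_seqs" and lim: "(\<lambda>n. nrm (A n) (x n)) \<longlonglongrightarrow> 0" using x by (auto simp: cstar_sum_def)
    obtain K :: real where K: "K \<ge> 0" "\<And>n. nrm (A n) (y n) \<le> K" using bounded_seqs_bound[OF y] by metis
    have lim': "(\<lambda>n. K * nrm (A n) (x n)) \<longlonglongrightarrow> 0" using tendsto_mult_right_zero[OF lim] .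
    have "nrm (A n) (x n \<otimes>\<^bsub>A n\<^esub> y n) \<le> K * nrm (A n) (x n)" "nrm (A n) (y n \<otimes>\<^bsub>A n\<^esub> x n) \<le> K * nrm (A n) (x n)" for n
    proof -
      have c: "x n \<in> carrier (A n)" "y n \<in> carrier (A n)" using xc y by (simp_all add: bounded_seqs_coord)
      have "nrm (A n) (y n) * nrm (A n) (x n) \<le> K * nrm (A n) (x n)"
        using K(2) coord.nrm_nonneg[OF c(1)] by (rule mult_right_mono)
      then show "nrm (A n) (x n \<otimes>\<^bsub>A n\<^esub> y n) \<le> K * nrm (A n) (x n)" "nrm (A n) (y n \<otimes>\<^bsub>A n\<^esub> x n) \<le> K * nrm (A n) (x n)"
        using coord.nrm_mult[OF c] coord.nrm_mult[OF c(2,1)] by (simp_all add: mult.commute)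
    qed
    then have "(\<lambda>n. nrm (A n) (x n \<otimes>\<^bsub>A n\<^esub> y n)) \<longlonglongrightarrow> 0" "(\<lambda>n. nrm (A n) (y n \<otimes>\<^bsub>A n\<^esub> x n)) \<longlonglongrightarrow> 0"
      using xc y by (auto intro!: tendsto_sandwich[OF _ _ tendsto_const lim'] simp: coord.nrm_nonneg bounded_seqs_coord)
    then show ?thesis using xc y by (simp add: cstar_sum_def cstar_prod_simps mult_bounded)
  qed
  then show "\<And>a x. a \<in> cstar_sum A \<Longrightarrow> x \<in> bounded_seqs \<Longrightarrow> x \<otimes>\<^bsub>cstar_prod A\<^esub> a \<in> cstar_sum A"
    and "\<And>a x. a \<in> cstar_sum A \<Longrightarrow> x \<in> bounded_seqs \<Longrightarrow> a \<otimes>\<^bsub>cstar_prod A\<^esub> x \<in> cstar_sum A" by blast+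
  show "subgroup (cstar_sum A) (add_monoid (cstar_prod A))"
  proof (rule group.subgroupI)
    show "group (add_monoid (cstar_prod A))" by (rule prod.add.is_group)
    show "cstar_sum A \<subseteq> carrier (add_monoid (cstar_prod A))" by (auto simp: cstar_sum_def)
    show "cstar_sum A \<noteq> {}" using const_bounded(1) by (auto simp: cstar_sum_def coord.nrm_zero)
  next
    fix x assume x: "x \<in> cstar_sum A"
    then have "(\<lambda>n. \<ominus>\<^bsub>A n\<^esub> x n) \<in> cstar_sum A" by (auto simp: cstar_sum_def uminus_bounded coord.nrm_uminus bounded_seqs_coord)
    moreover have "m_inv (add_monoid (cstar_prod A)) x = (\<lambda>n. \<ominus>\<^bsub>A n\<^esub> x n)"
      using x uminus_cstar_prod[of x] by (simp add: cstar_sum_def a_inv_def)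
    ultimately show "m_inv (add_monoid (cstar_prod A)) x \<in> cstar_sum A" by simp
  next
    fix x y assume x: "x \<in> cstar_sum A" and y: "y \<in> cstar_sum A"
    have lim: "(\<lambda>n. nrm (A n) (x n) + nrm (A n) (y n)) \<longlonglongrightarrow> 0"
      using x y tendsto_add[of "\<lambda>n. nrm (A n) (x n)" 0 sequentially "\<lambda>n. nrm (A n) (y n)" 0] by (simp add: cstar_sum_def)
    have "(\<lambda>n. nrm (A n) (x n \<oplus>\<^bsub>A n\<^esub> y n)) \<longlonglongrightarrow> 0"
      using x y by (intro tendsto_sandwich[OF _ _ tendsto_const lim])
        (auto intro!: always_eventually coord.nrm_triangle simp: coord.nrm_nonneg bounded_seqs_coord cstar_sum_def)
    then show "x \<otimes>\<^bsub>add_monoid (cstar_prod A)\<^esub> y \<in> cstar_sum A"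
      using x y by (simp add: cstar_sum_def cstar_prod_simps add_bounded)
  qed
qed (rule ring_cstar_prod)

lemma reduced_proj_hom: "reduced_proj A \<in> ring_hom (cstar_prod A) (reduced_prod A)"
proof -
  have eq: "reduced_proj A = (+>\<^bsub>cstar_prod A\<^esub>) (cstar_sum A)" by (simp add: fun_eq_iff reduced_proj_def)
  have "carrier (reduced_prod A) = carrier (cstar_prod A Quot cstar_sum A)"
    "monoid.mult (reduced_prod A) = monoid.mult (cstar_prod A Quot cstar_sum A)"
    "add (reduced_prod A) = add (cstar_prod A Quot cstar_sum A)"
    "one (reduced_prod A) = one (cstar_prod A Quot cstar_sum A)"
    by (simp_all add: reduced_prod_def cstar_quot_def)
  then show ?thesis using ideal.rcos_ring_hom[OF ideal_cstar_sum] unfolding eq ring_hom_def by simp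
qed

lemma reduced_proj_closed: "x \<in> bounded_seqs \<Longrightarrow> reduced_proj A x \<in> carrier (reduced_prod A)"
  by (rule ring_hom_closed[OF reduced_proj_hom])

lemma reduced_proj_mult:
  "x \<in> bounded_seqs \<Longrightarrow> y \<in> bounded_seqs \<Longrightarrow>
    reduced_proj A (\<lambda>n. x n \<otimes>\<^bsub>A n\<^esub> y n) = reduced_proj A x \<otimes>\<^bsub>reduced_prod A\<^esub> reduced_proj A y"
  using ring_hom_mult[OF reduced_proj_hom, of x y] by (simp add: cstar_prod_simps)

lemma reduced_proj_add:
  "x \<in> bounded_seqs \<Longrightarrow> y \<in> bounded_seqs \<Longrightarrow>
    reduced_proj A (\<lambda>n. x n \<oplus>\<^bsub>A n\<^esub> y n) = reduced_proj A x \<oplus>\<^bsub>reduced_prod A\<^esub> reduced_proj A y"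
  using ring_hom_add[OF reduced_proj_hom, of x y] by (simp add: cstar_prod_simps)

lemma reduced_proj_one: "reduced_proj A (\<lambda>n. \<one>\<^bsub>A n\<^esub>) = \<one>\<^bsub>reduced_prod A\<^esub>"
  using ring_hom_one[OF reduced_proj_hom] by (simp add: cstar_prod_simps)

lemma reduced_proj_surj:
  assumes "X \<in> carrier (reduced_prod A)"
  obtains x where "x \<in> bounded_seqs" "X = reduced_proj A x"
  using assms by (auto simp: reduced_prod_def reduced_proj_def cstar_quot_def FactRing_def A_RCOSETS_def')

lemma reduced_proj_eq_iff:
  assumes "x \<in> bounded_seqs" "y \<in> bounded_seqs"
  shows "reduced_proj A x = reduced_proj A y \<longleftrightarrow> (\<lambda>n. nrm (A n) (x n \<ominus>\<^bsub>A n\<^esub> y n)) \<longlonglongrightarrow> 0"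
  unfolding reduced_proj_def prod.quotient_eq_iff_same_a_r_cos[OF ideal_cstar_sum assms, symmetric]
  using minus_bounded[OF assms] by (simp add: cstar_sum_def minus_cstar_prod[OF assms])

section \<open>Characteristic sequences and central idempotents\<close>

definition char_seq :: "nat set \<Rightarrow> nat \<Rightarrow> 'a"
  where "char_seq S n = (if n \<in> S then \<one>\<^bsub>A n\<^esub> else \<zero>\<^bsub>A n\<^esub>)"

lemma char_seq_bounded: "char_seq S \<in> bounded_seqs"
  by (auto intro!: bounded_seqsI[where K = 1] simp: char_seq_def coord.nrm_zero coord.nrm_one)

lemma char_seq_mult: "(\<lambda>n. char_seq S n \<otimes>\<^bsub>A n\<^esub> char_seq T n) = char_seq (S \<inter> T)"
  by (simp add: fun_eq_iff char_seq_def)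

text \<open>Each coordinate of the difference has norm 0 or 1, so it tends to zero only by vanishing
  eventually.\<close>

lemma char_seq_eq_iff:
  "reduced_proj A (char_seq S) = reduced_proj A (char_seq T) \<longleftrightarrow> (\<forall>\<^sub>F n in cofinite. n \<in> S \<longleftrightarrow> n \<in> T)"
proof -
  have "nrm (A n) (char_seq S n \<ominus>\<^bsub>A n\<^esub> char_seq T n) = (if n \<in> S \<longleftrightarrow> n \<in> T then 0 else 1)" for n
    by (simp add: char_seq_def coord.minus_self coord.nrm_zero coord.nrm_one coord.nrm_uminus a_minus_def coord.r_neg)
  then show ?thesis
    unfolding reduced_proj_eq_iff[OF char_seq_bounded char_seq_bounded]
    by (subst tendsto_0_iff_eventually_zero) auto
qed

text \<open>Commuting with the whole reduced product makes the commutators of \<open>q n\<close>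
  uniformly small, since witnesses of failure, one per coordinate, would form a bounded sequence.
  Hence almost every \<open>q n\<close> is close to 0 or 1.\<close>

lemma reduced_proj_central_idempotent:
  assumes np: "\<And>n. no_nontrivial_central_projections (A n)" and q: "q \<in> bounded_seqs"
    and idem: "reduced_proj A q \<otimes>\<^bsub>reduced_prod A\<^esub> reduced_proj A q = reduced_proj A q"
    and central: "\<And>a. a \<in> bounded_seqs \<Longrightarrow>
      reduced_proj A q \<otimes>\<^bsub>reduced_prod A\<^esub> reduced_proj A a = reduced_proj A a \<otimes>\<^bsub>reduced_prod A\<^esub> reduced_proj A q"
  obtains T where "reduced_proj A q = reduced_proj A (char_seq T)"
proof -
  obtain K :: real where K: "K \<ge> 0" "\<And>n. nrm (A n) (q n) \<le> K" using bounded_seqs_bound[OF q] by metis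
  have qc: "q n \<in> carrier (A n)" for n using q by (rule bounded_seqs_coord)
  have idem': "(\<lambda>n. nrm (A n) (q n \<otimes>\<^bsub>A n\<^esub> q n \<ominus>\<^bsub>A n\<^esub> q n)) \<longlonglongrightarrow> 0"
    using idem q unfolding reduced_proj_mult[OF q q, symmetric] by (simp add: reduced_proj_eq_iff mult_bounded)
  have central': "(\<lambda>n. nrm (A n) (q n \<otimes>\<^bsub>A n\<^esub> a n \<ominus>\<^bsub>A n\<^esub> a n \<otimes>\<^bsub>A n\<^esub> q n)) \<longlonglongrightarrow> 0" if a: "a \<in> bounded_seqs" for a
    using central[OF a] a q unfolding reduced_proj_mult[OF q a, symmetric] reduced_proj_mult[OF a q, symmetric]
    by (simp add: reduced_proj_eq_iff mult_bounded)
  \<comment> \<open>Records which of 0 and 1 is nearer to \<open>q n\<close>.\<close>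
  define T where "T = {n. nrm (A n) (q n \<ominus>\<^bsub>A n\<^esub> \<one>\<^bsub>A n\<^esub>) < nrm (A n) (q n)}"
  have uniform: "\<forall>\<^sub>F n in sequentially. \<forall>a\<in>carrier (A n).
      nrm (A n) (q n \<otimes>\<^bsub>A n\<^esub> a \<ominus>\<^bsub>A n\<^esub> a \<otimes>\<^bsub>A n\<^esub> q n) \<le> \<delta> * nrm (A n) a" if \<delta>: "\<delta> > 0" for \<delta>
  proof -
    define bad where "bad n a \<longleftrightarrow> a \<in> carrier (A n) \<and> nrm (A n) a \<le> 1 \<and>
      \<delta> < nrm (A n) (q n \<otimes>\<^bsub>A n\<^esub> a \<ominus>\<^bsub>A n\<^esub> a \<otimes>\<^bsub>A n\<^esub> q n)" for n a
    define b where "b n = (if Ex (bad n) then Eps (bad n) else \<zero>\<^bsub>A n\<^esub>)" for n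
    have bad_b: "bad n (b n)" if "bad n a" for n a
      using someI[of "bad n" a] that by (auto simp: b_def)
    have "b \<in> bounded_seqs"
    proof (rule bounded_seqsI[where K = 1])
      fix n
      show "b n \<in> carrier (A n)" "nrm (A n) (b n) \<le> 1"
        using bad_b[of n] by (cases "Ex (bad n)"; force simp: b_def[of n] bad_def coord.nrm_zero)+
    qed
    then have "\<forall>\<^sub>F n in sequentially. nrm (A n) (q n \<otimes>\<^bsub>A n\<^esub> b n \<ominus>\<^bsub>A n\<^esub> b n \<otimes>\<^bsub>A n\<^esub> q n) < \<delta>"
      using central' \<delta> by (intro order_tendstoD)
    then show ?thesis
    proof eventually_elim
      fix n assume n: "nrm (A n) (q n \<otimes>\<^bsub>A n\<^esub> b n \<ominus>\<^bsub>A n\<^esub> b n \<otimes>\<^bsub>A n\<^esub> q n) < \<delta>"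
      then have no_bad: "\<not> bad n a" for a using bad_b[of n a] by (auto simp: bad_def)
      show "\<forall>a\<in>carrier (A n). nrm (A n) (q n \<otimes>\<^bsub>A n\<^esub> a \<ominus>\<^bsub>A n\<^esub> a \<otimes>\<^bsub>A n\<^esub> q n) \<le> \<delta> * nrm (A n) a"
      proof
        fix a assume a: "a \<in> carrier (A n)"
        show "nrm (A n) (q n \<otimes>\<^bsub>A n\<^esub> a \<ominus>\<^bsub>A n\<^esub> a \<otimes>\<^bsub>A n\<^esub> q n) \<le> \<delta> * nrm (A n) a"
        proof (cases "a = \<zero>\<^bsub>A n\<^esub>")
          case True
          then show ?thesis using qc[of n] by (simp add: coord.nrm_zero coord.minus_self)
        next
          case False
          define t where "t = nrm (A n) a"
          have t: "t > 0" using False coord.nrm_nonneg[OF a] coord.nrm_eq_zero[OF a] by (simp add: t_def)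
          define c where "c = complex_of_real (1 / t)"
          define a' where "a' = c \<odot>\<^bsub>A n\<^esub> a"
          have a': "a' \<in> carrier (A n)" "nrm (A n) a' \<le> 1"
            using a t coord.smult_closed'[of a n c] coord.nrm_smult[OF a, of c] by (simp_all add: a'_def c_def t_def norm_divide)
          define w where "w = q n \<otimes>\<^bsub>A n\<^esub> a \<ominus>\<^bsub>A n\<^esub> a \<otimes>\<^bsub>A n\<^esub> q n"
          have w: "w \<in> carrier (A n)" using a qc by (simp add: w_def)
          have "q n \<otimes>\<^bsub>A n\<^esub> a' \<ominus>\<^bsub>A n\<^esub> a' \<otimes>\<^bsub>A n\<^esub> q n = c \<odot>\<^bsub>A n\<^esub> (q n \<otimes>\<^bsub>A n\<^esub> a) \<ominus>\<^bsub>A n\<^esub> c \<odot>\<^bsub>A n\<^esub> (a \<otimes>\<^bsub>A n\<^esub> q n)"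
            using a qc[of n] by (simp add: a'_def coord.smult_mult_left coord.smult_mult_right)
          also have "\<dots> = c \<odot>\<^bsub>A n\<^esub> w"
            using a qc[of n] coord.scalar.smult_r_distr[of c "q n \<otimes>\<^bsub>A n\<^esub> a" n "\<ominus>\<^bsub>A n\<^esub> (a \<otimes>\<^bsub>A n\<^esub> q n)"]
              coord.scalar.smult_r_minus[of c "a \<otimes>\<^bsub>A n\<^esub> q n" n]
            by (simp add: a_minus_def w_def complex_ring_def)
          finally have "nrm (A n) (q n \<otimes>\<^bsub>A n\<^esub> a' \<ominus>\<^bsub>A n\<^esub> a' \<otimes>\<^bsub>A n\<^esub> q n) = nrm (A n) w / t"
            using t coord.nrm_smult[OF w, of c] by (simp add: c_def norm_divide)
          then have "nrm (A n) w / t \<le> \<delta>" using no_bad[of a'] a' by (simp add: bad_def)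
          then show ?thesis using t by (simp add: w_def t_def divide_le_eq)
        qed
      qed
    qed
  qed
  have "(\<lambda>n. nrm (A n) (q n \<ominus>\<^bsub>A n\<^esub> char_seq T n)) \<longlonglongrightarrow> 0"
  proof (rule order_tendstoI)
    fix \<epsilon> :: real assume "\<epsilon> < 0"
    then have "\<epsilon> < nrm (A n) (q n \<ominus>\<^bsub>A n\<^esub> char_seq T n)" for n
      using coord.nrm_nonneg[of "q n \<ominus>\<^bsub>A n\<^esub> char_seq T n" n] qc[of n] bounded_seqs_coord[OF char_seq_bounded, of T n]
      by force
    then show "\<forall>\<^sub>F n in sequentially. \<epsilon> < nrm (A n) (q n \<ominus>\<^bsub>A n\<^esub> char_seq T n)" by simp
  next
    fix \<epsilon> :: real assume \<epsilon>: "\<epsilon> > 0"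
    \<comment> \<open>The three bounds serve Newton's method, the relative size of commutators, and
      a final error of at most \<open>\<epsilon> / 2\<close>.\<close>
    define \<delta> where "\<delta> = min (1 / 14) (min (1 / (10 * (2 * K + 3))) (\<epsilon> / (4 * (2 * K + 3))))"
    have \<delta>: "\<delta> > 0" "\<delta> \<le> 1 / 14" "\<delta> \<le> 1 / (10 * (2 * K + 3))" "\<delta> \<le> \<epsilon> / (4 * (2 * K + 3))"
      using \<epsilon> K(1) unfolding \<delta>_def by (simp_all only: min.bounded_iff min_less_iff_conj min_le_iff_disj order_refl simp_thms) auto
    have K3: "2 * K + 3 > 0" using K(1) by simp
    have "\<delta> * (10 * (2 * K + 3)) \<le> 1" "\<delta> * (4 * (2 * K + 3)) \<le> \<epsilon>"
      using \<delta>(3,4) K3 by (simp_all only: pos_le_divide_eq zero_less_mult_iff zero_less_numeral simp_thms)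
    moreover define X where "X = (2 * K + 3) * \<delta>"
    ultimately have "10 * X \<le> 1" "4 * X \<le> \<epsilon>" by (simp_all add: mult.commute mult.left_commute)
    then have \<delta>': "5 * (2 * K + 3) * \<delta> < 1" "2 * (2 * K + 3) * \<delta> < \<epsilon>"
      using \<epsilon> unfolding mult.assoc X_def[symmetric] by linarith+
    have "\<forall>\<^sub>F n in sequentially. nrm (A n) (q n \<otimes>\<^bsub>A n\<^esub> q n \<ominus>\<^bsub>A n\<^esub> q n) < \<delta>"
      using idem' \<delta>(1) by (rule order_tendstoD)
    then show "\<forall>\<^sub>F n in sequentially. nrm (A n) (q n \<ominus>\<^bsub>A n\<^esub> char_seq T n) < \<epsilon>"
      using uniform[OF \<delta>(1)]
    proof eventually_elim
      fix n assume n: "nrm (A n) (q n \<otimes>\<^bsub>A n\<^esub> q n \<ominus>\<^bsub>A n\<^esub> q n) < \<delta>"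
        "\<forall>a\<in>carrier (A n). nrm (A n) (q n \<otimes>\<^bsub>A n\<^esub> a \<ominus>\<^bsub>A n\<^esub> a \<otimes>\<^bsub>A n\<^esub> q n) \<le> \<delta> * nrm (A n) a"
      then have "nrm (A n) (q n) \<le> 2 * (2 * K + 3) * \<delta> \<or> nrm (A n) (q n \<ominus>\<^bsub>A n\<^esub> \<one>\<^bsub>A n\<^esub>) \<le> 2 * (2 * K + 3) * \<delta>"
        using coord.near_central_idempotent[OF np qc K(2) _ \<delta>(2) \<delta>'(1)] by simp
      then show "nrm (A n) (q n \<ominus>\<^bsub>A n\<^esub> char_seq T n) < \<epsilon>"
        using \<delta>'(2) qc[of n] by (auto simp: char_seq_def T_def a_minus_def)
    qed
  qed
  then show thesis using that[of T] q by (simp add: reduced_proj_eq_iff char_seq_bounded)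
qed

end

subsection \<open>Isomorphisms of reduced products\<close>

locale reduced_prod_iso = A: cstar_family A + B: cstar_family B
  for A :: "nat \<Rightarrow> 'a cstar" and B :: "nat \<Rightarrow> 'b cstar" +
  fixes \<Lambda> :: "(nat \<Rightarrow> 'a) set \<Rightarrow> (nat \<Rightarrow> 'b) set"
  assumes no_projections_A: "no_nontrivial_central_projections (A n)"
    and no_projections_B: "no_nontrivial_central_projections (B n)"
    and iso: "\<Lambda> \<in> ring_iso (reduced_prod A) (reduced_prod B)"
begin

lemma \<Lambda>_mult:
  "x \<in> A.bounded_seqs \<Longrightarrow> y \<in> A.bounded_seqs \<Longrightarrow>
    \<Lambda> (reduced_proj A (\<lambda>n. x n \<otimes>\<^bsub>A n\<^esub> y n)) = \<Lambda> (reduced_proj A x) \<otimes>\<^bsub>reduced_prod B\<^esub> \<Lambda> (reduced_proj A y)"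
  by (simp add: A.reduced_proj_mult ring_iso_memE(2)[OF iso] A.reduced_proj_closed)

lemma \<Lambda>_add:
  "x \<in> A.bounded_seqs \<Longrightarrow> y \<in> A.bounded_seqs \<Longrightarrow>
    \<Lambda> (reduced_proj A (\<lambda>n. x n \<oplus>\<^bsub>A n\<^esub> y n)) = \<Lambda> (reduced_proj A x) \<oplus>\<^bsub>reduced_prod B\<^esub> \<Lambda> (reduced_proj A y)"
  by (simp add: A.reduced_proj_add ring_iso_memE(3)[OF iso] A.reduced_proj_closed)

lemma \<Lambda>_one: "\<Lambda> (reduced_proj A (\<lambda>n. \<one>\<^bsub>A n\<^esub>)) = reduced_proj B (\<lambda>n. \<one>\<^bsub>B n\<^esub>)"
  by (simp add: A.reduced_proj_one B.reduced_proj_one ring_iso_memE(4)[OF iso])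

lemma \<Lambda>_lift:
  assumes "x \<in> A.bounded_seqs"
  obtains y where "y \<in> B.bounded_seqs" "\<Lambda> (reduced_proj A x) = reduced_proj B y"
  using B.reduced_proj_surj[OF ring_iso_memE(1)[OF iso A.reduced_proj_closed[OF assms]]] by metis

lemma \<Lambda>_inj:
  "x \<in> A.bounded_seqs \<Longrightarrow> y \<in> A.bounded_seqs \<Longrightarrow>
    \<Lambda> (reduced_proj A x) = \<Lambda> (reduced_proj A y) \<longleftrightarrow> reduced_proj A x = reduced_proj A y"
  using inj_on_eq_iff[OF bij_betw_imp_inj_on[OF ring_iso_memE(5)[OF iso]]] A.reduced_proj_closed by blast

lemma \<Lambda>_surj:
  assumes "y \<in> B.bounded_seqs"
  obtains x where "x \<in> A.bounded_seqs" "\<Lambda> (reduced_proj A x) = reduced_proj B y"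
proof -
  have "reduced_proj B y \<in> \<Lambda> ` carrier (reduced_prod A)"
    using ring_iso_memE(5)[OF iso] B.reduced_proj_closed[OF assms] by (simp add: bij_betw_def)
  then obtain X where X: "X \<in> carrier (reduced_prod A)" "reduced_proj B y = \<Lambda> X" by blast
  obtain x where "x \<in> A.bounded_seqs" "X = reduced_proj A x" using A.reduced_proj_surj[OF X(1)] .
  then show thesis using that X(2) by simp
qed

text \<open>Central idempotents are preserved by an isomorphism, and those on the side of
  \<open>B\<close> are classes of characteristic sequences.\<close>

lemma char_seq_image: "\<exists>T. \<Lambda> (reduced_proj A (A.char_seq S)) = reduced_proj B (B.char_seq T)"
proof -
  note c = A.char_seq_bounded[of S]
  obtain q where q: "q \<in> B.bounded_seqs" "\<Lambda> (reduced_proj A (A.char_seq S)) = reduced_proj B q"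
    using \<Lambda>_lift[OF c] .
  obtain T where "reduced_proj B q = reduced_proj B (B.char_seq T)"
  proof (rule B.reduced_proj_central_idempotent[OF no_projections_B q(1)])
    show "reduced_proj B q \<otimes>\<^bsub>reduced_prod B\<^esub> reduced_proj B q = reduced_proj B q"
      using \<Lambda>_mult[OF c c] by (simp add: q(2) A.char_seq_mult)
    fix b assume b: "b \<in> B.bounded_seqs"
    obtain a where a: "a \<in> A.bounded_seqs" "\<Lambda> (reduced_proj A a) = reduced_proj B b" using \<Lambda>_surj[OF b] .
    have "(\<lambda>n. A.char_seq S n \<otimes>\<^bsub>A n\<^esub> a n) = (\<lambda>n. a n \<otimes>\<^bsub>A n\<^esub> A.char_seq S n)"
      using A.bounded_seqs_coord[OF a(1)] by (simp add: fun_eq_iff A.char_seq_def)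
    then show "reduced_proj B q \<otimes>\<^bsub>reduced_prod B\<^esub> reduced_proj B b = reduced_proj B b \<otimes>\<^bsub>reduced_prod B\<^esub> reduced_proj B q"
      using \<Lambda>_mult[OF c a(1)] \<Lambda>_mult[OF a(1) c] by (simp add: q(2) a(2))
  qed blast
  then show ?thesis using q(2) by metis
qed

definition F :: "nat set \<Rightarrow> nat set"
  where "F S = (SOME T. \<Lambda> (reduced_proj A (A.char_seq S)) = reduced_proj B (B.char_seq T))"

lemma F_char_seq: "\<Lambda> (reduced_proj A (A.char_seq S)) = reduced_proj B (B.char_seq (F S))"
  unfolding F_def by (rule someI_ex[OF char_seq_image])

text \<open>Intersection is multiplication, and complements have sum 1: two characteristic values
  sum to 0, 1 or 2 in a coordinate, and both 0 and 2 have distance 1 from 1. For surjectivity, a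
  characteristic sequence is pulled back to a central idempotent on the side of
  \<open>A\<close>.\<close>

lemma F_automorphism: "mod_finite_automorphism F"
proof
  fix S S'
  have "reduced_proj B (B.char_seq (F (S \<inter> S'))) = reduced_proj B (B.char_seq (F S \<inter> F S'))"
    using \<Lambda>_mult[OF A.char_seq_bounded A.char_seq_bounded, of S S']
      B.reduced_proj_mult[OF B.char_seq_bounded B.char_seq_bounded, of "F S" "F S'"]
    by (simp add: A.char_seq_mult B.char_seq_mult F_char_seq)
  then show "\<forall>\<^sub>F m in cofinite. m \<in> F (S \<inter> S') \<longleftrightarrow> m \<in> F S \<and> m \<in> F S'"
    by (simp add: B.char_seq_eq_iff)
next
  fix S
  define u where "u n = B.char_seq (F S) n \<oplus>\<^bsub>B n\<^esub> B.char_seq (F (- S)) n" for n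
  have u: "u \<in> B.bounded_seqs" using B.add_bounded[OF B.char_seq_bounded B.char_seq_bounded, of "F S" "F (- S)"] by (simp add: u_def[abs_def])
  have "(\<lambda>n. A.char_seq S n \<oplus>\<^bsub>A n\<^esub> A.char_seq (- S) n) = (\<lambda>n. \<one>\<^bsub>A n\<^esub>)"
    by (simp add: fun_eq_iff A.char_seq_def)
  then have "reduced_proj B u = reduced_proj B (\<lambda>n. \<one>\<^bsub>B n\<^esub>)"
    using \<Lambda>_add[OF A.char_seq_bounded A.char_seq_bounded, of S "- S"] \<Lambda>_one
      B.reduced_proj_add[OF B.char_seq_bounded B.char_seq_bounded, of "F S" "F (- S)"]
    by (simp add: F_char_seq u_def[abs_def])
  then have "(\<lambda>n. nrm (B n) (u n \<ominus>\<^bsub>B n\<^esub> \<one>\<^bsub>B n\<^esub>)) \<longlonglongrightarrow> 0"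
    using B.reduced_proj_eq_iff[OF u B.const_bounded(2)] by simp
  then have "\<forall>\<^sub>F n in cofinite. nrm (B n) (u n \<ominus>\<^bsub>B n\<^esub> \<one>\<^bsub>B n\<^esub>) < 1"
    unfolding cofinite_eq_sequentially by (rule order_tendstoD) simp
  then show "\<forall>\<^sub>F n in cofinite. n \<in> F (- S) \<longleftrightarrow> n \<notin> F S"
  proof eventually_elim
    fix n assume n: "nrm (B n) (u n \<ominus>\<^bsub>B n\<^esub> \<one>\<^bsub>B n\<^esub>) < 1"
    have "\<one>\<^bsub>B n\<^esub> \<oplus>\<^bsub>B n\<^esub> \<one>\<^bsub>B n\<^esub> \<ominus>\<^bsub>B n\<^esub> \<one>\<^bsub>B n\<^esub> = \<one>\<^bsub>B n\<^esub>"
      by (simp add: a_minus_def B.coord.a_assoc B.coord.r_neg)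
    then show "n \<in> F (- S) \<longleftrightarrow> n \<notin> F S"
      using n by (auto simp: u_def B.char_seq_def B.coord.nrm_one B.coord.nrm_uminus a_minus_def split: if_splits)
  qed
next
  fix T
  obtain x where x: "x \<in> A.bounded_seqs" "\<Lambda> (reduced_proj A x) = reduced_proj B (B.char_seq T)"
    using \<Lambda>_surj[OF B.char_seq_bounded] .
  obtain S where S: "reduced_proj A x = reduced_proj A (A.char_seq S)"
  proof (rule A.reduced_proj_central_idempotent[OF no_projections_A x(1)])
    have "\<Lambda> (reduced_proj A (\<lambda>n. x n \<otimes>\<^bsub>A n\<^esub> x n)) = \<Lambda> (reduced_proj A x)"
      using \<Lambda>_mult[OF x(1) x(1)] B.reduced_proj_mult[OF B.char_seq_bounded B.char_seq_bounded, of T T]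
      by (simp add: x(2) B.char_seq_mult)
    then show "reduced_proj A x \<otimes>\<^bsub>reduced_prod A\<^esub> reduced_proj A x = reduced_proj A x"
      using \<Lambda>_inj[OF A.mult_bounded[OF x(1) x(1)] x(1)] by (simp add: A.reduced_proj_mult x(1))
    fix a assume a: "a \<in> A.bounded_seqs"
    obtain b where b: "b \<in> B.bounded_seqs" "\<Lambda> (reduced_proj A a) = reduced_proj B b" using \<Lambda>_lift[OF a] .
    have "(\<lambda>n. B.char_seq T n \<otimes>\<^bsub>B n\<^esub> b n) = (\<lambda>n. b n \<otimes>\<^bsub>B n\<^esub> B.char_seq T n)"
      using B.bounded_seqs_coord[OF b(1)] by (simp add: fun_eq_iff B.char_seq_def)
    then have "\<Lambda> (reduced_proj A (\<lambda>n. x n \<otimes>\<^bsub>A n\<^esub> a n)) = \<Lambda> (reduced_proj A (\<lambda>n. a n \<otimes>\<^bsub>A n\<^esub> x n))"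
      using \<Lambda>_mult[OF x(1) a] \<Lambda>_mult[OF a x(1)] B.reduced_proj_mult[OF B.char_seq_bounded b(1), of T]
        B.reduced_proj_mult[OF b(1) B.char_seq_bounded, of T] by (simp add: x(2) b(2))
    then show "reduced_proj A x \<otimes>\<^bsub>reduced_prod A\<^esub> reduced_proj A a = reduced_proj A a \<otimes>\<^bsub>reduced_prod A\<^esub> reduced_proj A x"
      using \<Lambda>_inj[OF A.mult_bounded[OF x(1) a] A.mult_bounded[OF a x(1)]] by (simp add: A.reduced_proj_mult x(1) a)
  qed blast
  have "\<forall>\<^sub>F m in cofinite. m \<in> F S \<longleftrightarrow> m \<in> T"
    using x(2) F_char_seq[of S] by (simp add: S B.char_seq_eq_iff[symmetric])
  then show "\<exists>S. \<forall>\<^sub>F m in cofinite. m \<in> F S \<longleftrightarrow> m \<in> T" by blast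
next
  fix S
  have eq: "(\<forall>\<^sub>F n in cofinite. n \<in> S' \<longleftrightarrow> n \<in> S'') \<longleftrightarrow> (\<forall>\<^sub>F m in cofinite. m \<in> F S' \<longleftrightarrow> m \<in> F S'')" for S' S''
    using \<Lambda>_inj[OF A.char_seq_bounded A.char_seq_bounded, of S' S'']
    by (simp only: F_char_seq A.char_seq_eq_iff B.char_seq_eq_iff)
  have "\<forall>\<^sub>F m in cofinite. m \<in> F {}  \<longleftrightarrow> m \<in> {}"
  proof -
    define z where "z = (\<lambda>n. \<zero>\<^bsub>A n\<^esub>)"
    have z: "z \<in> A.bounded_seqs" by (simp add: z_def A.const_bounded)
    have "A.char_seq {} = z" by (simp add: fun_eq_iff A.char_seq_def z_def)
    \<comment> \<open>Zero is recognized additively: adding the class to itself does not change it,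
      which excludes the value 1 in almost all coordinates.\<close>
    define v where "v n = B.char_seq (F {}) n \<oplus>\<^bsub>B n\<^esub> B.char_seq (F {}) n" for n
    have v: "v \<in> B.bounded_seqs" using B.add_bounded[OF B.char_seq_bounded B.char_seq_bounded, of "F {}" "F {}"] by (simp add: v_def[abs_def])
    have "reduced_proj B v = reduced_proj B (B.char_seq (F {}))"
      using \<Lambda>_add[OF z z] F_char_seq[of "{}"] B.reduced_proj_add[OF B.char_seq_bounded B.char_seq_bounded, of "F {}" "F {}"]
      unfolding \<open>A.char_seq {} = z\<close> by (simp add: z_def v_def[abs_def])
    then have "(\<lambda>n. nrm (B n) (v n \<ominus>\<^bsub>B n\<^esub> B.char_seq (F {}) n)) \<longlonglongrightarrow> 0"
      using B.reduced_proj_eq_iff[OF v B.char_seq_bounded] by simp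
    then have "\<forall>\<^sub>F n in cofinite. nrm (B n) (v n \<ominus>\<^bsub>B n\<^esub> B.char_seq (F {}) n) < 1"
      unfolding cofinite_eq_sequentially by (rule order_tendstoD) simp
    then show ?thesis
    proof eventually_elim
      fix n assume n: "nrm (B n) (v n \<ominus>\<^bsub>B n\<^esub> B.char_seq (F {}) n) < 1"
      have "\<one>\<^bsub>B n\<^esub> \<oplus>\<^bsub>B n\<^esub> \<one>\<^bsub>B n\<^esub> \<ominus>\<^bsub>B n\<^esub> \<one>\<^bsub>B n\<^esub> = \<one>\<^bsub>B n\<^esub>"
        by (simp add: a_minus_def B.coord.a_assoc B.coord.r_neg)
      then show "n \<in> F {} \<longleftrightarrow> n \<in> {}"
        using n by (auto simp: v_def B.char_seq_def B.coord.nrm_one split: if_splits)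
    qed
  qed
  then have "finite (F {})" by (simp add: eventually_cofinite)
  have "finite (F S) \<longleftrightarrow> (\<forall>\<^sub>F m in cofinite. m \<in> F S \<longleftrightarrow> m \<in> F {})"
    unfolding eventually_cofinite
  proof
    assume "finite (F S)"
    then show "finite {m. \<not> (m \<in> F S \<longleftrightarrow> m \<in> F {})}"
      using \<open>finite (F {})\<close> by (auto intro: finite_subset[of _ "F S \<union> F {}"])
  next
    assume "finite {m. \<not> (m \<in> F S \<longleftrightarrow> m \<in> F {})}"
    then show "finite (F S)"
      using \<open>finite (F {})\<close> by (auto intro: finite_subset[of "F S" "{m. \<not> (m \<in> F S \<longleftrightarrow> m \<in> F {})} \<union> F {}"])
  qed
  also have "\<dots> \<longleftrightarrow> finite S"
    unfolding eq[symmetric] by (simp add: eventually_cofinite)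
  finally show "finite (F S) \<longleftrightarrow> finite S" .
qed

section \<open>Lifts of the isomorphism and their coordinatewise approximation\<close>

definition L :: "(nat \<Rightarrow> 'a) \<Rightarrow> nat \<Rightarrow> 'b"
  where "L x = (SOME y. y \<in> B.bounded_seqs \<and> \<Lambda> (reduced_proj A x) = reduced_proj B y)"

lemma
  assumes "x \<in> A.bounded_seqs"
  shows L_bounded: "L x \<in> B.bounded_seqs" and \<Lambda>_eq_L: "\<Lambda> (reduced_proj A x) = reduced_proj B (L x)"
proof -
  have "\<exists>y. y \<in> B.bounded_seqs \<and> \<Lambda> (reduced_proj A x) = reduced_proj B y" using \<Lambda>_lift[OF assms] by metis
  from someI_ex[OF this] show "L x \<in> B.bounded_seqs" "\<Lambda> (reduced_proj A x) = reduced_proj B (L x)"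
    unfolding L_def by blast+
qed

lemma L_coord: "x \<in> A.bounded_seqs \<Longrightarrow> L x m \<in> carrier (B m)"
  by (rule B.bounded_seqs_coord[OF L_bounded])

text \<open>Multiplication by the characteristic sequence of \<open>S\<close> makes \<open>x\<close>
  and \<open>y\<close> equal, and \<open>\<Lambda>\<close> turns this factor into the characteristic
  sequence of \<open>F S\<close>.\<close>

lemma L_local:
  assumes x: "x \<in> A.bounded_seqs" and y: "y \<in> A.bounded_seqs" and eq: "\<And>n. n \<in> S \<Longrightarrow> x n = y n"
    and \<epsilon>: "\<epsilon> > 0"
  shows "finite {m \<in> F S. \<epsilon> < nrm (B m) (L x m \<ominus>\<^bsub>B m\<^esub> L y m)}"
proof -
  have "(\<lambda>n. A.char_seq S n \<otimes>\<^bsub>A n\<^esub> x n) = (\<lambda>n. A.char_seq S n \<otimes>\<^bsub>A n\<^esub> y n)"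
    using eq A.bounded_seqs_coord[OF x] A.bounded_seqs_coord[OF y] by (simp add: fun_eq_iff A.char_seq_def)
  then have "reduced_proj B (\<lambda>m. B.char_seq (F S) m \<otimes>\<^bsub>B m\<^esub> L x m) = reduced_proj B (\<lambda>m. B.char_seq (F S) m \<otimes>\<^bsub>B m\<^esub> L y m)"
    using \<Lambda>_mult[OF A.char_seq_bounded x, of S] \<Lambda>_mult[OF A.char_seq_bounded y, of S]
    by (simp add: B.reduced_proj_mult B.char_seq_bounded L_bounded x y F_char_seq \<Lambda>_eq_L)
  then have "(\<lambda>m. nrm (B m) (B.char_seq (F S) m \<otimes>\<^bsub>B m\<^esub> L x m \<ominus>\<^bsub>B m\<^esub> B.char_seq (F S) m \<otimes>\<^bsub>B m\<^esub> L y m)) \<longlonglongrightarrow> 0"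
    by (subst (asm) B.reduced_proj_eq_iff) (simp_all add: B.mult_bounded B.char_seq_bounded L_bounded x y)
  then have "\<forall>\<^sub>F m in cofinite. nrm (B m) (B.char_seq (F S) m \<otimes>\<^bsub>B m\<^esub> L x m \<ominus>\<^bsub>B m\<^esub> B.char_seq (F S) m \<otimes>\<^bsub>B m\<^esub> L y m) < \<epsilon>"
    unfolding cofinite_eq_sequentially using \<epsilon> by (rule order_tendstoD)
  then have "finite {m. \<not> nrm (B m) (B.char_seq (F S) m \<otimes>\<^bsub>B m\<^esub> L x m \<ominus>\<^bsub>B m\<^esub> B.char_seq (F S) m \<otimes>\<^bsub>B m\<^esub> L y m) < \<epsilon>}"
    unfolding eventually_cofinite .
  then show ?thesis
    by (rule rev_finite_subset) (auto simp: B.char_seq_def L_coord x y)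
qed

text \<open>A partial function selects elements of the dense sequences \<open>c n\<close>, and its
  value at \<open>n\<close> is an index in the dense sequence of \<open>B (g n)\<close> close to the
  lifted image there. \<open>L_local\<close> makes the family coherent, and it contains all partial
  functions.\<close>

lemma coordinatewise_approximation:
  assumes axioms: OCA MA_aleph1
    and g: "finite F\<^sub>1" "inj_on g (- F\<^sub>1)" "\<And>S. \<forall>\<^sub>F m in cofinite. m \<in> F S \<longleftrightarrow> m \<in> g ` (S - F\<^sub>1)"
    and c: "\<And>n d. c n d \<in> carrier (A n)" and b: "\<And>m e. b m e \<in> carrier (B m)"
    and b_dense: "\<And>m y \<epsilon>. y \<in> carrier (B m) \<Longrightarrow> \<epsilon> > 0 \<Longrightarrow> \<exists>e :: nat. nrm (B m) (b m e \<ominus>\<^bsub>B m\<^esub> y) < \<epsilon>"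
    and \<epsilon>: "\<epsilon> > 0" and K: "K \<ge> 0"
  obtains \<psi> :: "nat \<Rightarrow> nat \<Rightarrow> 'b" where "\<And>n d. \<psi> n d \<in> carrier (B (g n))"
    "\<And>z :: nat \<Rightarrow> nat. (\<And>n. nrm (A n) (c n (z n)) \<le> K) \<Longrightarrow>
      finite {n. 3 * \<epsilon> < nrm (B (g n)) (L (\<lambda>n. c n (z n)) (g n) \<ominus>\<^bsub>B (g n)\<^esub> \<psi> n (z n))}"
proof -
  \<comment> \<open>Undefined places and elements of norm above \<open>K\<close> become zero, so
    that every partial function yields a bounded sequence.\<close>
  define hat where "hat x n = (case x n of None \<Rightarrow> \<zero>\<^bsub>A n\<^esub> |
    Some d \<Rightarrow> if nrm (A n) (c n d) \<le> K then c n d else \<zero>\<^bsub>A n\<^esub>)" for x :: "nat \<Rightarrow> nat option" and n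
  have hat: "hat x \<in> A.bounded_seqs" for x
  proof (rule A.bounded_seqsI[where K = K])
    fix n
    have "hat x n = \<zero>\<^bsub>A n\<^esub> \<or> (\<exists>d. hat x n = c n d \<and> nrm (A n) (c n d) \<le> K)"
      unfolding hat_def by (cases "x n") auto
    then consider "hat x n = \<zero>\<^bsub>A n\<^esub>" | d where "hat x n = c n d" "nrm (A n) (c n d) \<le> K" by blast
    then have "hat x n \<in> carrier (A n) \<and> nrm (A n) (hat x n) \<le> K"
    proof cases
      case 1
      show ?thesis unfolding 1 A.coord.nrm_zero using K by simp
    next
      case 2
      show ?thesis unfolding 2(1) using 2(2) c by blast
    qed
    then show "hat x n \<in> carrier (A n)" "nrm (A n) (hat x n) \<le> K" by blast+
  qed
  \<comment> \<open>\<open>\<epsilon> / 8\<close> on either side and \<open>\<epsilon> / 4\<close>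
    from \<open>L_local\<close> add up to the \<open>\<epsilon> / 2\<close> of coherence.\<close>
  define f where "f x n = (SOME e. nrm (B (g n)) (b (g n) e \<ominus>\<^bsub>B (g n)\<^esub> L (hat x) (g n)) < \<epsilon> / 8)" for x n
  have f: "nrm (B (g n)) (b (g n) (f x n) \<ominus>\<^bsub>B (g n)\<^esub> L (hat x) (g n)) < \<epsilon> / 8" for x n
    unfolding f_def using \<epsilon> by (rule someI_ex[OF b_dense[OF L_coord[OF hat]], OF divide_pos_pos]) simp
  define \<delta> where "\<delta> n e e' = nrm (B (g n)) (b (g n) e \<ominus>\<^bsub>B (g n)\<^esub> b (g n) e')" for n e e'
  have coherent: "finite {n. x n \<noteq> None \<and> x n = y n \<and> \<epsilon> / 2 < \<delta> n (f x n) (f y n)}" (is "finite ?C") for x y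
  proof -
    define S where "S = {n. x n = y n}"
    have "finite {m \<in> F S. \<epsilon> / 4 < nrm (B m) (L (hat x) m \<ominus>\<^bsub>B m\<^esub> L (hat y) m)}"
      using \<epsilon> by (intro L_local hat) (auto simp: S_def hat_def)
    moreover have "finite {m. \<not> (m \<in> F S \<longleftrightarrow> m \<in> g ` (S - F\<^sub>1))}"
      using g(3) unfolding eventually_cofinite .
    ultimately have "finite ({m \<in> F S. \<epsilon> / 4 < nrm (B m) (L (hat x) m \<ominus>\<^bsub>B m\<^esub> L (hat y) m)} \<union> {m. \<not> (m \<in> F S \<longleftrightarrow> m \<in> g ` (S - F\<^sub>1))})"
      (is "finite ?E") by (rule finite_UnI)
    then have "finite (g -` ?E \<inter> - F\<^sub>1)" using g(2) by (rule finite_vimage_IntI)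
    moreover have "?C \<subseteq> F\<^sub>1 \<union> (g -` ?E \<inter> - F\<^sub>1)"
    proof
      fix n assume n: "n \<in> ?C"
      have dist: "\<delta> n (f x n) (f y n) \<le> \<epsilon> / 8 + nrm (B (g n)) (L (hat x) (g n) \<ominus>\<^bsub>B (g n)\<^esub> L (hat y) (g n)) + \<epsilon> / 8"
      proof -
        let ?B = "B (g n)" and ?p = "b (g n) (f x n)" and ?q = "b (g n) (f y n)" and ?x = "L (hat x) (g n)" and ?y = "L (hat y) (g n)"
        have "nrm ?B (?p \<ominus>\<^bsub>?B\<^esub> ?q) \<le> nrm ?B (?p \<ominus>\<^bsub>?B\<^esub> ?x) + nrm ?B (?x \<ominus>\<^bsub>?B\<^esub> ?q)"
          by (intro B.coord.nrm_minus_triangle b L_coord hat)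
        moreover have "nrm ?B (?x \<ominus>\<^bsub>?B\<^esub> ?q) \<le> nrm ?B (?x \<ominus>\<^bsub>?B\<^esub> ?y) + nrm ?B (?y \<ominus>\<^bsub>?B\<^esub> ?q)"
          by (intro B.coord.nrm_minus_triangle b L_coord hat)
        moreover have "nrm ?B (?y \<ominus>\<^bsub>?B\<^esub> ?q) = nrm ?B (?q \<ominus>\<^bsub>?B\<^esub> ?y)"
          by (intro B.coord.nrm_minus_commute b L_coord hat)
        ultimately show ?thesis using f[where x = x and n = n] f[where x = y and n = n] unfolding \<delta>_def by linarith
      qed
      show "n \<in> F\<^sub>1 \<union> (g -` ?E \<inter> - F\<^sub>1)"
      proof (cases "n \<in> F\<^sub>1")
        case False
        then have "g n \<in> g ` (S - F\<^sub>1)" using n by (auto simp: S_def)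
        then show ?thesis using False n dist by auto
      qed simp
    qed
    ultimately show ?thesis using g(1) by (meson finite_UnI finite_subset)
  qed
  interpret coherent_family UNIV f \<delta> \<epsilon>
  proof
    show "\<delta> n a a = 0" for n a by (simp add: \<delta>_def B.coord.minus_self b B.coord.nrm_zero)
    show "\<delta> n a a' = \<delta> n a' a" for n a a' by (simp add: \<delta>_def B.coord.nrm_minus_commute b)
    show "\<delta> n a a'' \<le> \<delta> n a a' + \<delta> n a' a''" for n a a' a'' by (simp add: \<delta>_def B.coord.nrm_minus_triangle b)
  qed (use \<epsilon> coherent not_seq_meagre_UNIV in auto)
  obtain \<phi> where \<phi>: "\<forall>x\<in>UNIV. finite {n. \<exists>d. x n = Some d \<and> 2 * \<epsilon> < \<delta> n (f x n) (\<phi> n d)}"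
    using uniformization[OF axioms] by blast
  show thesis
  proof (rule that[of "\<lambda>n d. b (g n) (\<phi> n d)"])
    show "b (g n) (\<phi> n d) \<in> carrier (B (g n))" for n d by (rule b)
    fix z :: "nat \<Rightarrow> nat" assume z: "\<And>n. nrm (A n) (c n (z n)) \<le> K"
    define x where "x n = Some (z n)" for n
    have hx: "hat x = (\<lambda>n. c n (z n))" using z by (simp add: fun_eq_iff hat_def x_def)
    have "finite {n. 2 * \<epsilon> < \<delta> n (f x n) (\<phi> n (z n))}" using \<phi>[rule_format, of x] by (simp add: x_def)
    \<comment> \<open>The third \<open>\<epsilon>\<close> pays for the passage from the lift to its
      coded approximation.\<close>
    moreover have "2 * \<epsilon> < \<delta> n (f x n) (\<phi> n (z n))"
      if "3 * \<epsilon> < nrm (B (g n)) (L (hat x) (g n) \<ominus>\<^bsub>B (g n)\<^esub> b (g n) (\<phi> n (z n)))" for n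
    proof -
      let ?B = "B (g n)" and ?p = "b (g n) (f x n)" and ?q = "b (g n) (\<phi> n (z n))" and ?x = "L (hat x) (g n)"
      have "nrm ?B (?x \<ominus>\<^bsub>?B\<^esub> ?q) \<le> nrm ?B (?x \<ominus>\<^bsub>?B\<^esub> ?p) + nrm ?B (?p \<ominus>\<^bsub>?B\<^esub> ?q)"
        by (intro B.coord.nrm_minus_triangle b L_coord hat)
      moreover have "nrm ?B (?x \<ominus>\<^bsub>?B\<^esub> ?p) = nrm ?B (?p \<ominus>\<^bsub>?B\<^esub> ?x)"
        by (intro B.coord.nrm_minus_commute b L_coord hat)
      ultimately show ?thesis using that \<epsilon> f[where x = x and n = n] unfolding \<delta>_def by linarith
    qed
    ultimately show "finite {n. 3 * \<epsilon> < nrm (B (g n)) (L (\<lambda>n. c n (z n)) (g n) \<ominus>\<^bsub>B (g n)\<^esub> b (g n) (\<phi> n (z n)))}"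
      unfolding hx[symmetric] by (elim rev_finite_subset) auto
  qed
qed

text \<open>At the index \<open>n\<close> use the approximation for the largest \<open>j\<close> that is already compatible with all
  earlier ones from \<open>n\<close> on.\<close>

lemma diagonal_approximation:
  assumes g: "finite F\<^sub>1" "inj_on g (- F\<^sub>1)"
    and c: "\<And>n d. c n d \<in> carrier (A n)"
    and c_dense: "\<And>n a \<epsilon>. a \<in> carrier (A n) \<Longrightarrow> \<epsilon> > 0 \<Longrightarrow> \<exists>d :: nat. nrm (A n) (c n d \<ominus>\<^bsub>A n\<^esub> a) < \<epsilon>"
    and \<psi>: "\<And>j n d. \<psi> j n d \<in> carrier (B (g n))"
    and approx: "\<And>j (z :: nat \<Rightarrow> nat). (\<And>n. nrm (A n) (c n (z n)) \<le> real (Suc j)) \<Longrightarrow>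
      finite {n. 3 / real (Suc j) < nrm (B (g n)) (L (\<lambda>n. c n (z n)) (g n) \<ominus>\<^bsub>B (g n)\<^esub> \<psi> j n (z n))}"
  obtains \<phi> where "\<And>n a. \<phi> n a \<in> carrier (B (g n))"
    "\<And>x \<epsilon>. x \<in> A.bounded_seqs \<Longrightarrow> \<epsilon> > 0 \<Longrightarrow>
      finite {n \<in> - F\<^sub>1. \<epsilon> < nrm (B (g n)) (L x (g n) \<ominus>\<^bsub>B (g n)\<^esub> \<phi> n (x n))}"
proof -
  have bounded: "(\<lambda>n. c n (z n)) \<in> A.bounded_seqs" if "\<And>n. nrm (A n) (c n (z n)) \<le> K" for z K
    using that c by (intro A.bounded_seqsI[where K = K])
  \<comment> \<open>A default of norm at most 1, so that the sequence of bad witnesses remains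
    within the norm bound where there is none.\<close>
  define d\<^sub>0 where "d\<^sub>0 n = (SOME d. nrm (A n) (c n d \<ominus>\<^bsub>A n\<^esub> \<zero>\<^bsub>A n\<^esub>) < 1)" for n
  have near: "nrm (A n) (c n (d\<^sub>0 n) \<ominus>\<^bsub>A n\<^esub> \<zero>\<^bsub>A n\<^esub>) < 1" for n
    unfolding d\<^sub>0_def by (rule someI_ex[OF c_dense]) auto
  have d\<^sub>0: "nrm (A n) (c n (d\<^sub>0 n)) \<le> 1" for n
    using near[of n] c[of n "d\<^sub>0 n"] by (simp add: a_minus_def less_imp_le)
  \<comment> \<open>\<open>6 / real (Suc i)\<close> is twice the error of \<open>\<psi> i\<close>;
    for later \<open>j\<close> both maps approximate the same lift.\<close>
  define good where "good i j n \<longleftrightarrow> (\<forall>d. nrm (A n) (c n d) \<le> real (Suc i) \<longrightarrow>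
    nrm (B (g n)) (\<psi> i n d \<ominus>\<^bsub>B (g n)\<^esub> \<psi> j n d) \<le> 6 / real (Suc i))" for i j n
  have good: "finite {n. \<not> good i j n}" if "i \<le> j" for i j
  proof -
    define bad where "bad n d \<longleftrightarrow> nrm (A n) (c n d) \<le> real (Suc i) \<and>
      6 / real (Suc i) < nrm (B (g n)) (\<psi> i n d \<ominus>\<^bsub>B (g n)\<^esub> \<psi> j n d)" for n d
    define z where "z n = (if Ex (bad n) then Eps (bad n) else d\<^sub>0 n)" for n
    have bad_z: "bad n (z n)" if "\<not> good i j n" for n
    proof -
      have "Ex (bad n)" using that by (auto simp: good_def bad_def not_le)
      then show ?thesis unfolding z_def by (simp add: someI_ex)
    qed
    have zn: "nrm (A n) (c n (z n)) \<le> real (Suc i)" for n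
    proof (cases "good i j n")
      case True
      then have "z n = d\<^sub>0 n" by (auto simp: z_def good_def bad_def not_less)
      then show ?thesis using d\<^sub>0[of n] by simp
    qed (use bad_z bad_def in blast)
    define E where "E k = {n. 3 / real (Suc k) < nrm (B (g n)) (L (\<lambda>n. c n (z n)) (g n) \<ominus>\<^bsub>B (g n)\<^esub> \<psi> k n (z n))}" for k
    have "finite (E i)" unfolding E_def by (rule approx[OF zn])
    moreover have "finite (E j)"
      unfolding E_def using that by (intro approx order_trans[OF zn]) simp
    moreover have "{n. \<not> good i j n} \<subseteq> E i \<union> E j"
    proof
      fix n assume "n \<in> {n. \<not> good i j n}"
      then have b: "6 / real (Suc i) < nrm (B (g n)) (\<psi> i n (z n) \<ominus>\<^bsub>B (g n)\<^esub> \<psi> j n (z n))"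
        using bad_z[of n] by (simp add: bad_def)
      let ?y = "L (\<lambda>n. c n (z n)) (g n)"
      have "nrm (B (g n)) (\<psi> i n (z n) \<ominus>\<^bsub>B (g n)\<^esub> \<psi> j n (z n)) \<le>
          nrm (B (g n)) (\<psi> i n (z n) \<ominus>\<^bsub>B (g n)\<^esub> ?y) + nrm (B (g n)) (?y \<ominus>\<^bsub>B (g n)\<^esub> \<psi> j n (z n))"
        by (intro B.coord.nrm_minus_triangle \<psi> L_coord bounded[OF zn])
      moreover have "nrm (B (g n)) (\<psi> i n (z n) \<ominus>\<^bsub>B (g n)\<^esub> ?y) = nrm (B (g n)) (?y \<ominus>\<^bsub>B (g n)\<^esub> \<psi> i n (z n))"
        by (intro B.coord.nrm_minus_commute \<psi> L_coord bounded[OF zn])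
      moreover have "3 / real (Suc j) \<le> 3 / real (Suc i)" using that by (intro divide_left_mono) auto
      moreover have "6 / real (Suc i) = 3 / real (Suc i) + 3 / real (Suc i)" by simp
      ultimately show "n \<in> E i \<union> E j" using b unfolding E_def by (simp del: of_nat_Suc) linarith
    qed
    ultimately show ?thesis by (meson finite_UnI finite_subset)
  qed
  have "\<forall>j. \<exists>N. \<forall>n\<ge>N. \<forall>i\<le>j. good i j n"
  proof
    fix j
    have "finite (\<Union>i\<in>{..j}. {n. \<not> good i j n})" using good by blast
    then obtain N where "\<forall>n\<in>(\<Union>i\<in>{..j}. {n. \<not> good i j n}). n < N" using finite_nat_set_iff_bounded by auto
    then show "\<exists>N. \<forall>n\<ge>N. \<forall>i\<le>j. good i j n" by (intro exI[of _ N]) force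
  qed
  then obtain N where N: "\<And>j n i. N j \<le> n \<Longrightarrow> i \<le> j \<Longrightarrow> good i j n" by metis
  \<comment> \<open>For small \<open>n\<close> the set may be empty; the value is relied on only
    from \<open>max i (N i)\<close> on, where \<open>i\<close> belongs to the set.\<close>
  define J where "J n = Max {j. j \<le> n \<and> N j \<le> n}" for n
  have J: "i \<le> J n \<and> N (J n) \<le> n" if "max i (N i) \<le> n" for i n
  proof -
    have fin: "finite {j. j \<le> n \<and> N j \<le> n}" and i: "i \<in> {j. j \<le> n \<and> N j \<le> n}" using that by auto
    show ?thesis using Max_ge[OF fin i] Max_in[OF fin] i unfolding J_def by blast
  qed
  \<comment> \<open>The error \<open>1 / real (Suc n)\<close> tends to zero, so replacing
    \<open>x\<close> by these dense elements keeps its class.\<close>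
  define e where "e n a = (SOME d. nrm (A n) (c n d \<ominus>\<^bsub>A n\<^esub> a) < 1 / real (Suc n))" for n a
  have e: "nrm (A n) (c n (e n a) \<ominus>\<^bsub>A n\<^esub> a) < 1 / real (Suc n)" if "a \<in> carrier (A n)" for n a
    unfolding e_def by (rule someI_ex[OF c_dense[OF that]]) simp
  show thesis
  proof (rule that[of "\<lambda>n a. \<psi> (J n) n (e n a)"])
    fix x and \<epsilon> :: real assume x: "x \<in> A.bounded_seqs" and \<epsilon>: "\<epsilon> > 0"
    obtain K where K: "K \<ge> 0" "\<And>n. nrm (A n) (x n) \<le> K" using A.bounded_seqs_bound[OF x] by metis
    have xc: "x n \<in> carrier (A n)" for n using x by (rule A.bounded_seqs_coord)
    define z where "z n = e n (x n)" for n
    \<comment> \<open>10 is the sum of 1 for replacing \<open>x\<close>, 3 for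
      \<open>\<psi> i\<close>, and 6 for passing to \<open>\<psi> (J n)\<close>, in units of
      \<open>1 / real (Suc i)\<close>; \<open>K + 1\<close> bounds the dense elements.\<close>
    obtain i where i: "K + 1 + 10 / \<epsilon> < real i" using reals_Archimedean2 by blast
    have iK: "K + 1 \<le> real (Suc i)" and i\<epsilon>: "10 / real (Suc i) \<le> \<epsilon>"
    proof -
      have pos: "0 \<le> 10 / \<epsilon>" using \<epsilon> by simp
      then show "K + 1 \<le> real (Suc i)" using i by linarith
      have "10 / \<epsilon> \<le> real (Suc i)" using i K(1) by simp
      then show "10 / real (Suc i) \<le> \<epsilon>" using \<epsilon> by (simp add: field_simps)
    qed
    have zn: "nrm (A n) (c n (z n)) \<le> real (Suc i)" for n
    proof -
      have "nrm (A n) (c n (z n)) \<le> nrm (A n) (c n (z n) \<ominus>\<^bsub>A n\<^esub> x n) + nrm (A n) (x n)"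
        by (rule A.coord.nrm_le_diff[OF c xc])
      moreover have "1 / real (Suc n) \<le> 1" by simp
      ultimately show ?thesis using e[OF xc, of n] K(2)[of n] iK unfolding z_def by linarith
    qed
    define u where "u = (\<lambda>n. c n (z n))"
    have u: "u \<in> A.bounded_seqs" unfolding u_def by (rule bounded[OF zn])
    have "(\<lambda>n. nrm (A n) (u n \<ominus>\<^bsub>A n\<^esub> x n)) \<longlonglongrightarrow> 0"
    proof (rule tendsto_sandwich[OF _ _ tendsto_const LIMSEQ_inverse_real_of_nat])
      show "\<forall>\<^sub>F n in sequentially. 0 \<le> nrm (A n) (u n \<ominus>\<^bsub>A n\<^esub> x n)"
        using c xc by (simp add: A.coord.nrm_nonneg u_def)
      show "\<forall>\<^sub>F n in sequentially. nrm (A n) (u n \<ominus>\<^bsub>A n\<^esub> x n) \<le> inverse (real (Suc n))"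
        using e[OF xc] by (intro always_eventually allI) (auto simp: u_def z_def inverse_eq_divide less_imp_le)
    qed
    then have "reduced_proj B (L u) = reduced_proj B (L x)"
      using A.reduced_proj_eq_iff[OF u x] by (simp add: \<Lambda>_eq_L[symmetric] u x)
    then have "(\<lambda>m. nrm (B m) (L u m \<ominus>\<^bsub>B m\<^esub> L x m)) \<longlonglongrightarrow> 0"
      using B.reduced_proj_eq_iff[OF L_bounded[OF u] L_bounded[OF x]] by simp
    then have "\<forall>\<^sub>F m in cofinite. nrm (B m) (L u m \<ominus>\<^bsub>B m\<^esub> L x m) < 1 / real (Suc i)"
      unfolding cofinite_eq_sequentially by (rule order_tendstoD) simp
    then have "finite {m. \<not> nrm (B m) (L u m \<ominus>\<^bsub>B m\<^esub> L x m) < 1 / real (Suc i)}" (is "finite ?E\<^sub>1")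
      unfolding eventually_cofinite .
    then have "finite (g -` ?E\<^sub>1 \<inter> - F\<^sub>1)" using g(2) by (rule finite_vimage_IntI)
    moreover have "finite {n. 3 / real (Suc i) < nrm (B (g n)) (L u (g n) \<ominus>\<^bsub>B (g n)\<^esub> \<psi> i n (z n))}" (is "finite ?E\<^sub>2")
      unfolding u_def by (rule approx[OF zn])
    moreover have "{n \<in> - F\<^sub>1. \<epsilon> < nrm (B (g n)) (L x (g n) \<ominus>\<^bsub>B (g n)\<^esub> \<psi> (J n) n (e n (x n)))}
        \<subseteq> (g -` ?E\<^sub>1 \<inter> - F\<^sub>1) \<union> ?E\<^sub>2 \<union> {..< max i (N i)}"
    proof
      fix n assume n: "n \<in> {n \<in> - F\<^sub>1. \<epsilon> < nrm (B (g n)) (L x (g n) \<ominus>\<^bsub>B (g n)\<^esub> \<psi> (J n) n (e n (x n)))}"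
      show "n \<in> (g -` ?E\<^sub>1 \<inter> - F\<^sub>1) \<union> ?E\<^sub>2 \<union> {..< max i (N i)}"
      proof (rule ccontr)
        assume not: "n \<notin> (g -` ?E\<^sub>1 \<inter> - F\<^sub>1) \<union> ?E\<^sub>2 \<union> {..< max i (N i)}"
        let ?B = "B (g n)" and ?p = "L x (g n)" and ?q = "L u (g n)" and ?r = "\<psi> i n (z n)" and ?s = "\<psi> (J n) n (z n)"
        have "max i (N i) \<le> n" using not by (simp add: not_less)
        then have "good i (J n) n" using J N by blast
        then have "nrm ?B (?r \<ominus>\<^bsub>?B\<^esub> ?s) \<le> 6 / real (Suc i)" using zn[of n] unfolding good_def by blast
        moreover have "nrm ?B (?q \<ominus>\<^bsub>?B\<^esub> ?p) < 1 / real (Suc i)" "nrm ?B (?q \<ominus>\<^bsub>?B\<^esub> ?r) \<le> 3 / real (Suc i)"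
          using not n by (auto simp del: of_nat_Suc simp: not_less)
        moreover have "nrm ?B (?p \<ominus>\<^bsub>?B\<^esub> ?s) \<le> nrm ?B (?p \<ominus>\<^bsub>?B\<^esub> ?q) + nrm ?B (?q \<ominus>\<^bsub>?B\<^esub> ?s)"
          by (intro B.coord.nrm_minus_triangle \<psi> L_coord u x)
        moreover have "nrm ?B (?q \<ominus>\<^bsub>?B\<^esub> ?s) \<le> nrm ?B (?q \<ominus>\<^bsub>?B\<^esub> ?r) + nrm ?B (?r \<ominus>\<^bsub>?B\<^esub> ?s)"
          by (intro B.coord.nrm_minus_triangle \<psi> L_coord u x)
        moreover have "nrm ?B (?p \<ominus>\<^bsub>?B\<^esub> ?q) = nrm ?B (?q \<ominus>\<^bsub>?B\<^esub> ?p)"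
          by (intro B.coord.nrm_minus_commute L_coord u x)
        moreover have "10 / real (Suc i) = 1 / real (Suc i) + 3 / real (Suc i) + 6 / real (Suc i)"
          by (simp add: add_divide_distrib[symmetric])
        ultimately have "nrm ?B (?p \<ominus>\<^bsub>?B\<^esub> ?s) \<le> \<epsilon>" using i\<epsilon> by linarith
        then show False using n by (simp add: z_def)
      qed
    qed
    ultimately show "finite {n \<in> - F\<^sub>1. \<epsilon> < nrm (B (g n)) (L x (g n) \<ominus>\<^bsub>B (g n)\<^esub> \<psi> (J n) n (e n (x n)))}"
      by (meson finite_UnI finite_lessThan finite_subset)
  qed (rule \<psi>)
qed

text \<open>A sequence whose distance from the lift \<open>L x\<close> tends to zero is bounded and
  has the same class, so both demands on the coordinate map reduce to the limit of \<open>D\<close>,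
  where the finite set \<open>F\<^sub>2\<close> is absorbed.\<close>

theorem asymptotically_algebraic:
  assumes axioms: OCA MA_aleph1
    and sep: "\<And>n. separable_cstar (A n)" "\<And>n. separable_cstar (B n)"
  shows "asymptotically_algebraic A B \<Lambda>"
proof -
  interpret mod_finite_automorphism F by (rule F_automorphism)
  obtain F\<^sub>1 F\<^sub>2 g where F: "finite F\<^sub>1" "finite F\<^sub>2" and bij: "bij_betw g (- F\<^sub>1) (- F\<^sub>2)"
    and g: "\<And>S. \<forall>\<^sub>F m in cofinite. m \<in> F S \<longleftrightarrow> m \<in> g ` (S - F\<^sub>1)"
    using almost_permutation[OF axioms] by blast
  have inj: "inj_on g (- F\<^sub>1)" and img: "g ` (- F\<^sub>1) = - F\<^sub>2" using bij by (auto simp: bij_betw_def)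
  have "\<exists>c :: nat \<Rightarrow> 'a. (\<forall>d. c d \<in> carrier (A n)) \<and> (\<forall>a \<epsilon>. a \<in> carrier (A n) \<longrightarrow> \<epsilon> > 0 \<longrightarrow> (\<exists>d. nrm (A n) (c d \<ominus>\<^bsub>A n\<^esub> a) < \<epsilon>))" for n
    using A.coord.separable_dense_sequence[OF sep(1)[of n]] by metis
  then have "\<exists>c :: nat \<Rightarrow> nat \<Rightarrow> 'a. \<forall>n. (\<forall>d. c n d \<in> carrier (A n)) \<and> (\<forall>a \<epsilon>. a \<in> carrier (A n) \<longrightarrow> \<epsilon> > 0 \<longrightarrow> (\<exists>d. nrm (A n) (c n d \<ominus>\<^bsub>A n\<^esub> a) < \<epsilon>))"
    by (intro choice allI)
  then obtain c :: "nat \<Rightarrow> nat \<Rightarrow> 'a" where c: "\<And>n d. c n d \<in> carrier (A n)"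
    and c_dense: "\<And>n a \<epsilon>. a \<in> carrier (A n) \<Longrightarrow> \<epsilon> > 0 \<Longrightarrow> \<exists>d. nrm (A n) (c n d \<ominus>\<^bsub>A n\<^esub> a) < \<epsilon>"
    by blast
  have "\<exists>b :: nat \<Rightarrow> 'b. (\<forall>d. b d \<in> carrier (B n)) \<and> (\<forall>a \<epsilon>. a \<in> carrier (B n) \<longrightarrow> \<epsilon> > 0 \<longrightarrow> (\<exists>d. nrm (B n) (b d \<ominus>\<^bsub>B n\<^esub> a) < \<epsilon>))" for n
    using B.coord.separable_dense_sequence[OF sep(2)[of n]] by metis
  then have "\<exists>b :: nat \<Rightarrow> nat \<Rightarrow> 'b. \<forall>n. (\<forall>d. b n d \<in> carrier (B n)) \<and> (\<forall>a \<epsilon>. a \<in> carrier (B n) \<longrightarrow> \<epsilon> > 0 \<longrightarrow> (\<exists>d. nrm (B n) (b n d \<ominus>\<^bsub>B n\<^esub> a) < \<epsilon>))"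
    by (intro choice allI)
  then obtain b :: "nat \<Rightarrow> nat \<Rightarrow> 'b" where b: "\<And>n d. b n d \<in> carrier (B n)"
    and b_dense: "\<And>n a \<epsilon>. a \<in> carrier (B n) \<Longrightarrow> \<epsilon> > 0 \<Longrightarrow> \<exists>d. nrm (B n) (b n d \<ominus>\<^bsub>B n\<^esub> a) < \<epsilon>"
    by blast
  have "\<exists>\<psi>. (\<forall>n d. \<psi> n d \<in> carrier (B (g n))) \<and> (\<forall>z :: nat \<Rightarrow> nat. (\<forall>n. nrm (A n) (c n (z n)) \<le> real (Suc j)) \<longrightarrow>
      finite {n. 3 / real (Suc j) < nrm (B (g n)) (L (\<lambda>n. c n (z n)) (g n) \<ominus>\<^bsub>B (g n)\<^esub> \<psi> n (z n))})" for j
  proof -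
    obtain \<psi> :: "nat \<Rightarrow> nat \<Rightarrow> 'b" where "\<And>n d. \<psi> n d \<in> carrier (B (g n))"
      "\<And>z :: nat \<Rightarrow> nat. (\<And>n. nrm (A n) (c n (z n)) \<le> real (Suc j)) \<Longrightarrow>
        finite {n. 3 * (1 / real (Suc j)) < nrm (B (g n)) (L (\<lambda>n. c n (z n)) (g n) \<ominus>\<^bsub>B (g n)\<^esub> \<psi> n (z n))}"
      by (rule coordinatewise_approximation[OF axioms F(1) inj g, of c b "1 / real (Suc j)" "real (Suc j)"])
        (use c b b_dense in auto)
    then show ?thesis by (intro exI[of _ \<psi>]) simp
  qed
  then have "\<exists>\<psi>. \<forall>j. (\<forall>n d. \<psi> j n d \<in> carrier (B (g n))) \<and> (\<forall>z :: nat \<Rightarrow> nat. (\<forall>n. nrm (A n) (c n (z n)) \<le> real (Suc j)) \<longrightarrow>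
      finite {n. 3 / real (Suc j) < nrm (B (g n)) (L (\<lambda>n. c n (z n)) (g n) \<ominus>\<^bsub>B (g n)\<^esub> \<psi> j n (z n))})"
    by (intro choice allI)
  then obtain \<psi> :: "nat \<Rightarrow> nat \<Rightarrow> nat \<Rightarrow> 'b" where \<psi>: "\<And>j n d. \<psi> j n d \<in> carrier (B (g n))"
    "\<And>j (z :: nat \<Rightarrow> nat). (\<And>n. nrm (A n) (c n (z n)) \<le> real (Suc j)) \<Longrightarrow>
      finite {n. 3 / real (Suc j) < nrm (B (g n)) (L (\<lambda>n. c n (z n)) (g n) \<ominus>\<^bsub>B (g n)\<^esub> \<psi> j n (z n))}"
    by blast
  obtain \<phi> where \<phi>: "\<And>n a. \<phi> n a \<in> carrier (B (g n))"
    "\<And>x \<epsilon>. x \<in> A.bounded_seqs \<Longrightarrow> \<epsilon> > 0 \<Longrightarrow>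
      finite {n \<in> - F\<^sub>1. \<epsilon> < nrm (B (g n)) (L x (g n) \<ominus>\<^bsub>B (g n)\<^esub> \<phi> n (x n))}"
    using diagonal_approximation[OF F(1) inj c c_dense \<psi>] by blast
  have lift: "coordinate_map B F\<^sub>1 F\<^sub>2 g \<phi> x \<in> B.bounded_seqs \<and>
      reduced_proj B (coordinate_map B F\<^sub>1 F\<^sub>2 g \<phi> x) = \<Lambda> (reduced_proj A x)" if x: "x \<in> A.bounded_seqs" for x
  proof -
    define y where "y = coordinate_map B F\<^sub>1 F\<^sub>2 g \<phi> x"
    have y_g: "y (g n) = \<phi> n (x n)" if "n \<in> - F\<^sub>1" for n
    proof -
      have "g n \<notin> F\<^sub>2" using img that by blast
      then show ?thesis using inv_into_f_f[OF inj that] by (simp add: y_def coordinate_map_def)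
    qed
    have yc: "y m \<in> carrier (B m)" for m
    proof (cases "m \<in> F\<^sub>2")
      case False
      then obtain n where "n \<in> - F\<^sub>1" "m = g n" using img by blast
      then show ?thesis using y_g \<phi>(1) by simp
    qed (simp add: y_def coordinate_map_def)
    define D where "D m = nrm (B m) (L x m \<ominus>\<^bsub>B m\<^esub> y m)" for m
    have D0: "0 \<le> D m" for m unfolding D_def by (intro B.coord.nrm_nonneg B.coord.minus_closed yc L_coord x)
    have D: "D \<longlonglongrightarrow> 0"
    proof (rule order_tendstoI)
      fix \<epsilon> :: real assume "\<epsilon> < 0"
      then show "\<forall>\<^sub>F m in sequentially. \<epsilon> < D m" using D0 by (intro always_eventually) (auto intro: less_le_trans)
    next
      fix \<epsilon> :: real assume \<epsilon>: "\<epsilon> > 0"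
      have "finite (F\<^sub>2 \<union> g ` {n \<in> - F\<^sub>1. \<epsilon> / 2 < nrm (B (g n)) (L x (g n) \<ominus>\<^bsub>B (g n)\<^esub> \<phi> n (x n))})"
        using F(2) \<phi>(2)[OF x, of "\<epsilon> / 2"] \<epsilon> by simp
      moreover have "{m. \<not> D m < \<epsilon>} \<subseteq> F\<^sub>2 \<union> g ` {n \<in> - F\<^sub>1. \<epsilon> / 2 < nrm (B (g n)) (L x (g n) \<ominus>\<^bsub>B (g n)\<^esub> \<phi> n (x n))}"
      proof
        fix m assume m: "m \<in> {m. \<not> D m < \<epsilon>}"
        show "m \<in> F\<^sub>2 \<union> g ` {n \<in> - F\<^sub>1. \<epsilon> / 2 < nrm (B (g n)) (L x (g n) \<ominus>\<^bsub>B (g n)\<^esub> \<phi> n (x n))}"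
        proof (cases "m \<in> F\<^sub>2")
          case False
          then obtain n where n: "n \<in> - F\<^sub>1" "m = g n" using img by blast
          then have "\<epsilon> / 2 < nrm (B (g n)) (L x (g n) \<ominus>\<^bsub>B (g n)\<^esub> \<phi> n (x n))"
            using m \<epsilon> y_g[OF n(1)] by (simp add: D_def)
          then show ?thesis using n by blast
        qed simp
      qed
      ultimately show "\<forall>\<^sub>F m in sequentially. D m < \<epsilon>"
        unfolding cofinite_eq_sequentially[symmetric] eventually_cofinite by (rule rev_finite_subset)
    qed
    obtain K where K: "\<And>m. D m \<le> K" using convergent_imp_Bseq[OF convergentI[OF D]] unfolding Bseq_def by (metis abs_ge_self order_trans real_norm_def)
    obtain K' where K': "K' \<ge> 0" "\<And>m. nrm (B m) (L x m) \<le> K'" using B.bounded_seqs_bound[OF L_bounded[OF x]] by metis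
    have y: "y \<in> B.bounded_seqs"
    proof (rule B.bounded_seqsI[where K = "K + K'", OF yc])
      fix m
      have "nrm (B m) (y m) \<le> nrm (B m) (y m \<ominus>\<^bsub>B m\<^esub> L x m) + nrm (B m) (L x m)"
        by (intro B.coord.nrm_le_diff yc L_coord x)
      also have "nrm (B m) (y m \<ominus>\<^bsub>B m\<^esub> L x m) = D m"
        unfolding D_def by (intro B.coord.nrm_minus_commute yc L_coord x)
      finally show "nrm (B m) (y m) \<le> K + K'" using K[of m] K'(2)[of m] by linarith
    qed
    have "reduced_proj B (L x) = reduced_proj B y"
      using B.reduced_proj_eq_iff[OF L_bounded[OF x] y] D unfolding D_def by simp
    then show ?thesis using y \<Lambda>_eq_L[OF x] by (simp add: y_def)
  qed
  show ?thesis
    unfolding asymptotically_algebraic_def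
    by (rule exI[of _ F\<^sub>1], rule exI[of _ F\<^sub>2], rule exI[of _ g], rule exI[of _ \<phi>])
      (use F bij \<phi>(1) lift in blast)
qed

end

theorem theorem6p1:
  fixes A :: "nat \<Rightarrow> 'a cstar" and B :: "nat \<Rightarrow> 'b cstar"
    and \<Lambda> :: "(nat \<Rightarrow> 'a) set \<Rightarrow> (nat \<Rightarrow> 'b) set"
  assumes "OCA" and "MA_aleph1"
    and "\<And>n. unital_cstar_algebra (A n)" and "\<And>n. unital_cstar_algebra (B n)"
    and "\<And>n. separable_cstar (A n)" and "\<And>n. separable_cstar (B n)"
    and "\<And>n. no_nontrivial_central_projections (A n)"
    and "\<And>n. no_nontrivial_central_projections (B n)"
    and "\<And>n. metric_approximation_property TYPE('h) (A n)"
    and "\<Lambda> \<in> cstar_iso (reduced_prod A) (reduced_prod B)"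
  shows "asymptotically_algebraic A B \<Lambda>"
proof -
  have "\<Lambda> \<in> ring_iso (reduced_prod A) (reduced_prod B)" using assms(10) by (simp add: cstar_iso_def)
  then interpret reduced_prod_iso A B \<Lambda>
    using assms(3,4,7,8) by (intro reduced_prod_iso.intro cstar_family.intro reduced_prod_iso_axioms.intro)
  show ?thesis using assms(1,2,5,6) by (rule asymptotically_algebraic)
qed

end
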